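(* Let $m$ be a positive integer and let $n$ be a positive squarefree integer relatively prime to $m$. Let $\mathcal{L}\subset V(\mathbb{Z})$ be a set defined by congruence conditions modulo $m$. Then for real $X,Y>0$, each choice of sign $\pm$, and every $\epsilon>0$, \[ \#\{f\in\mathcal{L}\cap\Sigma_n: 0<\pm\Delta(f)<X,\ h(f)<Y\}=\nu(\mathcal{L})\,\nu(\Sigma_n)\,\mathrm{Vol}\bigl(V(\mathbb{R})^\pm_{X,Y}\bigr)+O_\epsilon\bigl(Y^3m/n^{1-\epsilon}+Y^2mn^\epsilon\bigr). \]
   Context: For a ring $R$, $V(R)$ is the set of monic cubic polynomials $x^3+tx^2+Ax+B$ with $t\in\{-1,0,1\}$ and $A,B\in R$; $\Delta(f)$ is the discriminant and $h(f)$ is the maximum absolute value of the complex roots of $f$. For $f\in V(\mathbb{Z})$ with $\Delta(f)\ne0$, $\mathrm{ind}(f)$ is the index of $\mathbb{Z}[x]/(f)$ in the ring of integral elements of $\mathbb{Q}[x]/(f)$. $\Sigma_n$ is the set of $f\in V(\mathbb{Z})$ with $\Delta(f)\neq0$ and $n\mid\mathrm{ind}(f)$. For $S\subset V(\mathbb{Z})$, $\nu(S)$ is the measure of the closure of $S$ in $V(\hat{\mathbb{Z}})=\{-1,0,1\}\times\hat{\mathbb{Z}}^2$ with respect to the probability measure (uniform in $t$, normalized Haar in $(A,B)$). $V(\mathbb{R})^\pm_{X,Y}$ is the set of $f\in V(\mathbb{R})$ with $\pm\Delta(f)>0$, $|\Delta(f)|<X$ and $h(f)<Y$; its volume is taken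 with respect to counting measure in $t$ times Lebesgue measure in $(A,B)$. *)

theory Defs
  imports "HOL-Analysis.Analysis" "HOL-Computational_Algebra.Polynomial"
    "HOL-Computational_Algebra.Squarefree"
begin

text \<open>An element (t,A,B) of V(Z) stands for the polynomial x^3 + t x^2 + A x + B.\<close>

definition VZ :: "(int \<times> int \<times> int) set" where
  "VZ = {(t, a, b). t \<in> {-1, 0, 1}}"

definition cubic_poly :: "'a::comm_ring_1 \<Rightarrow> 'a \<Rightarrow> 'a \<Rightarrow> 'a poly" where
  "cubic_poly t a b = [:b, a, t, 1:]"

definition disc :: "'a::comm_ring_1 \<Rightarrow> 'a \<Rightarrow> 'a \<Rightarrow> 'a" where
  "disc t a b = t^2 * a^2 - 4 * a^3 - 4 * t^3 * b - 27 * b^2 + 18 * t * a * b"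

definition hgt :: "real \<Rightarrow> real \<Rightarrow> real \<Rightarrow> real" where
  "hgt t a b = Max (cmod ` {z. poly (cubic_poly (complex_of_real t) (complex_of_real a)
                                                 (complex_of_real b)) z = 0})"

text \<open>Q[x]/(f) is represented by rational polynomials of degree < deg f (reduced
  representatives); an element is integral iff it is a root of a monic integer polynomial,
  i.e. f divides P(g) for some monic P in Z[x].\<close>
definition integral_elts :: "int poly \<Rightarrow> rat poly set" where
  "integral_elts f = {g. degree g < degree f \<and>
      (\<exists>P::int poly. lead_coeff P = 1 \<and>
         map_poly rat_of_int f dvd pcompose (map_poly rat_of_int P) g)}"

text \<open>ind(f): index of Z[x]/(f) (reduced polynomials with integer coefficients) in the
  ring of integral elements, i.e. the cardinality of the additive quotient.\<close>
definition ind :: "int poly \<Rightarrow> nat" where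
  "ind f = card (integral_elts f //
      {(g, h). g \<in> integral_elts f \<and> h \<in> integral_elts f \<and> (\<forall>i. coeff (g - h) i \<in> \<int>)})"

definition Sigma_n :: "nat \<Rightarrow> (int \<times> int \<times> int) set" where
  "Sigma_n n = {(t, a, b) \<in> VZ. disc t a b \<noteq> 0 \<and> n dvd ind (cubic_poly t a b)}"

definition defined_mod :: "nat \<Rightarrow> (int \<times> int \<times> int) set \<Rightarrow> bool" where
  "defined_mod m L \<longleftrightarrow> L \<subseteq> VZ \<and>
     (\<forall>t a b a' b'. (t, a, b) \<in> VZ \<longrightarrow> a mod int m = a' mod int m \<longrightarrow> b mod int m = b' mod int m \<longrightarrow>
        ((t, a, b) \<in> L \<longleftrightarrow> (t, a', b') \<in> L))"

text \<open>nu(S): Haar measure of the closure of S in {-1,0,1} x Zhat^2, expressed as the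
  infimum over N of the proportion of residue classes mod N met by S.\<close>
definition nu :: "(int \<times> int \<times> int) set \<Rightarrow> real" where
  "nu S = (INF N \<in> {0::nat<..}.
      real (card ((\<lambda>(t, a, b). (t, a mod int N, b mod int N)) ` S)) / (3 * real N ^ 2))"

definition Vol :: "int \<Rightarrow> real \<Rightarrow> real \<Rightarrow> real" where
  "Vol s X Y = (\<Sum>t\<in>{-1, 0, 1::int}. measure lborel
      {(a::real, b::real). 0 < of_int s * disc (of_int t) a b \<and>
          \<bar>disc (of_int t) a b\<bar> < X \<and> hgt (of_int t) a b < Y})"

definition count :: "(int \<times> int \<times> int) set \<Rightarrow> nat \<Rightarrow> int \<Rightarrow> real \<Rightarrow> real \<Rightarrow> nat" where
  "count L n s X Y = card {(t, a, b) \<in> L \<inter> Sigma_n n.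
      0 < s * disc t a b \<and> real_of_int (s * disc t a b) < X \<and>
      hgt (of_int t) (of_int a) (of_int b) < Y}"

end

(* For squarefree n, n divides ind(f) iff f(r) = 0 mod n^2 and f'(r) = 0 mod n for some r, which is
   then unique modulo n. Hence the members of Sigma_n, restricted to a residue class modulo m, are
   counted by fixing r: the coefficient A then runs through one class modulo n m and, for each A,
   B through one class modulo n^2 m. The region of bounded height and discriminant is met by every
   line parallel to an axis in boundedly many intervals, so the B can be counted up to O(1) for
   each A, and the sum over A of the lengths of the slices can be compared with the area by
   exchanging the roles of A and B.

   Since L may distribute unevenly over t = -1, 0, 1, one also needs that the three volumes agree up to
   O(Y^3). Translating the roots by t/3 = c preserves the discriminant and turns the condition
   |root| < Y into |root - c| < Y. For fixed A this moves the two ends of a B-interval by nearly opposite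
   amounts O(Y^2), while the set cut out by the discriminant is symmetric in B. So the slice length
   changes to second order only, unless an end is close to the boundary of that set, which by
   monotonicity in A happens only for a set of A of measure O(Y). *)
theory Submission
  imports "HOL-Algebra.Multiplicative_Group" "HOL-Algebra.Sylow" "Jordan_Normal_Form.Char_Poly"
    "HOL-Number_Theory.Cong" Defs
begin

section \<open>Algebraic integers\<close>

text \<open>The error terms depend on the order of summation. For fixed r and fixed residues of (A,
  B) modulo m the main term is area / (n^3 m^2), and there are up to n m^2 such choices. Bounding
  the number of A in each choice by O(Y^2 / (n m) + 1) would leave n m^2 in the total. So the sums
  over r and A are exchanged: for given A only the O(n^\<epsilon>) zeros r of f' modulo n occur,
  which gives Y^2 m n^\<epsilon>. Exchanging A and B costs Y^3 / (n^2 m) per choice, in all Y^3 m /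
  n. The comparison of traces has to save a factor Y: ends of intervals that move by O(Y^2), over a
  range of A of length O(Y^2), give only O(Y^4) to first order. The index criterion has to cover the
  primes 2 and 3 and reducible f. It is therefore proved with algebraic integers in the complex
  numbers, by evaluation at the three distinct roots. The height condition is rewritten as
  polynomial inequalities of low degree in A and B, so that its line sections are visibly intervals.
  For Y < 1 an O(1) error is no longer covered by Y^2 m n^\<epsilon>, but then no polynomial is
  counted.\<close>

lemma algebraic_int_if_finite_module:
  fixes x :: complex and v :: "nat \<Rightarrow> complex" and c :: "nat \<Rightarrow> nat \<Rightarrow> int"
  assumes act: "\<And>i. i < n \<Longrightarrow> x * v i = (\<Sum>j<n. of_int (c i j) * v j)"
    and nz: "i0 < n" "v i0 \<noteq> 0"
  shows "algebraic_int x"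
proof -
  define M where "M = Matrix.mat n n (\<lambda>(i, j). c i j)"
  have M: "M \<in> carrier_mat n n"
    by (simp add: M_def)
  define MC where "MC = map_mat (of_int :: int \<Rightarrow> complex) M"
  have MC: "MC \<in> carrier_mat n n"
    using M by (simp add: MC_def)
  \<comment> \<open>The relations say that v is an eigenvector of an integer matrix; x is then a
    root of its characteristic polynomial, which is monic with integer coefficients.\<close>
  have "eigenvector MC (Matrix.vec n v) x"
    unfolding eigenvector_def
  proof (intro conjI)
    show "Matrix.vec n v \<in> carrier_vec (dim_row MC)" using MC by simp
    show "Matrix.vec n v \<noteq> 0\<^sub>v (dim_row MC)"
      using nz MC by (metis carrier_matD(1) index_vec index_zero_vec(1))
    show "MC *\<^sub>v Matrix.vec n v = x \<cdot>\<^sub>v Matrix.vec n v"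
    proof (rule eq_vecI)
      fix i assume "i < dim_vec (x \<cdot>\<^sub>v Matrix.vec n v)"
      then have i: "i < n" by simp
      then have "vec_index (MC *\<^sub>v Matrix.vec n v) i = (\<Sum>j<n. of_int (c i j) * v j)"
        using MC by (simp add: MC_def M_def scalar_prod_def atLeast0LessThan)
      with act[OF i] show "vec_index (MC *\<^sub>v Matrix.vec n v) i = vec_index (x \<cdot>\<^sub>v Matrix.vec n v) i"
        using i by simp
    qed (use MC in simp)
  qed
  then have "eigenvalue MC x"
    by (auto simp: eigenvalue_def)
  then have "poly (char_poly MC) x = 0"
    using eigenvalue_root_char_poly[OF MC] by simp
  moreover have "char_poly MC = map_poly of_int (char_poly M)"
    unfolding MC_def by (rule of_int_hom.char_poly_hom[OF M])
  moreover have "lead_coeff (char_poly M) = 1"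
    using degree_monic_char_poly[OF M] by auto
  ultimately show ?thesis
    unfolding algebraic_int_altdef_ipoly by auto
qed

lemma algebraic_int_power_reduce:
  fixes x :: complex
  assumes "algebraic_int x"
  obtains d and e :: "nat \<Rightarrow> int" where "d > 0" "x ^ d = (\<Sum>i<d. of_int (e i) * x ^ i)"
proof -
  obtain p :: "int poly" where p: "poly (map_poly of_int p) x = 0" "lead_coeff p = 1"
    using assms unfolding algebraic_int_altdef_ipoly by auto
  have deg: "degree p > 0"
  proof (rule ccontr)
    assume "\<not> degree p > 0"
    then have "p = 1" using p(2) by (metis degree_eq_zeroE gr0I lead_coeff_pCons(2) one_pCons pCons_0_0 coeff_pCons_0 degree_pCons_0)
    with p(1) show False by simp
  qed
  have "0 = (\<Sum>i\<le>degree p. of_int (coeff p i) * x ^ i)"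
    using p(1) by (simp add: poly_altdef degree_map_poly coeff_map_poly)
  also have "\<dots> = (\<Sum>i<degree p. of_int (coeff p i) * x ^ i) + x ^ degree p"
    using p(2) by (simp add: lessThan_Suc_atMost[symmetric])
  finally have "x ^ degree p = (\<Sum>i<degree p. of_int (- coeff p i) * x ^ i)"
    by (simp add: sum_negf eq_neg_iff_add_eq_0 add.commute)
  with deg show thesis using that[of "degree p" "\<lambda>i. - coeff p i"] by blast
qed

text \<open>The monomials x^i y^j with i < d, j < e, enumerated as i * e + j, span a module
  that is stable under multiplication by x and y.\<close>

lemma algebraic_int_plus_times_aux:
  fixes x y z :: complex
  assumes x: "algebraic_int x" and y: "algebraic_int y"
    and z: "z = x + y \<or> z = x * y"
  shows "algebraic_int z"
proof -
  obtain d and a :: "nat \<Rightarrow> int" where d: "d > 0" "x ^ d = (\<Sum>i<d. of_int (a i) * x ^ i)"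
    using algebraic_int_power_reduce[OF x] .
  obtain e and b :: "nat \<Rightarrow> int" where e: "e > 0" "y ^ e = (\<Sum>i<e. of_int (b i) * y ^ i)"
    using algebraic_int_power_reduce[OF y] .
  define v where "v = (\<lambda>k. x ^ (k div e) * y ^ (k mod e))"
  define S where "S = {w :: complex. \<exists>c::nat \<Rightarrow> int. w = (\<Sum>k<d * e. of_int (c k) * v k)}"
  have S_add: "w + w' \<in> S" if "w \<in> S" "w' \<in> S" for w w'
  proof -
    from that obtain c c' :: "nat \<Rightarrow> int" where "w = (\<Sum>k<d * e. of_int (c k) * v k)"
      "w' = (\<Sum>k<d * e. of_int (c' k) * v k)" by (auto simp: S_def)
    then have "w + w' = (\<Sum>k<d * e. of_int (c k + c' k) * v k)"
      by (simp add: sum.distrib algebra_simps)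
    then show ?thesis unfolding S_def by (intro CollectI exI)
  qed
  have S_scale: "of_int r * w \<in> S" if "w \<in> S" for w r
  proof -
    from that obtain c :: "nat \<Rightarrow> int" where "w = (\<Sum>k<d * e. of_int (c k) * v k)"
      by (auto simp: S_def)
    then have "of_int r * w = (\<Sum>k<d * e. of_int (r * c k) * v k)"
      by (simp add: sum_distrib_left mult.assoc)
    then show ?thesis unfolding S_def by (intro CollectI exI)
  qed
  have S_0: "0 \<in> S"
    unfolding S_def by (intro CollectI exI[of _ "\<lambda>_. 0"]) simp
  have S_sum: "(\<Sum>i\<in>I. of_int (f i) * g i) \<in> S" if "finite I" "\<And>i. i \<in> I \<Longrightarrow> g i \<in> S" for I :: "nat set" and f g
    using that by (induction I rule: finite_induct) (auto intro: S_0 S_add S_scale)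
  have basis: "x ^ i * y ^ j \<in> S" if "i < d" "j < e" for i j
  proof -
    have lt: "i * e + j < d * e"
      
      using mult_le_mono1[of "Suc i" d e] that by simp
    have "v (i * e + j) = x ^ i * y ^ j"
      using that by (simp add: v_def)
    also have "v (i * e + j) = (\<Sum>k<d * e. of_int (if k = i * e + j then 1 else 0) * v k)"
      
    proof -
      have "(\<Sum>k<d * e. of_int (if k = i * e + j then 1 else 0) * v k) =
            (\<Sum>k<d * e. if k = i * e + j then v k else 0)"
        by (rule sum.cong) auto
      then show ?thesis using lt by simp
    qed
    finally show ?thesis unfolding S_def by (intro CollectI exI) (rule sym)
  qed
  have xS: "x * (x ^ i * y ^ j) \<in> S" if "i < d" "j < e" for i j
  proof (cases "Suc i < d")
    case True
    then show ?thesis using basis[of "Suc i" j] that by (simp add: mult.assoc)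
  next
    case False
    then have "Suc i = d" using that by simp
    then have "x * (x ^ i * y ^ j) = x ^ d * y ^ j"
      by (metis mult.assoc power_Suc)
    also have "\<dots> = (\<Sum>i<d. of_int (a i) * (x ^ i * y ^ j))"
      by (simp add: d(2) sum_distrib_right mult.assoc)
    also have "\<dots> \<in> S" by (rule S_sum) (use basis that in auto)
    finally show ?thesis .
  qed
  have yS: "y * (x ^ i * y ^ j) \<in> S" if "i < d" "j < e" for i j
  proof (cases "Suc j < e")
    case True
    then show ?thesis using basis[of i "Suc j"] that by (simp add: ac_simps)
  next
    case False
    then have "Suc j = e" using that by simp
    then have "y * (x ^ i * y ^ j) = y ^ e * x ^ i"
      by (metis mult.assoc mult.commute power_Suc)
    also have "\<dots> = (\<Sum>j<e. of_int (b j) * (x ^ i * y ^ j))"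
      by (simp add: e(2) sum_distrib_left sum_distrib_right ac_simps)
    also have "\<dots> \<in> S" by (rule S_sum) (use basis that in auto)
    finally show ?thesis .
  qed
  have vS: "v k \<in> S" "x * v k \<in> S" "y * v k \<in> S" if "k < d * e" for k
  proof -
    have "k div e < d" "k mod e < e"
      using that e(1) by (auto simp: less_mult_imp_div_less)
    then show "v k \<in> S" "x * v k \<in> S" "y * v k \<in> S"
      unfolding v_def by (auto intro: basis xS yS)
  qed
  have S_mult: "u * w \<in> S" if "w \<in> S" and u: "\<And>k. k < d * e \<Longrightarrow> u * v k \<in> S" for u w
  proof -
    from that obtain c :: "nat \<Rightarrow> int" where "w = (\<Sum>k<d * e. of_int (c k) * v k)"
      by (auto simp: S_def)
    then have "u * w = (\<Sum>k<d * e. of_int (c k) * (u * v k))"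
      by (simp add: sum_distrib_left mult.left_commute)
    also have "\<dots> \<in> S" by (rule S_sum) (use u in auto)
    finally show ?thesis .
  qed
  have "\<exists>c::nat \<Rightarrow> int. z * v k = (\<Sum>j<d * e. of_int (c j) * v j)" if "k < d * e" for k
  proof -
    have "x * v k + y * v k \<in> S" "x * (y * v k) \<in> S"
      using vS[OF that] vS by (auto intro: S_add S_mult)
    then have "z * v k \<in> S" using z by (auto simp: distrib_right mult.assoc)
    then show ?thesis by (simp add: S_def)
  qed
  then obtain c :: "nat \<Rightarrow> nat \<Rightarrow> int"
    where "\<And>k. k < d * e \<Longrightarrow> z * v k = (\<Sum>j<d * e. of_int (c k j) * v j)"
    by metis
  moreover have "0 < d * e" "v 0 \<noteq> 0" using d e by (auto simp: v_def)
  ultimately show ?thesis by (rule algebraic_int_if_finite_module)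
qed

lemma algebraic_int_plus:
  "algebraic_int x \<Longrightarrow> algebraic_int y \<Longrightarrow> algebraic_int (x + y :: complex)"
  by (rule algebraic_int_plus_times_aux[of x y]) auto

lemma algebraic_int_times:
  "algebraic_int x \<Longrightarrow> algebraic_int y \<Longrightarrow> algebraic_int (x * y :: complex)"
  by (rule algebraic_int_plus_times_aux[of x y]) auto

lemma algebraic_int_diff:
  "algebraic_int x \<Longrightarrow> algebraic_int y \<Longrightarrow> algebraic_int (x - y :: complex)"
  using algebraic_int_plus[of x "- y"] by simp

lemma algebraic_int_power:
  "algebraic_int (x :: complex) \<Longrightarrow> algebraic_int (x ^ k)"
  by (induction k) (auto intro: algebraic_int_times)

lemmas algebraic_int_ring = algebraic_int_plus algebraic_int_times algebraic_int_diff
  algebraic_int_of_int algebraic_int_power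

text \<open>Cauchy's theorem for the finite group G / H: a prime p divides the order iff some coset
  has order p. \<open>G\<close> and \<open>H\<close> are subsets of a ring that are closed under
  subtraction, so that p g can be written as a ring product.\<close>

lemma prime_dvd_card_quotient_iff:
  fixes G H :: "'a::comm_ring_1 set" and p :: nat
  defines "R \<equiv> {(g, h). g \<in> G \<and> h \<in> G \<and> g - h \<in> H}"
  assumes G: "0 \<in> G" "\<And>g h. g \<in> G \<Longrightarrow> h \<in> G \<Longrightarrow> g - h \<in> G"
    and H: "H \<subseteq> G" "0 \<in> H" "\<And>g h. g \<in> H \<Longrightarrow> h \<in> H \<Longrightarrow> g - h \<in> H"
    and fin: "finite (G // R)" and p: "prime p"
  shows "p dvd card (G // R) \<longleftrightarrow> (\<exists>g\<in>G. g \<notin> H \<and> of_nat p * g \<in> H)"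
proof -
  have Gm: "- g \<in> G" if "g \<in> G" for g using G(2)[OF G(1) that] by simp
  have Ga: "g + h \<in> G" if "g \<in> G" "h \<in> G" for g h
    using G(2)[OF that(1) Gm[OF that(2)]] by simp
  have Hm: "- g \<in> H" if "g \<in> H" for g using H(3)[OF H(2) that] by simp
  have Ha: "g + h \<in> H" if "g \<in> H" "h \<in> H" for g h
    using H(3)[OF that(1) Hm[OF that(2)]] by simp
  define M where "M = \<lparr>carrier = G, monoid.mult = (+), one = 0 :: 'a\<rparr>"
  have [simp]: "carrier M = G" "x \<otimes>\<^bsub>M\<^esub> y = x + y" "\<one>\<^bsub>M\<^esub> = 0" for x y
    by (simp_all add: M_def)
  interpret M: comm_group M
  proof (rule comm_groupI)
    fix x assume "x \<in> carrier M"
    then show "\<exists>y\<in>carrier M. y \<otimes>\<^bsub>M\<^esub> x = \<one>\<^bsub>M\<^esub>"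
      by (intro bexI[of _ "- x"]) (auto intro: Gm)
  qed (auto simp: G Ga algebra_simps)
  have inv: "inv\<^bsub>M\<^esub> x = - x" if "x \<in> G" for x
    using that by (intro M.inv_equality) (auto intro: Gm)
  have sub: "subgroup H M"
    
  proof (rule M.subgroupI)
    show "H \<subseteq> carrier M" "H \<noteq> {}" using H by auto
    show "inv\<^bsub>M\<^esub> g \<in> H" if "g \<in> H" for g using that H(1) inv[of g] Hm[of g] by auto
    show "g \<otimes>\<^bsub>M\<^esub> h \<in> H" if "g \<in> H" "h \<in> H" for g h using that Ha by simp
  qed
  interpret N: normal H M
    by (rule M.subgroup_imp_normal[OF sub])
  define Q where "Q = M Mod H"
  interpret Q: group Q unfolding Q_def by (rule N.factorgroup_is_group)
  have cos: "H #>\<^bsub>M\<^esub> g = R `` {g}" if "g \<in> G" for g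
  proof (intro equalityI subsetI)
    fix x assume "x \<in> H #>\<^bsub>M\<^esub> g"
    then obtain h where h: "h \<in> H" "x = h + g" by (auto simp: r_coset_def)
    then show "x \<in> R `` {g}" using that H(1) Hm[of h] Ga[of h g] by (auto simp: R_def)
  next
    fix x assume "x \<in> R `` {g}"
    then have x: "x \<in> G" "g - x \<in> H" by (auto simp: R_def)
    then have "x - g \<in> H" using Hm by force
    then have "\<exists>h\<in>H. x = h + g" by (intro bexI[of _ "x - g"]) simp_all
    then show "x \<in> H #>\<^bsub>M\<^esub> g" by (auto simp: r_coset_def)
  qed
  have carr: "carrier Q = G // R"
    unfolding Q_def carrier_FactGroup quotient_def by (auto simp: cos)
  have finQ: "finite (carrier Q)" and ordQ: "Coset.order Q = card (G // R)"
    using fin by (auto simp: carr Coset.order_def)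
  have pow: "g [^]\<^bsub>M\<^esub> k = of_nat k * g" for g and k :: nat
    by (induction k) (auto simp: algebra_simps)
  have powQ: "(H #>\<^bsub>M\<^esub> g) [^]\<^bsub>Q\<^esub> k = H #>\<^bsub>M\<^esub> (of_nat k * g)" if "g \<in> G" for g and k :: nat
    using N.FactGroup_pow[of g k] that by (simp add: Q_def pow)
  have oneQ: "\<one>\<^bsub>Q\<^esub> = H" by (simp add: Q_def)
  have triv: "H #>\<^bsub>M\<^esub> g = H \<longleftrightarrow> g \<in> H" if "g \<in> G" for g
    using M.coset_join2[OF _ sub, of g] M.coset_join1[OF _ _ sub, of g] that H(1) by auto
  have mG: "of_nat k * g \<in> G" if "g \<in> G" for g k
    by (induction k) (auto simp: algebra_simps G(1) intro: Ga that)
  show ?thesis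
  proof
    assume "p dvd card (G // R)"
    then obtain r where "Coset.order Q = p ^ 1 * r" by (auto simp: ordQ)
    then obtain K where K: "subgroup K Q" "card K = p"
      using sylow_thm[OF p Q.group_axioms _ finQ, of 1 r] by auto
    interpret K: group "Q\<lparr>carrier := K\<rparr>" by (rule Q.subgroup_imp_group[OF K(1)])
    have "p \<ge> 2" using p by (rule prime_ge_2_nat)
    then have "\<not> K \<subseteq> {H}" using K(2) card_mono[of "{H}" K] by auto
    then obtain c where c: "c \<in> K" "c \<noteq> H" by auto
    then have "c \<in> carrier Q" using K(1) subgroup.subset by blast
    then obtain g where g: "g \<in> G" "c = H #>\<^bsub>M\<^esub> g"
      by (auto simp: Q_def carrier_FactGroup)
    have "c [^]\<^bsub>Q\<lparr>carrier := K\<rparr>\<^esub> p = \<one>\<^bsub>Q\<^esub>"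
      using K.pow_order_eq_1[of c] c K(2) by (simp add: Coset.order_def)
    then have "c [^]\<^bsub>Q\<^esub> p = H"
      using Q.nat_pow_consistent[of c p K] oneQ by simp
    then have "of_nat p * g \<in> H"
      using g powQ triv mG by simp
    moreover have "g \<notin> H" using c(2) g triv by simp
    ultimately show "\<exists>g\<in>G. g \<notin> H \<and> of_nat p * g \<in> H" using g(1) by blast
  next
    assume "\<exists>g\<in>G. g \<notin> H \<and> of_nat p * g \<in> H"
    then obtain g where g: "g \<in> G" "g \<notin> H" "of_nat p * g \<in> H" by blast
    define c where "c = H #>\<^bsub>M\<^esub> g"
    have c: "c \<in> carrier Q" using g(1) by (auto simp: c_def Q_def carrier_FactGroup)
    have cp: "c [^]\<^bsub>Q\<^esub> p = \<one>\<^bsub>Q\<^esub>" using g powQ triv mG by (simp add: c_def oneQ)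
    have co: "c [^]\<^bsub>Q\<^esub> Coset.order Q = \<one>\<^bsub>Q\<^esub>" using Q.pow_order_eq_1[OF c] .
    have "c \<noteq> \<one>\<^bsub>Q\<^esub>" using g triv by (simp add: c_def oneQ)
    show "p dvd card (G // R)"
    proof (rule ccontr)
      assume "\<not> p dvd card (G // R)"
      then have "coprime p (Coset.order Q)" using p by (simp add: ordQ prime_imp_coprime)
      then obtain u v where e: "p * u = Coset.order Q * v + 1"
        using bezout_nat[of p "Coset.order Q"] prime_gt_0_nat[OF p] by auto
      have "\<one>\<^bsub>Q\<^esub> = c [^]\<^bsub>Q\<^esub> (p * u)"
        using cp Q.nat_pow_pow[OF c, of p u] by simp
      also have "\<dots> = (c [^]\<^bsub>Q\<^esub> Coset.order Q) [^]\<^bsub>Q\<^esub> v \<otimes>\<^bsub>Q\<^esub> c [^]\<^bsub>Q\<^esub> (1::nat)"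
        unfolding e Q.nat_pow_pow[OF c] using Q.nat_pow_mult[OF c, of "Coset.order Q * v" 1] by simp
      finally have "c [^]\<^bsub>Q\<^esub> (1::nat) = \<one>\<^bsub>Q\<^esub>"
        using co c by simp
      then show False using \<open>c \<noteq> \<one>\<^bsub>Q\<^esub>\<close> c by simp
    qed
  qed
qed

section \<open>Cubic polynomials and their complex roots\<close>

lemma poly_cubic_poly:
  "poly (cubic_poly t a b) x = x ^ 3 + t * x ^ 2 + a * x + b"
  by (simp add: cubic_poly_def algebra_simps power2_eq_square power3_eq_cube)

lemma degree_cubic_poly [simp]: "degree (cubic_poly t a b) = 3"
  and lead_coeff_cubic_poly: "coeff (cubic_poly t a b) 3 = 1"
  by (simp_all add: cubic_poly_def numeral_3_eq_3)

lemma complex_quadratic_split: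
  fixes a b :: complex
  obtains z w where "a = - (z + w)" "b = z * w"
proof -
  define z where "z = (- a + csqrt (a ^ 2 - 4 * b)) / 2"
  have "2 * z + a = csqrt (a ^ 2 - 4 * b)"
    by (simp add: z_def field_simps)
  then have "(2 * z + a) ^ 2 = a ^ 2 - 4 * b"
    by simp
  then have "4 * (z ^ 2 + a * z + b) = 0"
    by (simp add: power2_eq_square algebra_simps)
  then have "z ^ 2 + a * z + b = 0"
    by (metis mult_eq_0_iff zero_neq_numeral)
  then have "b = z * (- a - z)"
    by (simp add: power2_eq_square algebra_simps eq_neg_iff_add_eq_0)
  then show thesis using that[of z "- a - z"] by simp
qed

lemma complex_cubic_split:
  fixes t a b :: complex
  obtains x y z where "t = - (x + y + z)" "a = x * y + x * z + y * z" "b = - (x * y * z)"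
proof -
  have "\<not> constant (poly (cubic_poly t a b))"
    by (simp add: constant_degree)
  then obtain x where "poly (cubic_poly t a b) x = 0"
    using fundamental_theorem_of_algebra by blast
  then have x: "b = - (x ^ 3 + t * x ^ 2 + a * x)"
    by (simp add: poly_cubic_poly eq_neg_iff_add_eq_0 algebra_simps)
  obtain y z where yz: "t + x = - (y + z)" "a + x * (t + x) = y * z"
    by (rule complex_quadratic_split)
  have t: "t = - (x + y + z)"
    using yz(1) by (simp add: algebra_simps eq_neg_iff_add_eq_0)
  have a: "a = x * y + x * z + y * z"
    using yz(2) unfolding t by (simp add: algebra_simps)
  have "b = - (x * y * z)"
    unfolding x a t by (simp add: algebra_simps power2_eq_square power3_eq_cube)
  with t a show thesis by (rule that)
qed

lemma poly_cubic_poly_roots: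
  fixes x y z :: "'a::comm_ring_1"
  assumes "t = - (x + y + z)" "a = x * y + x * z + y * z" "b = - (x * y * z)"
  shows "poly (cubic_poly t a b) w = (w - x) * (w - y) * (w - z)"
  unfolding assms poly_cubic_poly
  by (simp add: algebra_simps power2_eq_square power3_eq_cube)

lemma disc_roots:
  fixes x y z :: "'a::comm_ring_1"
  assumes "t = - (x + y + z)" "a = x * y + x * z + y * z" "b = - (x * y * z)"
  shows "disc t a b = ((x - y) * (x - z) * (y - z)) ^ 2"
  unfolding assms disc_def
  by (simp add: algebra_simps power2_eq_square power3_eq_cube)

lemma of_int_disc: "of_int (disc t a b) = disc (of_int t) (of_int a) (of_int b)"
  by (simp add: disc_def)

lemma map_poly_cubic_poly:
  "map_poly of_int (cubic_poly t a b) = cubic_poly (of_int t) (of_int a) (of_int b)"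
  by (simp add: cubic_poly_def)

text \<open>Evaluation at the roots of f stands in for the residue ring: for nonzero discriminant
  the three values determine a polynomial of degree less than 3 (\<open>cev_eq_0_imp\<close>), also
  when f is reducible.\<close>

definition cev :: "rat poly \<Rightarrow> complex \<Rightarrow> complex" where
  "cev g z = poly (map_poly of_rat g) z"

interpretation of_rat_poly_complex: map_poly_inj_idom_hom "of_rat :: rat \<Rightarrow> complex" ..

lemma cev_simps [simp]:
  "cev 0 z = 0" "cev 1 z = 1" "cev (g + h) z = cev g z + cev h z" "cev (g - h) z = cev g z - cev h z"
  "cev (g * h) z = cev g z * cev h z" "cev (- g) z = - cev g z" "cev (Polynomial.smult c g) z = of_rat c * cev g z"
  "cev (pCons c g) z = of_rat c + z * cev g z"
  by (simp_all add: cev_def hom_distribs of_rat_hom.map_poly_hom_smult)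

lemma cev_of_int: "cev (map_poly of_int P) z = poly (map_poly of_int P) z"
  by (induction P) (simp_all add: map_poly_pCons hom_distribs)

lemma cev_cubic_poly [simp]:
  "cev (cubic_poly (of_int t) (of_int a) (of_int b)) z = poly (cubic_poly (of_int t) (of_int a) (of_int b)) z"
  by (simp add: cubic_poly_def)

lemma cev_pcompose: "cev (pcompose P g) z = poly (map_poly of_rat P) (cev g z)"
  by (induction P) (simp_all add: pcompose_pCons map_poly_pCons hom_distribs)

lemma cev_pcompose_of_int:
  "cev (pcompose (map_poly of_int P) g) z = poly (map_poly of_int P) (cev g z)"
  unfolding cev_pcompose cev_def[symmetric] by (rule cev_of_int)

lemma cev_eq_0_imp:
  assumes "degree g < 3" "cev g x = 0" "cev g y = 0" "cev g z = 0" "x \<noteq> y" "x \<noteq> z" "y \<noteq> z"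
  shows "g = 0"
proof (rule ccontr)
  assume g: "g \<noteq> 0"
  let ?g = "map_poly of_rat g :: complex poly"
  have "?g \<noteq> 0" using g by simp
  then have "card {w. poly ?g w = 0} \<le> degree ?g" "finite {w. poly ?g w = 0}"
    by (rule poly_roots_degree, rule poly_roots_finite)
  moreover have "card {x, y, z} \<le> card {w. poly ?g w = 0}"
    using assms calculation by (intro card_mono) (auto simp: cev_def)
  moreover have "card {x, y, z} = 3" using assms by auto
  ultimately show False using assms(1) by simp
qed

lemma cubic_complex_roots:
  fixes t a b :: int
  assumes "disc t a b \<noteq> 0"
  obtains x y z :: complex where "of_int t = - (x + y + z)" "of_int a = x * y + x * z + y * z"
    "of_int b = - (x * y * z)" "x \<noteq> y" "x \<noteq> z" "y \<noteq> z"
    "(of_int (disc t a b) :: complex) = ((x - y) * (x - z) * (y - z)) ^ 2"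
proof -
  obtain x y z :: complex where r: "of_int t = - (x + y + z)" "of_int a = x * y + x * z + y * z"
    "of_int b = - (x * y * z)" by (rule complex_cubic_split)
  have d: "(of_int (disc t a b) :: complex) = ((x - y) * (x - z) * (y - z)) ^ 2"
    unfolding of_int_disc by (rule disc_roots[OF r])
  moreover have "(of_int (disc t a b) :: complex) \<noteq> 0" using assms by simp
  ultimately have "x \<noteq> y" "x \<noteq> z" "y \<noteq> z" by auto
  with r d show thesis using that by blast
qed

text \<open>Integrality can be tested at each root separately. If f divides P(g), then P kills the
  values of g at the roots. Conversely, the product Q of monic polynomials killing the three values
  is monic, and the remainder of Q(g) modulo f has degree less than 3 and vanishes at three distinct
  points.\<close>

theorem integral_elts_iff:
  fixes t a b :: int
  assumes disc: "disc t a b \<noteq> 0"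
  shows "g \<in> integral_elts (cubic_poly t a b) \<longleftrightarrow> degree g < 3 \<and>
    (\<forall>z. poly (cubic_poly (of_int t) (of_int a) (of_int b)) z = 0 \<longrightarrow> algebraic_int (cev g z))"
    (is "?L \<longleftrightarrow> ?R")
proof
  let ?f = "cubic_poly (of_int t) (of_int a) (of_int b) :: rat poly"
  assume ?L
  then obtain P :: "int poly" where deg: "degree g < 3" and P: "lead_coeff P = 1"
    "?f dvd pcompose (map_poly of_int P) g"
    by (auto simp: integral_elts_def map_poly_cubic_poly)
  have "algebraic_int (cev g z)" if z: "poly (cubic_poly (of_int t) (of_int a) (of_int b)) z = 0" for z
  proof -
    from P(2) obtain k where "pcompose (map_poly of_int P) g = ?f * k" by blast
    then have "poly (map_poly of_int P) (cev g z) = cev (?f * k) z"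
      by (metis cev_pcompose_of_int)
    also have "\<dots> = 0" using z by simp
    finally show ?thesis using P(1) by (auto simp: algebraic_int_altdef_ipoly)
  qed
  with deg show ?R by blast
next
  let ?f = "cubic_poly (of_int t) (of_int a) (of_int b) :: rat poly"
  assume R: ?R
  obtain x y z :: complex where r: "of_int t = - (x + y + z)" "of_int a = x * y + x * z + y * z"
    "of_int b = - (x * y * z)" "x \<noteq> y" "x \<noteq> z" "y \<noteq> z"
    by (rule cubic_complex_roots[OF disc])
  note f = poly_cubic_poly_roots[OF r(1-3)]
  have ex: "\<exists>P::int poly. poly (map_poly of_int P) (cev g w) = 0 \<and> lead_coeff P = 1"
    if "w \<in> {x, y, z}" for w
    using R that f unfolding algebraic_int_altdef_ipoly[symmetric] by auto
  obtain P where P: "\<And>w. w \<in> {x, y, z} \<Longrightarrow> poly (map_poly of_int (P w)) (cev g w) = 0"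
    "\<And>w. w \<in> {x, y, z} \<Longrightarrow> lead_coeff (P w :: int poly) = 1"
    using ex by metis
  define Q where "Q = P x * P y * P z"
  define h where "h = pcompose (map_poly of_int Q) g"
  have "lead_coeff Q = 1"
    using P(2) by (simp add: Q_def lead_coeff_mult)
  moreover have "?f dvd h"
  proof -
    have f0: "?f \<noteq> 0" by (simp add: cubic_poly_def)
    define k where "k = h mod ?f"
    have deg: "degree k < 3"
      using degree_mod_less[OF f0, of h] by (auto simp: k_def)
    have "cev k w = 0" if "w \<in> {x, y, z}" for w
    proof -
      have "cev h w = poly (map_poly of_int Q) (cev g w)"
        unfolding h_def by (rule cev_pcompose_of_int)
      also have "\<dots> = 0"
        using P(1)[OF that] that by (auto simp: Q_def hom_distribs)
      finally have "cev h w = 0" .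
      moreover have "h = ?f * (h div ?f) + k" by (simp add: k_def)
      then have "cev h w = cev ?f w * cev (h div ?f) w + cev k w" by (metis cev_simps(3,5))
      moreover have "cev ?f w = 0" using that f by auto
      ultimately show ?thesis by simp
    qed
    then have "k = 0" using deg r(4-6) by (intro cev_eq_0_imp[of k x y z]) auto
    then show ?thesis by (auto simp: k_def)
  qed
  ultimately show ?L
    using R by (auto simp: integral_elts_def map_poly_cubic_poly h_def)
qed

section \<open>The index of a cubic order at a prime\<close>

lemma algebraic_int_of_int_divide:
  assumes "algebraic_int (of_int m / of_nat k :: complex)" "k > 0"
  shows "int k dvd m"
proof -
  have "of_int m / of_nat k \<in> (\<rat> :: complex set)" by simp
  then have "of_int m / of_nat k \<in> (\<int> :: complex set)"
    using assms(1) rational_algebraic_int_is_int by blast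
  then obtain l where "of_int m / of_nat k = (of_int l :: complex)" by (auto elim: Ints_cases)
  then have "(of_int m :: complex) = of_int (l * int k)" using assms(2) by (simp add: field_simps)
  then have "m = l * int k" using of_int_eq_iff by blast
  then show ?thesis by simp
qed

lemma algebraic_int_cubicI:
  fixes z :: complex and a b c :: int
  assumes "z ^ 3 + of_int a * z ^ 2 + of_int b * z + of_int c = 0"
  shows "algebraic_int z"
  unfolding algebraic_int_altdef_ipoly
  using assms by (intro exI[of _ "[:c, b, a, 1:]"])
    (simp add: map_poly_pCons algebra_simps power2_eq_square power3_eq_cube)

definition cubic_val :: "int \<Rightarrow> int \<Rightarrow> int \<Rightarrow> int \<Rightarrow> int" where
  "cubic_val t a b r = r ^ 3 + t * r ^ 2 + a * r + b"

definition cubic_der :: "int \<Rightarrow> int \<Rightarrow> int \<Rightarrow> int" where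
  "cubic_der t a r = 3 * r ^ 2 + 2 * t * r + a"

locale cubic =
  fixes t a b :: int and x y z :: complex
  assumes disc: "disc t a b \<noteq> 0"
    and t: "of_int t = - (x + y + z)" and a: "of_int a = x * y + x * z + y * z"
    and b: "of_int b = - (x * y * z)"
    and disc_eq: "(of_int (disc t a b) :: complex) = ((x - y) * (x - z) * (y - z)) ^ 2"
begin

abbreviation "f \<equiv> cubic_poly t a b"
abbreviation "D \<equiv> disc t a b"

definition G :: "rat poly set" where "G = integral_elts f"
text \<open>The image of Z[x]/(f) in the ring of integral elements.\<close>

definition H :: "rat poly set" where "H = {g \<in> G. \<forall>i. coeff g i \<in> \<int>}"

lemma root_iff: "poly (cubic_poly (of_int t) (of_int a) (of_int b)) w = 0 \<longleftrightarrow> w \<in> {x, y, z}"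
  unfolding poly_cubic_poly_roots[OF t a b] by simp

lemma root_eq: "w ^ 3 + of_int t * w ^ 2 + of_int a * w + of_int b = 0" if "w \<in> {x, y, z}"
  using root_iff[of w] that by (simp add: poly_cubic_poly)

lemma algebraic_int_root: "algebraic_int w" if "w \<in> {x, y, z}"
  using root_eq[OF that] by (rule algebraic_int_cubicI)

lemma mem_G: "g \<in> G \<longleftrightarrow> degree g < 3 \<and> (\<forall>w\<in>{x, y, z}. algebraic_int (cev g w))"
  unfolding G_def integral_elts_iff[OF disc] root_iff by blast

lemma coeffs_deg_lt_3: "g = [:coeff g 0, coeff g 1, coeff g 2:]" if "degree g < 3" for g :: "rat poly"
proof (rule poly_eqI)
  fix i
  have "coeff g i = 0" if "i > 2" using that \<open>degree g < 3\<close> by (intro coeff_eq_0) simp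
  moreover consider "i = 0" | "i = 1" | "i = 2" | "i > 2" by linarith
  ultimately show "coeff g i = coeff [:coeff g 0, coeff g 1, coeff g 2:] i"
    by cases (auto simp: coeff_pCons numeral_2_eq_2 split: nat.splits)
qed

lemma cev_deg_lt_3:
  "cev g w = of_rat (coeff g 0) + of_rat (coeff g 1) * w + of_rat (coeff g 2) * w ^ 2" if "degree g < 3"
  by (subst coeffs_deg_lt_3[OF that]) (simp add: algebra_simps power2_eq_square)

lemma G_0: "0 \<in> G" and G_diff: "g \<in> G \<Longrightarrow> h \<in> G \<Longrightarrow> g - h \<in> G"
  by (auto simp: mem_G degree_diff_less intro: algebraic_int_ring)

lemma H_0: "0 \<in> H" and H_diff: "g \<in> H \<Longrightarrow> h \<in> H \<Longrightarrow> g - h \<in> H"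
  by (auto simp: H_def G_0 G_diff)

lemma rat_algebraic_int: "q \<in> \<int>" if "algebraic_int (of_rat q :: complex)" for q :: rat
proof -
  have "(of_rat q :: complex) \<in> \<int>"
    using rational_algebraic_int_is_int[OF that] by simp
  then obtain k where "(of_rat q :: complex) = of_int k" by (auto elim: Ints_cases)
  then have "(of_rat q :: complex) = of_rat (of_int k)" by simp
  then have "q = of_int k" using of_rat_eq_iff by blast
  then show ?thesis by simp
qed

text \<open>Cramer's rule for the Vandermonde system expressing the values of g at the roots.\<close>

lemma disc_coeff_Ints:
  assumes g: "g \<in> G"
  shows "of_int D * coeff g i \<in> \<int>"
proof -
  have deg: "degree g < 3" using g by (simp add: mem_G)
  have alg: "algebraic_int (cev g x)" "algebraic_int (cev g y)" "algebraic_int (cev g z)"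
    "algebraic_int x" "algebraic_int y" "algebraic_int z"
    using g algebraic_int_root by (auto simp: mem_G)
  define d where "d = (x - y) * (x - z) * (y - z)"
  have eqs: "d * of_rat (coeff g 2) = cev g x * (y - z) - cev g y * (x - z) + cev g z * (x - y)"
    "d * of_rat (coeff g 1) = - (cev g x * (y ^ 2 - z ^ 2) - cev g y * (x ^ 2 - z ^ 2) + cev g z * (x ^ 2 - y ^ 2))"
    "d * of_rat (coeff g 0) = cev g x * (y * z * (y - z)) - cev g y * (x * z * (x - z)) + cev g z * (x * y * (x - y))"
    unfolding cev_deg_lt_3[OF deg] d_def by (simp_all add: algebra_simps power2_eq_square)
  have "algebraic_int (d * of_rat (coeff g i))"
  proof (cases "i \<le> 2")
    case True
    then consider "i = 0" | "i = 1" | "i = 2" by linarith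
    then show ?thesis
      by cases (auto simp only: eqs intro!: algebraic_int_ring alg algebraic_int_minus)
  next
    case False
    then have "coeff g i = 0" using deg by (intro coeff_eq_0) simp
    then show ?thesis by simp
  qed
  moreover have "algebraic_int d"
    unfolding d_def by (intro algebraic_int_ring alg)
  ultimately have "algebraic_int (d * (d * of_rat (coeff g i)))" by (rule algebraic_int_times[rotated])
  also have "d * (d * of_rat (coeff g i)) = of_rat (of_int D * coeff g i)"
    using disc_eq by (simp add: of_rat_mult d_def power2_eq_square)
  finally show ?thesis by (rule rat_algebraic_int)
qed

definition R :: "(rat poly \<times> rat poly) set" where
  "R = {(g, h). g \<in> G \<and> h \<in> G \<and> g - h \<in> H}"

lemma ind_eq: "ind f = card (G // R)"
proof -
  have "R = {(g, h). g \<in> integral_elts f \<and> h \<in> integral_elts f \<and> (\<forall>i. coeff (g - h) i \<in> \<int>)}"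
    using G_diff by (auto simp: R_def H_def G_def)
  then show ?thesis by (simp add: ind_def G_def)
qed

text \<open>Multiplication by \<open>D\<close> clears the denominators of elements of
  \<open>G\<close>, so the class modulo \<open>H\<close> depends only on three residues modulo
  \<open>D\<close>. Finiteness matters because \<open>card\<close> is 0 on infinite sets, and every
  prime divides 0.\<close>

lemma finite_quotient: "finite (G // R)"
proof -
  define \<phi> where "\<phi> = (\<lambda>(g :: rat poly) i. \<lfloor>of_int D * coeff g i\<rfloor> mod D)"
  define \<psi> where "\<psi> = (\<lambda>g. (\<phi> g 0, \<phi> g 1, \<phi> g (2::nat)))"
  have "D > 0 \<or> D < 0" using disc by linarith
  then have "finite (range (\<lambda>k. k mod D))"
  proof
    assume "D > 0"
    then have "k mod D \<in> {0..D}" for k using pos_mod_bound[of D k] pos_mod_sign[of D k] unfolding atLeastAtMost_iff by linarith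
    then have "range (\<lambda>k. k mod D) \<subseteq> {0..D}" by blast
    then show ?thesis by (rule finite_subset) simp
  next
    assume "D < 0"
    then have "k mod D \<in> {D..0}" for k using neg_mod_bound[of D k] neg_mod_sign[of D k] unfolding atLeastAtMost_iff by linarith
    then have "range (\<lambda>k. k mod D) \<subseteq> {D..0}" by blast
    then show ?thesis by (rule finite_subset) simp
  qed
  moreover define S where "S = range (\<lambda>k. k mod D)"
  ultimately have "finite (S \<times> S \<times> S)" by simp
  moreover have "\<psi> ` G \<subseteq> S \<times> S \<times> S"
    unfolding \<psi>_def \<phi>_def S_def by blast
  ultimately have "finite (\<psi> ` G)" by (rule rev_finite_subset)
  moreover have "R `` {g} = R `` {h}" if gh: "g \<in> G" "h \<in> G" "\<psi> g = \<psi> h" for g h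
  proof -
    have "coeff (g - h) i \<in> \<int>" for i
    proof (cases "i \<le> 2")
      case True
      then have "\<phi> g i = \<phi> h i" using gh(3) by (auto simp: \<psi>_def le_Suc_eq numeral_2_eq_2)
      then have "D dvd \<lfloor>of_int D * coeff g i\<rfloor> - \<lfloor>of_int D * coeff h i\<rfloor>"
        by (simp add: \<phi>_def mod_eq_dvd_iff)
      then obtain k where k: "\<lfloor>of_int D * coeff g i\<rfloor> - \<lfloor>of_int D * coeff h i\<rfloor> = D * k" by blast
      have "of_int D * coeff g i - of_int D * coeff h i =
          of_int (\<lfloor>of_int D * coeff g i\<rfloor> - \<lfloor>of_int D * coeff h i\<rfloor>)"
        using disc_coeff_Ints[OF gh(1), of i] disc_coeff_Ints[OF gh(2), of i]
        by (auto elim!: Ints_cases)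
      then have "of_int D * (coeff g i - coeff h i) = of_int D * of_int k"
        unfolding k by (simp add: algebra_simps)
      then have "coeff g i - coeff h i = of_int k" using disc by simp
      then show ?thesis by simp
    next
      case False
      then have "coeff g i = 0" "coeff h i = 0"
        using gh by (auto simp: mem_G intro!: coeff_eq_0)
      then show ?thesis by simp
    qed
    then have *: "g - h \<in> H" "h - g \<in> H"
      using gh G_diff H_diff[OF H_0, of "g - h"] by (auto simp: H_def)
    have "g - k \<in> H \<longleftrightarrow> h - k \<in> H" for k
      using H_diff[of "h - k" "h - g"] H_diff[of "g - k" "g - h"] * by (auto simp: algebra_simps)
    then show ?thesis using gh by (auto simp: R_def)
  qed
  note same = this
  have "R `` {inv_into G \<psi> (\<psi> g)} = R `` {g}" if "g \<in> G" for g
    by (rule same) (use that in \<open>simp_all add: inv_into_into f_inv_into_f\<close>)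
  then have "(\<lambda>g. R `` {g}) ` G = (\<lambda>v. R `` {inv_into G \<psi> v}) ` \<psi> ` G"
    unfolding image_image by (intro image_cong) auto
  moreover have "G // R = (\<lambda>g. R `` {g}) ` G" by (auto simp: quotient_def)
  ultimately show ?thesis by (metis finite_imageI)
qed

section \<open>Elements of Z[x]/(f) that are divisible by p among the integral elements\<close>

abbreviation quad :: "int \<Rightarrow> int \<Rightarrow> int \<Rightarrow> complex \<Rightarrow> complex" where
  "quad u v w \<theta> \<equiv> of_int u + of_int v * \<theta> + of_int w * \<theta> ^ 2"

text \<open>These triples form an ideal of Z[x]/(f) containing p: the lemmas below give closure
  under addition, integer multiples and multiplication by the root. The index is divisible by p when
  the ideal contains a triple whose entries are not all divisible by p.\<close>

definition J :: "nat \<Rightarrow> int \<Rightarrow> int \<Rightarrow> int \<Rightarrow> bool" where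
  "J p u v w \<longleftrightarrow> (\<forall>\<theta>\<in>{x, y, z}. algebraic_int (quad u v w \<theta> / of_nat p))"

lemma J_D: "J p u v w \<Longrightarrow> \<theta> \<in> {x, y, z} \<Longrightarrow> algebraic_int (quad u v w \<theta> / of_nat p)"
  unfolding J_def by blast

lemma J_add:
  assumes "J p u v w" "J p u' v' w'"
  shows "J p (u + u') (v + v') (w + w')"
  unfolding J_def
proof
  fix \<theta> assume "\<theta> \<in> {x, y, z}"
  then have "algebraic_int (quad u v w \<theta> / of_nat p + quad u' v' w' \<theta> / of_nat p)"
    by (intro algebraic_int_plus J_D assms)
  then show "algebraic_int (quad (u + u') (v + v') (w + w') \<theta> / of_nat p)"
    by (simp add: algebra_simps add_divide_distrib)
qed

lemma J_scale:
  assumes "J p u v w"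
  shows "J p (k * u) (k * v) (k * w)"
  unfolding J_def
proof
  fix \<theta> assume "\<theta> \<in> {x, y, z}"
  then have "algebraic_int (of_int k * (quad u v w \<theta> / of_nat p))"
    by (intro algebraic_int_times algebraic_int_of_int J_D assms)
  then show "algebraic_int (quad (k * u) (k * v) (k * w) \<theta> / of_nat p)"
    by (simp add: algebra_simps add_divide_distrib)
qed

lemma J_trivial: "J p (int p * u) (int p * v) (int p * w)" if "p > 0"
  unfolding J_def
proof
  fix \<theta> assume *: "\<theta> \<in> {x, y, z}"
  have "algebraic_int (quad u v w \<theta>)"
    using algebraic_int_root[OF *] by (intro algebraic_int_ring)
  also have "of_int u + of_int v * \<theta> + of_int w * \<theta> ^ 2 =
    quad (int p * u) (int p * v) (int p * w) \<theta> / of_nat p"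
    using that by (simp add: field_simps)
  finally show "algebraic_int (quad (int p * u) (int p * v) (int p * w) \<theta> / of_nat p)" .
qed

lemma J_cong:
  assumes "p > 0" "J p u v w" "int p dvd u' - u" "int p dvd v' - v" "int p dvd w' - w"
  shows "J p u' v' w'"
proof -
  obtain i j k where "u' - u = int p * i" "v' - v = int p * j" "w' - w = int p * k"
    using assms(3-5) by (auto elim!: dvdE)
  then have "u' = u + int p * i" "v' = v + int p * j" "w' = w + int p * k" by simp_all
  then show ?thesis using J_add[OF assms(2) J_trivial[OF assms(1)]] by simp
qed

lemma J_times_root:
  assumes "J p u v w"
  shows "J p (- b * w) (u - a * w) (v - t * w)"
  unfolding J_def
proof
  fix \<theta> assume \<theta>: "\<theta> \<in> {x, y, z}"
  then have "algebraic_int (\<theta> * (quad u v w \<theta> / of_nat p))"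
    by (intro algebraic_int_times algebraic_int_root J_D assms)
  moreover have "\<theta> * quad u v w \<theta> = quad (- b * w) (u - a * w) (v - t * w) \<theta>
      + of_int w * (\<theta> ^ 3 + of_int t * \<theta> ^ 2 + of_int a * \<theta> + of_int b)"
    by (simp add: algebra_simps power2_eq_square power3_eq_cube)
  ultimately show "algebraic_int (quad (- b * w) (u - a * w) (v - t * w) \<theta> / of_nat p)"
    using root_eq[OF \<theta>] by simp
qed

text \<open>The numbers h(\<theta>) / p are algebraic integers, hence so is their k-th elementary
  symmetric function e_k / p^k; if e_k is an integer, this is rational and therefore an
  integer.\<close>

lemma J_imp_pair_sums:
  assumes "p > 0" "J p u v w"
    and "\<And>\<theta>. h \<theta> = quad u v w \<theta>"
  shows "h x + h y + h z = of_int e1 \<Longrightarrow> int p dvd e1"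
    and "h x * h y + h x * h z + h y * h z = of_int e2 \<Longrightarrow> int (p ^ 2) dvd e2"
    and "h x * h y * h z = of_int e3 \<Longrightarrow> int (p ^ 3) dvd e3"
proof -
  have alg: "algebraic_int (h x / of_nat p)" "algebraic_int (h y / of_nat p)" "algebraic_int (h z / of_nat p)"
    using assms by (auto simp: J_def)
  show "int p dvd e1" if *: "h x + h y + h z = of_int e1"
  proof (rule algebraic_int_of_int_divide)
    have "algebraic_int (h x / of_nat p + h y / of_nat p + h z / of_nat p)"
      by (intro algebraic_int_ring alg)
    also have "h x / of_nat p + h y / of_nat p + h z / of_nat p = of_int e1 / of_nat p"
      using * by (simp flip: add_divide_distrib)
    finally show "algebraic_int (of_int e1 / of_nat p :: complex)" .
  qed (use assms in auto)
  show "int (p ^ 2) dvd e2" if *: "h x * h y + h x * h z + h y * h z = of_int e2"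
  proof (rule algebraic_int_of_int_divide)
    have "algebraic_int (h x / of_nat p * (h y / of_nat p) + h x / of_nat p * (h z / of_nat p)
        + h y / of_nat p * (h z / of_nat p))"
      by (intro algebraic_int_ring alg)
    also have "h x / of_nat p * (h y / of_nat p) + h x / of_nat p * (h z / of_nat p)
        + h y / of_nat p * (h z / of_nat p) = of_int e2 / of_nat (p ^ 2)"
      using * by (simp add: power2_eq_square flip: add_divide_distrib)
    finally show "algebraic_int (of_int e2 / of_nat (p ^ 2) :: complex)" .
  qed (use assms in auto)
  show "int (p ^ 3) dvd e3" if *: "h x * h y * h z = of_int e3"
  proof (rule algebraic_int_of_int_divide)
    have "algebraic_int (h x / of_nat p * (h y / of_nat p) * (h z / of_nat p))"
      by (intro algebraic_int_ring alg)
    also have "h x / of_nat p * (h y / of_nat p) * (h z / of_nat p) = of_int e3 / of_nat (p ^ 3)"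
      using * by (simp add: power3_eq_cube)
    finally show "algebraic_int (of_int e3 / of_nat (p ^ 3) :: complex)" .
  qed (use assms in auto)
qed

lemma normalize_unit:
  assumes "prime p" "\<not> int p dvd w"
  obtains k where "int p dvd 1 - k * w"
proof -
  have "coprime w (int p)"
    using assms by (metis coprime_commute prime_imp_coprime prime_nat_int_transfer)
  then obtain k where "[w * k = 1] (mod int p)"
    using cong_solve_coprime_int by blast
  then have "int p dvd k * w - 1" by (simp add: cong_iff_dvd_diff mult.commute)
  then have "int p dvd 1 - k * w" using dvd_minus_iff[of "int p" "k * w - 1"] by simp
  then show thesis by (rule that)
qed

text \<open>Multiplication by an inverse of v modulo p turns the element into \<theta> - r. The
  second and third symmetric functions of the \<theta> - r are f'(r) and - f(r), so p^2 divides
  f'(r) and p^3 divides f(r).\<close>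

lemma J_linear:
  assumes p: "prime p" and J: "J p u v 0" and v: "\<not> int p dvd v"
  shows "\<exists>r. int p dvd cubic_der t a r \<and> int (p ^ 2) dvd cubic_val t a b r"
proof -
  have p0: "p > 0" using p by (rule prime_gt_0_nat)
  obtain k where k: "int p dvd 1 - k * v" using normalize_unit[OF p v] .
  define r where "r = - (k * u)"
  have "J p (- r) 1 0"
    using k by (intro J_cong[OF p0 J_scale[OF J, of k]]) (auto simp: r_def)
  note sums = J_imp_pair_sums[OF p0 this, of "\<lambda>\<theta>. \<theta> - of_int r"]
  have "(x - of_int r) * (y - of_int r) + (x - of_int r) * (z - of_int r) + (y - of_int r) * (z - of_int r)
    = of_int (cubic_der t a r)"
    by (simp add: cubic_der_def t a algebra_simps power2_eq_square)
  then have "int (p ^ 2) dvd cubic_der t a r" by (intro sums(2)) auto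
  moreover have "(x - of_int r) * (y - of_int r) * (z - of_int r) = of_int (- cubic_val t a b r)"
    by (simp add: cubic_val_def t a b algebra_simps power2_eq_square power3_eq_cube)
  then have "int (p ^ 3) dvd - cubic_val t a b r" by (intro sums(3)) auto
  ultimately have "int (p ^ 2) dvd cubic_der t a r" "int (p ^ 3) dvd cubic_val t a b r" by auto
  then show ?thesis
    by (intro exI[of _ r] conjI) (auto elim: dvd_trans[rotated] simp: power2_eq_square power3_eq_cube)
qed

lemma J_constant: "int p dvd u" if "p > 0" "J p u 0 0"
  using that by (auto simp: J_def intro: algebraic_int_of_int_divide)

text \<open>An element d = X^2 + d1 X + d0 of minimal degree satisfies X d = r d modulo p,
  so f = (X - r) d modulo p; in terms of Y = X - r one may replace d by
  Y^2 + (3 r + t) Y + f'(r), whose values at the roots are the pairwise products of the Y's.\<close>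

lemma J_quadratic:
  assumes p: "prime p" and J: "J p u v w" and w: "\<not> int p dvd w"
  shows "\<exists>r. int p dvd cubic_der t a r \<and> int (p ^ 2) dvd cubic_val t a b r"
proof -
  have p0: "p > 0" using p by (rule prime_gt_0_nat)
  obtain k where k: "int p dvd 1 - k * w" using normalize_unit[OF p w] .
  define d0 d1 where "d0 = k * u" and "d1 = k * v"
  have Jd: "J p d0 d1 1"
    using k by (intro J_cong[OF p0 J_scale[OF J, of k]]) (auto simp: d0_def d1_def)
  \<comment> \<open>With this r the element (X - r) d, reduced by f, has no quadratic term. It
    equals e1 X + e0, whence f(r) = - e1 r - e0.\<close>
  define r where "r = d1 - t"
  define e0 e1 where "e0 = - b - r * d0" and "e1 = d0 - a - r * d1"
  have Je: "J p e0 e1 0"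
    using J_add[OF J_times_root[OF Jd] J_scale[OF Jd, of "- r"]] by (simp add: e0_def e1_def r_def algebra_simps)
  show ?thesis
  proof (cases "int p dvd e1")
    case False
    with J_linear[OF p Je] show ?thesis by blast
  next
    case e1: True
    then have "J p e0 0 0" by (intro J_cong[OF p0 Je]) auto
    then have e0: "int p dvd e0" by (rule J_constant[OF p0])
    have "cubic_val t a b r = - e1 * r - e0"
      by (simp add: cubic_val_def e0_def e1_def r_def algebra_simps power2_eq_square power3_eq_cube)
    then have val: "int p dvd cubic_val t a b r" using e0 e1 by simp
    have "J p (d0 - e1) d1 1"
      using e1 by (intro J_cong[OF p0 Jd]) auto
    note sums = J_imp_pair_sums[OF p0 this, of "\<lambda>\<theta>. of_int (d0 - e1) + of_int d1 * \<theta> + \<theta> ^ 2"]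
    have h_eq: "of_int (d0 - e1) + of_int d1 * \<theta> + \<theta> ^ 2 =
      of_int (d0 - e1) + of_int d1 * \<theta> + of_int 1 * \<theta> ^ 2" for \<theta> :: complex by simp
    define X Y Z where "X = x - of_int r" and "Y = y - of_int r" and "Z = z - of_int r"
    have d0e1: "d0 - e1 = a + r * d1" and d1: "d1 = r + t" by (simp_all add: e1_def r_def)
    have h: "of_int (d0 - e1) + of_int d1 * x + x ^ 2 = Y * Z"
      "of_int (d0 - e1) + of_int d1 * y + y ^ 2 = X * Z"
      "of_int (d0 - e1) + of_int d1 * z + z ^ 2 = X * Y"
      unfolding d0e1 d1 of_int_add of_int_mult t a X_def Y_def Z_def
      by (simp_all add: algebra_simps power2_eq_square)
    have "Y * Z + X * Z + X * Y = of_int (cubic_der t a r)"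
      by (simp add: X_def Y_def Z_def cubic_der_def t a algebra_simps power2_eq_square)
    then have der: "int p dvd cubic_der t a r" by (intro sums(1)[OF h_eq]) (simp only: h)
    have "X * Y * Z = - of_int (cubic_val t a b r)"
      by (simp add: X_def Y_def Z_def cubic_val_def t a b algebra_simps power2_eq_square power3_eq_cube)
    then have "(Y * Z) * (X * Z) * (X * Y) = of_int (cubic_val t a b r ^ 2)"
    proof -
      have "(Y * Z) * (X * Z) * (X * Y) = (X * Y * Z) ^ 2" by (simp add: power2_eq_square)
      then show ?thesis using \<open>X * Y * Z = - of_int (cubic_val t a b r)\<close> by simp
    qed
    then have val2: "int (p ^ 3) dvd cubic_val t a b r ^ 2" by (intro sums(3)[OF h_eq]) (simp only: h)
    \<comment> \<open>From f(r) = p m and p^3 dividing f(r)^2 it follows that p divides m^2, hence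
      m.\<close>
    from val obtain m where m: "cubic_val t a b r = int p * m" by blast
    have "int p ^ 2 * int p dvd int p ^ 2 * m ^ 2"
      using val2 unfolding m by (simp add: power_mult_distrib power2_eq_square power3_eq_cube ac_simps)
    then have "int p dvd m ^ 2" using p0 by simp
    then have "int p dvd m" using p by (meson prime_dvd_power prime_nat_int_transfer)
    then have "int (p ^ 2) dvd cubic_val t a b r" unfolding m by (simp add: power2_eq_square)
    with der show ?thesis by blast
  qed
qed

lemma degree_lt_3_iff: "degree [:u, v, w:] < 3" for u v w :: rat
  using degree_pCons_le[of u "[:v, w:]"] degree_pCons_le[of v "[:w:]"] by simp

text \<open>An element of order p modulo \<open>H\<close> has the form (c0 + c1 x + c2 x^2) / p with
  some c_i prime to p. The highest such i selects \<open>J_quadratic\<close> or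
  \<open>J_linear\<close>, and i = 0 contradicts \<open>J_constant\<close>. Conversely, such an r
  makes ((x - r)^2 + (3 r + t) (x - r)) / p integral.\<close>

lemma prime_dvd_ind_iff:
  assumes p: "prime p"
  shows "p dvd ind f \<longleftrightarrow> (\<exists>r. int p dvd cubic_der t a r \<and> int (p ^ 2) dvd cubic_val t a b r)"
proof -
  have p0: "p > 0" using p by (rule prime_gt_0_nat)
  have "p dvd ind f \<longleftrightarrow> (\<exists>g\<in>G. g \<notin> H \<and> of_nat p * g \<in> H)"
    unfolding ind_eq R_def
    by (rule prime_dvd_card_quotient_iff)
       (use finite_quotient p in \<open>auto simp: R_def H_def intro: G_0 G_diff\<close>)
  also have "\<dots> \<longleftrightarrow> (\<exists>r. int p dvd cubic_der t a r \<and> int (p ^ 2) dvd cubic_val t a b r)"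
  proof
    assume "\<exists>g\<in>G. g \<notin> H \<and> of_nat p * g \<in> H"
    then obtain g where g: "g \<in> G" "g \<notin> H" "of_nat p * g \<in> H" by blast
    have "coeff (of_nat p * g) i \<in> \<int>" for i using g(3) by (auto simp: H_def)
    then have "of_nat p * coeff g i \<in> \<int>" for i by (simp add: of_nat_poly)
    then have "\<exists>k. of_nat p * coeff g i = of_int k" for i by (auto elim: Ints_cases)
    then obtain c where c: "\<And>i. of_nat p * coeff g i = of_int (c i)" by metis
    have coeff: "coeff g i = of_int (c i) / of_nat p" for i using c[of i] p0 by (simp add: field_simps)
    have deg: "degree g < 3" using g(1) by (simp add: mem_G)
    have J: "J p (c 0) (c 1) (c 2)"
      unfolding J_def
    proof
      fix \<theta> assume \<theta>: "\<theta> \<in> {x, y, z}"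
      then have "algebraic_int (cev g \<theta>)" using g(1) by (auto simp: mem_G)
      also have "cev g \<theta> = quad (c 0) (c 1) (c 2) \<theta> / of_nat p"
        unfolding cev_deg_lt_3[OF deg] coeff by (simp add: of_rat_divide add_divide_distrib)
      finally show "algebraic_int (quad (c 0) (c 1) (c 2) \<theta> / of_nat p)" .
    qed
    have "\<exists>i. coeff g i \<notin> \<int>" using g by (auto simp: H_def)
    then obtain i where i: "coeff g i \<notin> \<int>" by blast
    have "\<not> int p dvd c i"
    proof
      assume "int p dvd c i"
      then obtain l where "c i = int p * l" by blast
      then have "coeff g i = of_int l" using p0 by (simp add: coeff)
      with i show False by simp
    qed
    moreover have "i \<le> 2"
    proof (rule ccontr)
      assume "\<not> i \<le> 2"
      then have "coeff g i = 0" using deg by (intro coeff_eq_0) simp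
      with i show False by simp
    qed
    ultimately consider "\<not> int p dvd c 2" | "int p dvd c 2" "\<not> int p dvd c 1"
      | "int p dvd c 2" "int p dvd c 1" "\<not> int p dvd c 0"
      by (auto simp: le_Suc_eq numeral_2_eq_2)
    then show "\<exists>r. int p dvd cubic_der t a r \<and> int (p ^ 2) dvd cubic_val t a b r"
    proof cases
      case 1
      with J_quadratic[OF p J] show ?thesis by blast
    next
      case 2
      have "J p (c 0) (c 1) 0" using 2 by (intro J_cong[OF p0 J]) auto
      with J_linear[OF p] 2 show ?thesis by blast
    next
      case 3
      have "J p (c 0) 0 0" using 3 by (intro J_cong[OF p0 J]) auto
      with J_constant[OF p0] 3 show ?thesis by blast
    qed
  next
    assume "\<exists>r. int p dvd cubic_der t a r \<and> int (p ^ 2) dvd cubic_val t a b r"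
    then obtain r \<beta> \<gamma> where \<beta>: "cubic_der t a r = int p * \<beta>" and \<gamma>: "cubic_val t a b r = int (p ^ 2) * \<gamma>"
      by blast
    \<comment> \<open>In Y = x - r the polynomial f reads Y^3 + \<alpha> Y^2 + f'(r) Y + f(r), and g
      is (Y^2 + \<alpha> Y) / p.\<close>
    define \<alpha> where "\<alpha> = 3 * r + t"
    define g :: "rat poly" where "g = [:of_int (r ^ 2 - \<alpha> * r) / of_nat p, of_int (\<alpha> - 2 * r) / of_nat p, 1 / of_nat p:]"
    have deg: "degree g < 3" unfolding g_def by (rule degree_lt_3_iff)
    have "algebraic_int (cev g \<theta>)" if \<theta>: "\<theta> \<in> {x, y, z}" for \<theta>
    proof -
      define Y where "Y = \<theta> - of_int r"
      \<comment> \<open>This is g + \<beta>, chosen so that p \<zeta> Y = - f(r), that is \<zeta> Y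
        = - p \<gamma>. Eliminating Y from this relation and the definition gives a monic integral
        cubic equation for \<zeta>.\<close>
      define \<zeta> where "\<zeta> = (Y ^ 2 + of_int \<alpha> * Y) / of_nat p + of_int \<beta>"
      have u: "of_nat p * \<zeta> = Y ^ 2 + of_int \<alpha> * Y + of_nat p * of_int \<beta>"
        using p0 by (simp add: \<zeta>_def field_simps)
      have "of_int (cubic_der t a r) = (of_nat p * of_int \<beta> :: complex)"
        "of_int (cubic_val t a b r) = (of_nat p ^ 2 * of_int \<gamma> :: complex)"
        unfolding \<beta> \<gamma> by simp_all
      then have bg: "of_nat p * of_int \<beta> = 3 * (of_int r) ^ 2 + 2 * of_int t * of_int r + (of_int a :: complex)"
        "of_nat p ^ 2 * of_int \<gamma> = (of_int r) ^ 3 + of_int t * (of_int r) ^ 2 + of_int a * of_int r + (of_int b :: complex)"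
        by (simp_all add: cubic_der_def cubic_val_def)
      have uY: "(of_nat p * \<zeta>) * Y = - (of_nat p ^ 2 * of_int \<gamma>)"
      proof -
        have "(of_nat p * \<zeta>) * Y = \<theta> ^ 3 + of_int t * \<theta> ^ 2 + of_int a * \<theta> + of_int b
          - of_nat p ^ 2 * of_int \<gamma>"
          unfolding u bg Y_def \<alpha>_def by (simp add: algebra_simps power2_eq_square power3_eq_cube)
        then show ?thesis using root_eq[OF \<theta>] by simp
      qed
      have "(of_nat p * \<zeta>) ^ 3 - of_nat p * of_int \<beta> * (of_nat p * \<zeta>) ^ 2
        + of_int \<alpha> * (of_nat p ^ 2 * of_int \<gamma>) * (of_nat p * \<zeta>) - (of_nat p ^ 2 * of_int \<gamma>) ^ 2 = 0"
      proof -
        define U where "U = of_nat p * \<zeta>"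
        have "U ^ 3 - of_nat p * of_int \<beta> * U ^ 2 = U ^ 2 * (U - of_nat p * of_int \<beta>)"
          by (simp add: algebra_simps power2_eq_square power3_eq_cube)
        also have "U - of_nat p * of_int \<beta> = Y ^ 2 + of_int \<alpha> * Y" using u by (simp add: U_def)
        also have "U ^ 2 * (Y ^ 2 + of_int \<alpha> * Y) = (U * Y) ^ 2 + of_int \<alpha> * U * (U * Y)"
          by (simp add: algebra_simps power2_eq_square)
        also have "U * Y = - (of_nat p ^ 2 * of_int \<gamma>)" using uY by (simp add: U_def)
        finally have "U ^ 3 - of_nat p * of_int \<beta> * U ^ 2
            + of_int \<alpha> * (of_nat p ^ 2 * of_int \<gamma>) * U - (of_nat p ^ 2 * of_int \<gamma>) ^ 2 = 0"
          by (simp add: algebra_simps)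
        then show ?thesis unfolding U_def .
      qed
      then have "of_nat p ^ 3 * (\<zeta> ^ 3 + of_int (- \<beta>) * \<zeta> ^ 2 + of_int (\<alpha> * \<gamma>) * \<zeta> + of_int (- (int p * \<gamma> ^ 2))) = 0"
        by (simp add: algebra_simps power2_eq_square power3_eq_cube)
      then have "\<zeta> ^ 3 + of_int (- \<beta>) * \<zeta> ^ 2 + of_int (\<alpha> * \<gamma>) * \<zeta> + of_int (- (int p * \<gamma> ^ 2)) = 0"
        using p0 by (metis mult_eq_0_iff of_nat_eq_0_iff power_not_zero less_not_refl)
      then have "algebraic_int \<zeta>" by (rule algebraic_int_cubicI)
      then have "algebraic_int (\<zeta> - of_int \<beta>)" by (intro algebraic_int_ring)
      also have "\<zeta> - of_int \<beta> = cev g \<theta>"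
        using p0 by (simp add: \<zeta>_def g_def Y_def of_rat_divide of_rat_diff of_rat_mult field_simps power2_eq_square)
      finally show ?thesis .
    qed
    then have gG: "g \<in> G" using deg by (auto simp: mem_G)
    have "of_nat p * g = map_poly of_int [:r ^ 2 - \<alpha> * r, \<alpha> - 2 * r, 1:]"
      using p0 by (simp add: g_def of_nat_poly)
    then have pg: "coeff (of_nat p * g) i \<in> \<int>" for i
      by (simp only: coeff_map_poly[of of_int, OF of_int_0] Ints_of_int)
    moreover have "of_nat p * g \<in> G"
    proof -
      have "algebraic_int (of_int (int p) * cev g \<theta>)" if "\<theta> \<in> {x, y, z}" for \<theta>
        using gG that by (intro algebraic_int_times algebraic_int_of_int) (auto simp: mem_G)
      moreover have "of_nat p * g = Polynomial.smult (of_nat p) g" by (simp add: of_nat_poly)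
      ultimately show ?thesis using deg p0 by (auto simp: mem_G)
    qed
    ultimately have "of_nat p * g \<in> H" by (simp add: H_def)
    moreover have "g \<notin> H"
    proof
      assume "g \<in> H"
      then have "coeff g 2 \<in> \<int>" by (auto simp: H_def)
      then have "1 / of_nat p \<in> (\<int> :: rat set)" by (simp add: g_def numeral_2_eq_2)
      then obtain l :: int where "1 / of_nat p = (of_int l :: rat)" by (auto elim: Ints_cases)
      then have "(1 :: rat) = of_int (l * int p)" using p0 by (simp add: field_simps)
      then have "1 = l * int p" using of_int_eq_iff by (metis of_int_1)
      then have "int p dvd 1" by (metis dvd_triv_right)
      with p show False by (simp add: prime_nat_iff)
    qed
    ultimately show "\<exists>g\<in>G. g \<notin> H \<and> of_nat p * g \<in> H" using gG by blast
  qed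
  finally show ?thesis .
qed

end

theorem prime_dvd_ind_iff:
  assumes "disc t a b \<noteq> 0" "prime p"
  shows "p dvd ind (cubic_poly t a b) \<longleftrightarrow>
    (\<exists>r. int p dvd cubic_der t a r \<and> int (p ^ 2) dvd cubic_val t a b r)"
proof -
  obtain x y z :: complex where "of_int t = - (x + y + z)" "of_int a = x * y + x * z + y * z"
    "of_int b = - (x * y * z)" "x \<noteq> y" "x \<noteq> z" "y \<noteq> z"
    "(of_int (disc t a b) :: complex) = ((x - y) * (x - z) * (y - z)) ^ 2"
    by (rule cubic_complex_roots[OF assms(1)])
  then interpret cubic t a b x y z by unfold_locales (use assms in auto)
  show ?thesis by (rule prime_dvd_ind_iff[OF assms(2)])
qed

section \<open>Squarefree moduli\<close>

lemma squarefree_nat_induct [consumes 1, case_names 1 mult]: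
  fixes n :: nat
  assumes "squarefree n" and "P 1"
    and step: "\<And>p k. prime p \<Longrightarrow> squarefree k \<Longrightarrow> coprime p k \<Longrightarrow> P k \<Longrightarrow> P (p * k)"
  shows "P n"
  using \<open>squarefree n\<close>
proof (induction n rule: less_induct)
  case (less n)
  have "n \<noteq> 0" using less.prems by (metis not_squarefree_0)
  show ?case
  proof (cases "n = 1")
    case False
    then obtain p where p: "prime p" "p dvd n" using prime_factor_nat by blast
    then obtain k where k: "n = p * k" by blast
    have "squarefree k" using less.prems squarefree_mono[of k n] k by simp
    moreover have "k < n" using k \<open>n \<noteq> 0\<close> prime_gt_1_nat[OF p(1)] by simp
    moreover have "coprime p k"
    proof (rule ccontr)
      assume "\<not> coprime p k"
      then have "p dvd k" using p(1) prime_imp_coprime by blast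
      then have "p ^ 2 dvd n" using k by (simp add: power2_eq_square)
      then have "p dvd 1" using less.prems squarefreeD by blast
      then show False using p(1) by (simp add: prime_nat_iff)
    qed
    ultimately show ?thesis using step[OF p(1)] less.IH k by blast
  qed (use assms(2) in simp)
qed

definition index_dvd_at :: "int \<Rightarrow> int \<Rightarrow> int \<Rightarrow> nat \<Rightarrow> int \<Rightarrow> bool" where
  "index_dvd_at t a b n r \<longleftrightarrow> int n dvd cubic_der t a r \<and> int (n ^ 2) dvd cubic_val t a b r"

text \<open>Taylor expansion: f(r + n k) = f(r) + n k f'(r) modulo n^2, and n divides f'(r). So only
  r modulo n matters although f(r) is taken modulo n^2.\<close>

lemma index_dvd_at_shift:
  assumes "index_dvd_at t a b n r" "int n dvd r' - r"
  shows "index_dvd_at t a b n r'"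
proof -
  obtain k where k: "r' - r = int n * k" using assms(2) by blast
  then have r': "r' = r + int n * k" by simp
  obtain u where u: "cubic_der t a r = int n * u"
    using assms(1) by (auto simp: index_dvd_at_def)
  have "cubic_der t a r' = int n * (u + 6 * r * k + 3 * int n * k ^ 2 + 2 * t * k)"
    using u unfolding r' cubic_der_def by (simp add: algebra_simps power2_eq_square)
  moreover have "cubic_val t a b r' = cubic_val t a b r + int n * k * cubic_der t a r
    + int (n ^ 2) * (k ^ 2 * (3 * r + t) + int n * k ^ 3)"
    unfolding r' cubic_der_def cubic_val_def by (simp add: algebra_simps power2_eq_square power3_eq_cube)
  then have "cubic_val t a b r' = cubic_val t a b r + int (n ^ 2) * (k * u + k ^ 2 * (3 * r + t) + int n * k ^ 3)"
    unfolding u by (simp add: algebra_simps power2_eq_square)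
  ultimately show ?thesis using assms(1) by (simp add: index_dvd_at_def)
qed

lemma index_dvd_at_mult:
  assumes "coprime n m"
  shows "index_dvd_at t a b (n * m) r \<longleftrightarrow> index_dvd_at t a b n r \<and> index_dvd_at t a b m r"
proof -
  have c: "coprime (int n) (int m)" using assms by simp
  then have c2: "coprime (int (n ^ 2)) (int (m ^ 2))" by simp
  have "int (n * m) dvd k \<longleftrightarrow> int n dvd k \<and> int m dvd k" for k
    using divides_mult[OF _ _ c] by (auto intro: dvd_mult_left dvd_mult_right)
  moreover have "int ((n * m) ^ 2) dvd k \<longleftrightarrow> int (n ^ 2) dvd k \<and> int (m ^ 2) dvd k" for k
    using divides_mult[OF _ _ c2] by (auto simp: power_mult_distrib intro: dvd_mult_left dvd_mult_right)
  ultimately show ?thesis unfolding index_dvd_at_def by blast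
qed

text \<open>Induction over the primes of n, with \<open>prime_dvd_ind_iff\<close> at each of them.
  The roots for p and k are merged by the Chinese remainder theorem modulo p and k, not their
  squares; this suffices by \<open>index_dvd_at_shift\<close>.\<close>

lemma squarefree_dvd_ind_iff:
  assumes "squarefree n" "disc t a b \<noteq> 0"
  shows "n dvd ind (cubic_poly t a b) \<longleftrightarrow> (\<exists>r. index_dvd_at t a b n r)"
  using assms(1)
proof (induction rule: squarefree_nat_induct)
  case 1
  show ?case by (simp add: index_dvd_at_def)
next
  case (mult p k)
  have "p * k dvd ind (cubic_poly t a b) \<longleftrightarrow> p dvd ind (cubic_poly t a b) \<and> k dvd ind (cubic_poly t a b)"
    using divides_mult[OF _ _ mult.hyps(3)] by (auto intro: dvd_mult_left dvd_mult_right)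
  also have "\<dots> \<longleftrightarrow> (\<exists>r. index_dvd_at t a b p r) \<and> (\<exists>r. index_dvd_at t a b k r)"
    using prime_dvd_ind_iff[OF assms(2) mult.hyps(1)] mult.IH by (simp add: index_dvd_at_def)
  also have "\<dots> \<longleftrightarrow> (\<exists>r. index_dvd_at t a b (p * k) r)"
  proof
    assume "(\<exists>r. index_dvd_at t a b p r) \<and> (\<exists>r. index_dvd_at t a b k r)"
    then obtain r s where rs: "index_dvd_at t a b p r" "index_dvd_at t a b k s" by blast
    have "coprime (int p) (int k)" using mult.hyps(3) by simp
    then obtain x where "[x = r] (mod int p)" "[x = s] (mod int k)"
      using binary_chinese_remainder_int by blast
    then show "\<exists>r. index_dvd_at t a b (p * k) r"
      using index_dvd_at_shift[OF rs(1)] index_dvd_at_shift[OF rs(2)]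
      unfolding index_dvd_at_mult[OF mult.hyps(3)] by (auto simp: cong_iff_dvd_diff)
  qed (auto simp: index_dvd_at_mult[OF mult.hyps(3)])
  finally show ?case .
qed

lemma squarefree_dvd_power:
  fixes n m :: nat
  assumes "squarefree n" "n dvd m ^ k"
  shows "n dvd m"
  using assms
proof (induction rule: squarefree_nat_induct)
  case (mult p l)
  then have "p dvd m" "l dvd m" by (auto intro: dvd_mult_left dvd_mult_right dest: prime_dvd_power)
  then show ?case using mult.hyps(3) by (simp add: divides_mult)
qed simp

text \<open>The identity for (r - s)^3 below is the error term of the trapezoidal rule for a cubic.\<close>

lemma index_dvd_at_unique:
  assumes "squarefree n" "index_dvd_at t a b n r" "index_dvd_at t a b n s"
  shows "int n dvd r - s"
proof -
  have "(r - s) ^ 3 = (r - s) * (cubic_der t a r + cubic_der t a s)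
      - 2 * (cubic_val t a b r - cubic_val t a b s)"
    by (simp add: cubic_der_def cubic_val_def algebra_simps power2_eq_square power3_eq_cube)
  moreover have "int n dvd cubic_val t a b r" "int n dvd cubic_val t a b s"
    using assms by (auto simp: index_dvd_at_def power2_eq_square intro: dvd_mult_left)
  ultimately have "int n dvd (r - s) ^ 3"
    using assms by (auto simp: index_dvd_at_def)
  then have "int n dvd int (nat \<bar>r - s\<bar> ^ 3)" by (simp add: power_abs[symmetric])
  then have "n dvd nat \<bar>r - s\<bar> ^ 3" by (simp only: int_dvd_int_iff)
  then have "n dvd nat \<bar>r - s\<bar>" by (rule squarefree_dvd_power[OF assms(1)])
  then show ?thesis by (simp add: dvd_nat_abs_iff)
qed

lemma index_dvd_at_ex1:
  assumes "squarefree n"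
  shows "(\<exists>r. index_dvd_at t a b n r) \<longleftrightarrow> (\<exists>!r. r \<in> {0..<int n} \<and> index_dvd_at t a b n r)"
proof
  assume "\<exists>r. index_dvd_at t a b n r"
  then obtain r where r: "index_dvd_at t a b n r" by blast
  have n: "n > 0" using assms by (metis gr0I not_squarefree_0)
  show "\<exists>!r. r \<in> {0..<int n} \<and> index_dvd_at t a b n r"
  proof (rule ex1I[of _ "r mod int n"])
    have "int n dvd r mod int n - r" by (metis dvd_minus_mod minus_diff_eq dvd_minus_iff)
    then show *: "r mod int n \<in> {0..<int n} \<and> index_dvd_at t a b n (r mod int n)"
      using index_dvd_at_shift[OF r] n by simp
    fix s assume s: "s \<in> {0..<int n} \<and> index_dvd_at t a b n s"
    then have "int n dvd s - r mod int n" using * index_dvd_at_unique[OF assms] by blast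
    then show "s = r mod int n"
      using s by (metis atLeastLessThan_iff mod_eq_dvd_iff mod_mod_trivial mod_pos_pos_trivial)
  qed
qed blast

section \<open>The number of zeros of f' modulo n\<close>

abbreviation der_roots :: "nat \<Rightarrow> int \<Rightarrow> int \<Rightarrow> int set" where
  "der_roots n t a \<equiv> {r \<in> {0..<int n}. int n dvd cubic_der t a r}"

lemma card_roots_mult_le:
  fixes g :: "int \<Rightarrow> int"
  assumes "coprime p k" "p > 0" "k > 0"
    and g: "\<And>n r s. int n dvd r - s \<Longrightarrow> int n dvd g r - g s"
  shows "card {r \<in> {0..<int (p * k)}. int (p * k) dvd g r}
    \<le> card {r \<in> {0..<int p}. int p dvd g r} * card {r \<in> {0..<int k}. int k dvd g r}"
proof -
  let ?A = "\<lambda>n. {r \<in> {0..<int n}. int n dvd g r}"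
  let ?\<phi> = "\<lambda>r. (r mod int p, r mod int k)"
  have "inj_on ?\<phi> (?A (p * k))"
  proof (rule inj_onI)
    fix r s assume rs: "r \<in> ?A (p * k)" "s \<in> ?A (p * k)" "?\<phi> r = ?\<phi> s"
    then have "int p dvd r - s" "int k dvd r - s" by (auto simp: mod_eq_dvd_iff)
    then have "int p * int k dvd r - s" using assms(1) by (intro divides_mult) auto
    then have "r mod int (p * k) = s mod int (p * k)" by (simp add: mod_eq_dvd_iff)
    then show "r = s" using rs(1,2) by simp
  qed
  moreover have "?\<phi> ` ?A (p * k) \<subseteq> ?A p \<times> ?A k"
  proof -
    have "r mod int n \<in> ?A n" if "int n dvd g r" "n > 0" for r n
    proof -
      have "int n dvd r mod int n - r" by (metis dvd_minus_mod minus_diff_eq dvd_minus_iff)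
      then have "int n dvd g (r mod int n) - g r" by (rule g)
      then have "int n dvd g (r mod int n)" using that(1) by (metis dvd_diffD diff_add_cancel dvd_add)
      then show ?thesis using that(2) by simp
    qed
    moreover have "int p dvd g r" "int k dvd g r" if "int (p * k) dvd g r" for r
      using that by (auto intro: dvd_mult_left dvd_mult_right)
    ultimately show ?thesis using assms(2,3) by auto
  qed
  moreover have "finite (?A n)" for n
    by (rule finite_subset[of _ "{0..<int n}"]) auto
  ultimately have "card (?A (p * k)) \<le> card (?A p \<times> ?A k)"
    by (intro card_inj_on_le[of ?\<phi>] finite_cartesian_product)
  then show ?thesis by (simp add: card_cartesian_product)
qed

text \<open>The bound 3 is needed for p = 3, where the quadratic may vanish identically.\<close>

lemma card_cubic_der_roots_prime:
  assumes p: "prime p"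
  shows "card (der_roots p t a) \<le> 3"
proof (cases "p = 3")
  case True
  have "card (der_roots p t a) \<le> card {0..<int p}"
    by (intro card_mono) auto
  then show ?thesis using True by simp
next
  case False
  let ?A = "der_roots p t a"
  have 3: "\<not> int p dvd 3"
  proof
    assume "int p dvd 3"
    then have "p dvd 3" by (metis int_dvd_int_iff of_nat_numeral)
    then show False using False p using primes_dvd_imp_eq[of p 3] by simp
  qed
  have ip: "prime (int p)" using p by simp
  show ?thesis
  proof (cases "?A = {}")
    case False
    then obtain r where r: "r \<in> ?A" by blast
    \<comment> \<open>If r is the only zero, m is unspecified; the inclusion below holds
      nevertheless, because any s outside it is a second zero and makes the choice
      meaningful.\<close>
    define m where "m = (SOME m. m \<in> ?A \<and> m \<noteq> r)"
    have "?A \<subseteq> {r, m}"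
    proof (rule subsetI, rule ccontr)
      fix s assume s: "s \<in> ?A" "s \<notin> {r, m}"
      then have m: "m \<in> ?A \<and> m \<noteq> r" unfolding m_def by (metis (mono_tags, lifting) insertI1 someI_ex)
      \<comment> \<open>The difference of the values of f' at u and r has the factor u - r;
        cancelling it leaves a linear congruence for u, and two solutions differ by a multiple of p
        because p is not 3.\<close>
      have key: "int p dvd 3 * (r + u) + 2 * t" if "u \<in> ?A" "u \<noteq> r" for u
      proof -
        have "cubic_der t a u - cubic_der t a r = (u - r) * (3 * (r + u) + 2 * t)"
          by (simp add: cubic_der_def algebra_simps power2_eq_square)
        then have "int p dvd (u - r) * (3 * (r + u) + 2 * t)"
          using that r by (metis (no_types, lifting) dvd_diff mem_Collect_eq)
        moreover have "\<not> int p dvd u - r"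
          using that r zdvd_imp_le[of "int p" "\<bar>u - r\<bar>"] by auto
        ultimately show ?thesis using ip by (auto simp: prime_dvd_mult_iff)
      qed
      have "int p dvd (3 * (r + s) + 2 * t) - (3 * (r + m) + 2 * t)"
        using key[of s] key[of m] s m by (intro dvd_diff) auto
      then have "int p dvd 3 * (s - m)" by (simp add: algebra_simps)
      then have "int p dvd s - m" using ip 3 prime_dvd_mult_iff by blast
      then show False using s m zdvd_imp_le[of "int p" "\<bar>s - m\<bar>"] by auto
    qed
    then have "card ?A \<le> card {r, m}" by (intro card_mono) auto
    also have "\<dots> \<le> 2" by (simp add: card_insert_if)
    finally show ?thesis by simp
  next
    case True
    show ?thesis unfolding True by simp
  qed
qed

lemma cubic_der_diff_dvd: "int n dvd r - s \<Longrightarrow> int n dvd cubic_der t a r - cubic_der t a s"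
proof -
  have "cubic_der t a r - cubic_der t a s = (r - s) * (3 * (r + s) + 2 * t)"
    by (simp add: cubic_der_def algebra_simps power2_eq_square)
  then show "int n dvd r - s \<Longrightarrow> int n dvd cubic_der t a r - cubic_der t a s" by simp
qed

text \<open>Primes p >= 3^(1/e) contribute a factor 3 <= p^e each, and the others at most K factors 3.\<close>

lemma card_cubic_der_roots_le:
  fixes \<epsilon> :: real
  assumes "\<epsilon> > 0"
  obtains C where "C > 0" "\<And>n t a. squarefree n \<Longrightarrow>
    real (card (der_roots n t a)) \<le> C * real n powr \<epsilon>"
proof -
  define K where "K = nat \<lceil>3 powr (1 / \<epsilon>)\<rceil>"
  have big: "3 \<le> real p powr \<epsilon>" if "p \<ge> K" for p :: nat
  proof -
    have "3 powr (1 / \<epsilon>) \<le> real p" using that unfolding K_def by linarith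
    then have "(3 powr (1 / \<epsilon>)) powr \<epsilon> \<le> real p powr \<epsilon>" using assms by (intro powr_mono2) auto
    then show ?thesis using assms by (simp add: powr_powr)
  qed
  \<comment> \<open>The exponent counts the primes of n below K, so that in the induction each new
    prime is absorbed by one of the two factors; it is replaced by K only at the end.\<close>
  have main: "real (card (der_roots n t a))
      \<le> 3 ^ card {p. prime p \<and> p dvd n \<and> p < K} * real n powr \<epsilon>" if "squarefree n" for n t a
    using that
  proof (induction rule: squarefree_nat_induct)
    case 1
    have "card (der_roots 1 t a) \<le> card {0::int}"
      by (intro card_mono) auto
    then have "real (card (der_roots 1 t a)) \<le> real (card {0::int})"
      by (rule of_nat_mono)
    also have "\<dots> \<le> 3 ^ card {p. prime p \<and> p dvd (1::nat) \<and> p < K} * real 1 powr \<epsilon>" by simp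
    finally show ?case .
  next
    case (mult p k)
    let ?A = "\<lambda>n. der_roots n t a"
    let ?P = "\<lambda>n. {p::nat. prime p \<and> p dvd n \<and> p < K}"
    have p0: "p > 0" using mult.hyps(1) by (rule prime_gt_0_nat)
    have k0: "k > 0" using mult.hyps(2) by (metis gr0I not_squarefree_0)
    have fin: "finite (?P n)" for n by (rule finite_subset[of _ "{..<K}"]) auto
    have "card (?A (p * k)) \<le> card (?A p) * card (?A k)"
      by (rule card_roots_mult_le) (use mult.hyps p0 k0 cubic_der_diff_dvd in auto)
    also have "\<dots> \<le> 3 * card (?A k)"
      by (intro mult_right_mono card_cubic_der_roots_prime mult.hyps) simp
    finally have "real (card (?A (p * k))) \<le> 3 * real (card (?A k))" by linarith
    also have "\<dots> \<le> 3 * (3 ^ card (?P k) * real k powr \<epsilon>)"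
      using mult.IH by simp
    also have "\<dots> \<le> 3 ^ card (?P (p * k)) * real (p * k) powr \<epsilon>"
    proof (cases "p < K")
      case True
      have "p \<notin> ?P k" using mult.hyps by (auto dest: coprime_common_divisor_nat[of p k p] simp: prime_nat_iff)
      then have "Suc (card (?P k)) = card (insert p (?P k))" using fin by simp
      also have "\<dots> \<le> card (?P (p * k))"
        using mult.hyps True by (intro card_mono fin) auto
      finally have "(3::real) ^ Suc (card (?P k)) \<le> 3 ^ card (?P (p * k))"
        by (intro power_increasing) auto
      moreover have "real k powr \<epsilon> \<le> real (p * k) powr \<epsilon>"
        using p0 assms mult_le_mono1[of 1 p k] by (intro powr_mono2) (auto simp flip: of_nat_mult)
      ultimately have "3 ^ Suc (card (?P k)) * real k powr \<epsilon> \<le> 3 ^ card (?P (p * k)) * real (p * k) powr \<epsilon>"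
        by (intro mult_mono) auto
      then show ?thesis by simp
    next
      case False
      have "(3::real) ^ card (?P k) \<le> 3 ^ card (?P (p * k))"
        by (intro power_increasing card_mono fin) auto
      moreover have "3 * real k powr \<epsilon> \<le> real p powr \<epsilon> * real k powr \<epsilon>"
        using big[of p] False by (intro mult_right_mono) auto
      then have "3 * real k powr \<epsilon> \<le> real (p * k) powr \<epsilon>" by (simp add: powr_mult)
      ultimately have "3 ^ card (?P k) * (3 * real k powr \<epsilon>) \<le> 3 ^ card (?P (p * k)) * real (p * k) powr \<epsilon>"
        by (intro mult_mono) auto
      then show ?thesis by (simp add: mult_ac)
    qed
    finally show ?case .
  qed
  show thesis
  proof (rule that[of "3 ^ K"])
    fix n :: nat and t a assume n: "squarefree n"
    have "card {p. prime p \<and> p dvd n \<and> p < K} \<le> card {..<K}" by (intro card_mono) auto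
    then have "(3::real) ^ card {p. prime p \<and> p dvd n \<and> p < K} \<le> 3 ^ K"
      by (intro power_increasing) auto
    then show "real (card (der_roots n t a)) \<le> 3 ^ K * real n powr \<epsilon>"
      using main[OF n, of t a] by (meson mult_right_mono order_trans powr_ge_zero)
  qed simp
qed

section \<open>Densities\<close>

definition reduce :: "nat \<Rightarrow> int \<times> int \<times> int \<Rightarrow> int \<times> int \<times> int" where
  "reduce N = (\<lambda>(t, a, b). (t, a mod int N, b mod int N))"

lemma reduce_simp [simp]: "reduce N (t, a, b) = (t, a mod int N, b mod int N)"
  by (simp add: reduce_def)

lemma finite_reduce_image:
  assumes "S \<subseteq> VZ" "N > 0"
  shows "finite (reduce N ` S)"
proof (rule finite_subset)
  show "reduce N ` S \<subseteq> {-1, 0, 1} \<times> {0..<int N} \<times> {0..<int N}"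
    using assms by (auto simp: VZ_def)
qed auto

lemma nu_reduce: "nu S = (INF N \<in> {0::nat<..}. real (card (reduce N ` S)) / (3 * real N ^ 2))"
  by (simp add: nu_def reduce_def)

lemma card_reduce_mult_le:
  assumes "S \<subseteq> VZ" "N > 0" "M > 0"
  shows "card (reduce (N * M) ` S) \<le> card (reduce N ` S) * M ^ 2"
proof -
  let ?\<phi> = "\<lambda>(t::int, a, b). ((t, a mod int N, b mod int N), a div int N, b div int N)"
  have "inj_on ?\<phi> (reduce (N * M) ` S)"
  proof (rule inj_on_subset)
    show "inj ?\<phi>" by (rule injI) (auto, (metis div_mult_mod_eq)+)
  qed simp
  moreover have "?\<phi> ` reduce (N * M) ` S \<subseteq> reduce N ` S \<times> ({0..<int M} \<times> {0..<int M})"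
  proof
    fix y assume "y \<in> ?\<phi> ` reduce (N * M) ` S"
    then obtain t a b where x: "(t, a, b) \<in> S" "y = ?\<phi> (reduce (N * M) (t, a, b))" by force
    have "c mod (int N * int M) div int N \<in> {0..<int M}" for c
    proof -
      have "int N * (c mod (int N * int M) div int N) \<le> c mod (int N * int M)"
        by (metis assms(2) mult.commute mult_div_mod_eq le_add_same_cancel1 of_nat_0_less_iff pos_mod_sign)
      also have "\<dots> < int N * int M" using assms by simp
      finally have "c mod (int N * int M) div int N < int M" using assms by simp
      then show ?thesis using assms by (simp add: pos_imp_zdiv_nonneg_iff)
    qed
    moreover have "reduce N (t, a, b) \<in> reduce N ` S" using x(1) by (rule imageI)
    ultimately show "y \<in> reduce N ` S \<times> ({0..<int M} \<times> {0..<int M})"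
      unfolding x(2) by (simp add: mod_mod_cancel)
  qed
  moreover have "finite (reduce N ` S \<times> ({0..<int M} \<times> {0..<int M}))"
    using assms by (intro finite_cartesian_product finite_reduce_image) auto
  ultimately have "card (reduce (N * M) ` S) \<le> card (reduce N ` S \<times> ({0..<int M} \<times> {0..<int M}))"
    by (intro card_inj_on_le)
  then show ?thesis by (simp add: card_cartesian_product power2_eq_square)
qed

text \<open>The condition \<open>dense\<close> makes S dense in the union of the classes in C. Hence
  S meets all the card C N^2 classes modulo M N above C. A class modulo N contains M^2 classes
  modulo M N, so S meets at least card C N^2 / M^2 classes modulo N, and the infimum is attained at
  N = M.\<close>

lemma nu_eqI:
  assumes S: "S \<subseteq> VZ" and M: "M > 0" and C: "C = reduce M ` S"
    and dense: "\<And>t a b K. reduce M (t, a, b) \<in> C \<Longrightarrow> K > 0 \<Longrightarrow> \<exists>x\<in>S. reduce K x = reduce K (t, a, b)"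
  shows "nu S = real (card C) / (3 * real M ^ 2)"
proof -
  have "real (card C) / (3 * real M ^ 2) \<le> real (card (reduce N ` S)) / (3 * real N ^ 2)" if N: "N > 0" for N
  proof -
    let ?\<phi> = "\<lambda>((t::int, a, b), i, j). (t, a + int M * i, b + int M * j)"
    have mm: "(c mod int M + int M * i) mod int M = c mod int M"
      "(c mod int M + int M * i) div int M = i" for c i
      using M by (simp_all add: div_add_self2)
    have "inj_on ?\<phi> (C \<times> ({0..<int N} \<times> {0..<int N}))"
    proof (rule inj_onI)
      fix u v assume uv: "u \<in> C \<times> ({0..<int N} \<times> {0..<int N})" "v \<in> C \<times> ({0..<int N} \<times> {0..<int N})"
        "?\<phi> u = ?\<phi> v"
      obtain t a b i j where u: "u = ((t, a mod int M, b mod int M), i, j)"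
        using uv(1) by (auto simp: C)
      obtain t' a' b' i' j' where v: "v = ((t', a' mod int M, b' mod int M), i', j')"
        using uv(2) by (auto simp: C)
      have "t = t'" and e: "a mod int M + int M * i = a' mod int M + int M * i'"
        "b mod int M + int M * j = b' mod int M + int M * j'"
        using uv(3) by (auto simp: u v)
      with mm[of a i] mm[of a' i'] mm[of b j] mm[of b' j'] show "u = v"
        unfolding u v by metis
    qed
    moreover have "?\<phi> ` (C \<times> ({0..<int N} \<times> {0..<int N})) \<subseteq> reduce (M * N) ` S"
    proof
      fix y assume "y \<in> ?\<phi> ` (C \<times> ({0..<int N} \<times> {0..<int N}))"
      then obtain t a b i j where *: "(t, a, b) \<in> C" "i \<in> {0..<int N}" "j \<in> {0..<int N}"
        and y: "y = (t, a + int M * i, b + int M * j)" by auto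
      have ab: "a \<in> {0..<int M}" "b \<in> {0..<int M}" using *(1) M by (auto simp: C)
      then have "reduce M y = (t, a, b)" by (simp add: y)
      then obtain x where x: "x \<in> S" "reduce (M * N) x = reduce (M * N) y"
        using dense[of t "a + int M * i" "b + int M * j" "M * N"] *(1) M N y by auto
      have lt: "c + int M * k < int M * int N" if "c \<in> {0..<int M}" "k \<in> {0..<int N}" for c k
      proof -
        have "c + int M * k < int M * (k + 1)" using that by (simp add: distrib_left)
        also have "\<dots> \<le> int M * int N" using that by (intro mult_left_mono) auto
        finally show ?thesis .
      qed
      have "reduce (M * N) y = y"
        using ab * lt by (simp add: y)
      then show "y \<in> reduce (M * N) ` S" using x by force
    qed
    ultimately have "card (C \<times> ({0..<int N} \<times> {0..<int N})) \<le> card (reduce (M * N) ` S)"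
      using finite_reduce_image[OF S, of "M * N"] M N by (intro card_inj_on_le) auto
    also have "\<dots> \<le> card (reduce N ` S) * M ^ 2"
      using card_reduce_mult_le[OF S N M] by (simp add: mult.commute)
    finally have "card C * N ^ 2 \<le> card (reduce N ` S) * M ^ 2"
      by (simp add: card_cartesian_product power2_eq_square)
    then have "real (card C) * real N ^ 2 \<le> real (card (reduce N ` S)) * real M ^ 2"
      by (metis of_nat_le_iff of_nat_mult of_nat_power)
    then show ?thesis using M N by (simp add: field_simps)
  qed
  then have "real (card C) / (3 * real M ^ 2) \<le> nu S"
    unfolding nu_reduce by (intro cINF_greatest) auto
  moreover have "nu S \<le> real (card C) / (3 * real M ^ 2)"
    unfolding nu_reduce C using M by (intro cINF_lower bdd_belowI2[of _ 0]) auto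
  ultimately show ?thesis by simp
qed

lemma nu_defined_mod:
  assumes "defined_mod m L" "m > 0"
  shows "nu L = real (card (reduce m ` L)) / (3 * real m ^ 2)"
proof (rule nu_eqI)
  show "L \<subseteq> VZ" using assms by (simp add: defined_mod_def)
  fix t a b and K :: nat
  assume "reduce m (t, a, b) \<in> reduce m ` L" "K > 0"
  then obtain a' b' where ab: "(t, a', b') \<in> L" "a' mod int m = a mod int m" "b' mod int m = b mod int m" by auto
  then have "(t, a', b') \<in> VZ" using assms by (auto simp: defined_mod_def)
  then have "(t, a, b) \<in> L" using assms(1) ab unfolding defined_mod_def by blast
  then show "\<exists>x\<in>L. reduce K x = reduce K (t, a, b)" by blast
qed (use assms in auto)

section \<open>The density of the polynomials with index divisible by n\<close>

lemma index_dvd_at_cong: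
  assumes "a mod int (n ^ 2) = a' mod int (n ^ 2)" "b mod int (n ^ 2) = b' mod int (n ^ 2)"
  shows "index_dvd_at t a b n r \<longleftrightarrow> index_dvd_at t a' b' n r"
proof -
  obtain k l where kl: "a = a' + int (n ^ 2) * k" "b = b' + int (n ^ 2) * l"
    using assms by (auto simp: mod_eq_dvd_iff elim!: dvdE) (metis diff_add_cancel add.commute)
  have "cubic_der t a r = cubic_der t a' r + int n * (int n * k)"
    "cubic_val t a b r = cubic_val t a' b' r + int (n ^ 2) * (k * r + l)"
    by (simp_all add: kl cubic_der_def cubic_val_def algebra_simps power2_eq_square)
  then show ?thesis
    unfolding index_dvd_at_def by (metis dvd_add_left_iff dvd_triv_left)
qed

lemma finite_disc_zero: "finite {b :: int. disc t a b = 0}"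
proof -
  let ?p = "[:t^2 * a^2 - 4 * a^3, 18 * t * a - 4 * t^3, -27:]"
  have "{b. disc t a b = 0} = {b. poly ?p b = 0}"
    by (auto simp: disc_def algebra_simps power2_eq_square)
  then show ?thesis using poly_roots_finite[of ?p] by simp
qed

lemma mod_diff_mod_mult_eq: "(p - (x mod m) * r) mod m = (p - x * r) mod (m :: int)"
  by (metis mod_diff_right_eq mod_mult_left_eq)

abbreviation index_classes :: "int \<Rightarrow> nat \<Rightarrow> (int \<times> int) set" where
  "index_classes t n \<equiv> {(a, b). a \<in> {0..<int (n ^ 2)} \<and> b \<in> {0..<int (n ^ 2)} \<and> (\<exists>r. index_dvd_at t a b n r)}"

text \<open>The pairs are parametrised by r and i modulo n: a is n i - 3 r^2 - 2 t r, and f(r) = 0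
  then determines b modulo n^2. Different r give different pairs by
  \<open>index_dvd_at_unique\<close>.\<close>

lemma card_index_classes:
  assumes n: "squarefree n"
  shows "card (index_classes t n) = n ^ 2"
proof -
  have n0: "n > 0" using n by (metis gr0I not_squarefree_0)
  define \<alpha> where "\<alpha> = (\<lambda>r i. (int n * i - 3 * r ^ 2 - 2 * t * r) mod int (n ^ 2))"
  define \<beta> where "\<beta> = (\<lambda>r i. (- (r ^ 3) - t * r ^ 2 - \<alpha> r i * r) mod int (n ^ 2))"
  have ix: "index_dvd_at t (\<alpha> r i) (\<beta> r i) n r" for r i
  proof -
    have "index_dvd_at t (int n * i - 3 * r ^ 2 - 2 * t * r) (- (r ^ 3) - t * r ^ 2 - (int n * i - 3 * r ^ 2 - 2 * t * r) * r) n r"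
      by (simp add: index_dvd_at_def cubic_der_def cubic_val_def algebra_simps)
    moreover have "\<beta> r i mod int (n ^ 2) = (- (r ^ 3) - t * r ^ 2 - (int n * i - 3 * r ^ 2 - 2 * t * r) * r) mod int (n ^ 2)"
      unfolding \<beta>_def \<alpha>_def mod_mod_trivial by (rule mod_diff_mod_mult_eq)
    ultimately show ?thesis
      by (subst index_dvd_at_cong) (auto simp: \<alpha>_def)
  qed
  have "bij_betw (\<lambda>(r, i). (\<alpha> r i, \<beta> r i)) ({0..<int n} \<times> {0..<int n}) (index_classes t n)"
    unfolding bij_betw_def
  proof
    show "inj_on (\<lambda>(r, i). (\<alpha> r i, \<beta> r i)) ({0..<int n} \<times> {0..<int n})"
    proof (rule inj_onI, clarify)
      fix r i s j assume r: "r \<in> {0..<int n}" "i \<in> {0..<int n}" "s \<in> {0..<int n}" "j \<in> {0..<int n}"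
        and eq: "\<alpha> r i = \<alpha> s j" "\<beta> r i = \<beta> s j"
      have "index_dvd_at t (\<alpha> r i) (\<beta> r i) n s" using ix[of s j] eq by simp
      then have "int n dvd r - s" by (rule index_dvd_at_unique[OF n ix])
      then have rs: "r = s" using r(1,3) by (metis atLeastLessThan_iff mod_eq_dvd_iff mod_pos_pos_trivial)
      then have "int (n ^ 2) dvd int n * i - int n * j"
        using eq(1) by (simp add: \<alpha>_def mod_eq_dvd_iff)
      then have "int n * int n dvd int n * (i - j)" by (simp add: power2_eq_square right_diff_distrib)
      then have "int n dvd i - j" using n0 by simp
      then have "i = j" using r(2,4) by (metis atLeastLessThan_iff mod_eq_dvd_iff mod_pos_pos_trivial)
      with rs show "r = s \<and> i = j" by blast
    qed
    show "(\<lambda>(r, i). (\<alpha> r i, \<beta> r i)) ` ({0..<int n} \<times> {0..<int n}) = index_classes t n"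
    proof (intro equalityI subsetI)
      fix x assume "x \<in> (\<lambda>(r, i). (\<alpha> r i, \<beta> r i)) ` ({0..<int n} \<times> {0..<int n})"
      then show "x \<in> index_classes t n" using ix n0 by (auto simp: \<alpha>_def \<beta>_def)
    next
      fix x assume x: "x \<in> index_classes t n"
      obtain a b where ab: "x = (a, b)" by fastforce
      then obtain r where r: "r \<in> {0..<int n}" "index_dvd_at t a b n r"
        using x index_dvd_at_ex1[OF n, of t a b] by auto
      obtain k where k: "3 * r ^ 2 + 2 * t * r + a = int n * k"
        using r(2) by (auto simp: index_dvd_at_def cubic_der_def)
      define u v where "u = k div int n" and "v = k mod int n"
      have "k = int n * u + v" by (simp add: u_def v_def)
      then have "int n * k = int (n ^ 2) * u + int n * v"
        by (simp add: algebra_simps power2_eq_square)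
      then have "int n * k = int (n ^ 2) * (k div int n) + int n * (k mod int n)"
        by (simp only: u_def v_def)
      then have "a - (int n * (k mod int n) - 3 * r ^ 2 - 2 * t * r) = int (n ^ 2) * (k div int n)"
        using k by linarith
      then have "int (n ^ 2) dvd a - (int n * (k mod int n) - 3 * r ^ 2 - 2 * t * r)" by simp
      then have "a mod int (n ^ 2) = \<alpha> r (k mod int n)" by (simp add: \<alpha>_def mod_eq_dvd_iff)
      then have a: "a = \<alpha> r (k mod int n)" using x ab by simp
      have "int (n ^ 2) dvd b - (- (r ^ 3) - t * r ^ 2 - a * r)"
        using r(2) by (simp add: index_dvd_at_def cubic_val_def algebra_simps)
      then have "b mod int (n ^ 2) = \<beta> r (k mod int n)" unfolding \<beta>_def a[symmetric] by (simp add: mod_eq_dvd_iff)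
      then have b: "b = \<beta> r (k mod int n)" using x ab by simp
      show "x \<in> (\<lambda>(r, i). (\<alpha> r i, \<beta> r i)) ` ({0..<int n} \<times> {0..<int n})"
        unfolding ab using a b r(1) n0 by (intro image_eqI[of _ _ "(r, k mod int n)"]) auto
    qed
  qed
  then have "card ({0..<int n} \<times> {0..<int n}) = card (index_classes t n)" by (rule bij_betw_same_card)
  moreover have "card ({0..<int n} \<times> {0..<int n}) = n ^ 2"
    by (simp add: card_cartesian_product power2_eq_square)
  ultimately show ?thesis by (rule trans[OF sym])
qed

lemma nu_Sigma_n:
  assumes n: "squarefree n"
  shows "nu (Sigma_n n) = 1 / real n ^ 2"
proof -
  have n0: "n > 0" using n by (metis gr0I not_squarefree_0)
  define C where "C = {(t, a, b). t \<in> {-1, 0, 1::int} \<and> a \<in> {0..<int (n ^ 2)} \<and> b \<in> {0..<int (n ^ 2)}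
    \<and> (\<exists>r. index_dvd_at t a b n r)}"
  have mem: "(t, a, b) \<in> Sigma_n n \<longleftrightarrow> t \<in> {-1, 0, 1} \<and> disc t a b \<noteq> 0 \<and> (\<exists>r. index_dvd_at t a b n r)" for t a b
    using squarefree_dvd_ind_iff[OF n] by (auto simp: Sigma_n_def VZ_def)
  have dense: "\<exists>x\<in>Sigma_n n. reduce K x = reduce K (t, a, b)"
    if "reduce (n ^ 2) (t, a, b) \<in> C" "K > 0" for t a b K
  proof -
    \<comment> \<open>The requirement of nonzero discriminant does not shrink the closure: b may be
      moved within its class modulo n^2 K, and for given t and a only finitely many b make the
      discriminant vanish.\<close>
    have "infinite (range (\<lambda>k. b + int (n ^ 2 * K) * k))"
    proof
      assume "finite (range (\<lambda>k. b + int (n ^ 2 * K) * k))"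
      then have "finite (UNIV :: int set)" by (rule finite_imageD) (use n0 that(2) in \<open>simp add: inj_on_def\<close>)
      then show False by (simp add: infinite_UNIV_int)
    qed
    then obtain b' where b': "b' \<in> range (\<lambda>k. b + int (n ^ 2 * K) * k)" "disc t a b' \<noteq> 0"
      using finite_disc_zero[of t a] by (metis (mono_tags, lifting) finite_subset mem_Collect_eq subsetI)
    then obtain k where k: "b' = b + int (n ^ 2 * K) * k" by blast
    have "b' mod int (n ^ 2) = b mod int (n ^ 2)" "b' mod int K = b mod int K"
      unfolding k by (simp_all add: mod_eq_dvd_iff)
    moreover have "t \<in> {-1, 0, 1} \<and> (\<exists>r. index_dvd_at t a b n r)"
      using that(1) index_dvd_at_cong[of a n "a mod int (n ^ 2)" b "b mod int (n ^ 2)" t] by (auto simp: C_def)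
    ultimately have "(t, a, b') \<in> Sigma_n n" "reduce K (t, a, b') = reduce K (t, a, b)"
      using b'(2) index_dvd_at_cong[of a n a b' b t] by (auto simp: mem)
    then show ?thesis by blast
  qed
  have C: "C = reduce (n ^ 2) ` Sigma_n n"
  proof (intro equalityI subsetI)
    fix x assume x: "x \<in> C"
    then obtain t a b where tab: "x = (t, a, b)" "reduce (n ^ 2) (t, a, b) = (t, a, b)" by (auto simp: C_def)
    then show "x \<in> reduce (n ^ 2) ` Sigma_n n" using dense[of t a b "n ^ 2"] x n0 by force
  next
    fix x assume "x \<in> reduce (n ^ 2) ` Sigma_n n"
    then obtain t a b where x: "(t, a, b) \<in> Sigma_n n" "x = (t, a mod int (n ^ 2), b mod int (n ^ 2))" by force
    then show "x \<in> C" using n0 index_dvd_at_cong[of a n "a mod int (n ^ 2)" b "b mod int (n ^ 2)" t]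
      by (auto simp: C_def mem)
  qed
  have "C = (SIGMA t:{-1, 0, 1}. index_classes t n)"
    by (auto simp: C_def)
  moreover have "finite (index_classes t n)" for t
    by (rule finite_subset[of _ "{0..<int (n ^ 2)} \<times> {0..<int (n ^ 2)}"]) auto
  ultimately have "card C = (\<Sum>t\<in>{-1, 0, 1::int}. n ^ 2)"
    using card_index_classes[OF n] by simp
  then have "card C = 3 * n ^ 2" by simp
  moreover have "nu (Sigma_n n) = real (card C) / (3 * real (n ^ 2) ^ 2)"
    using n0 by (intro nu_eqI[OF _ _ C dense]) (auto simp: Sigma_n_def)
  ultimately show ?thesis using n0 by (simp add: field_simps power2_eq_square)
qed

section \<open>The height condition\<close>

lemma hgt_less_iff:
  "hgt t a b < Y \<longleftrightarrow>
    (\<forall>z. poly (cubic_poly (of_real t) (of_real a) (of_real b)) z = 0 \<longrightarrow> cmod z < Y)"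
proof -
  let ?p = "cubic_poly (of_real t) (of_real a) (of_real b) :: complex poly"
  have "?p \<noteq> 0" by (simp add: cubic_poly_def)
  then have "finite {z. poly ?p z = 0}" by (rule poly_roots_finite)
  moreover have "\<not> constant (poly ?p)" by (simp add: constant_degree)
  then have "{z. poly ?p z = 0} \<noteq> {}" using fundamental_theorem_of_algebra by blast
  ultimately show ?thesis unfolding hgt_def by (subst Max_less_iff) auto
qed

lemma hgt_less_bounds:
  assumes "hgt t a b < Y"
  shows "\<bar>t\<bar> \<le> 3 * Y" "\<bar>a\<bar> \<le> 3 * Y ^ 2" "\<bar>b\<bar> \<le> Y ^ 3" "Y > 0" "Y \<le> 1 \<Longrightarrow> \<bar>b\<bar> < 1"
proof -
  obtain x y z :: complex where r: "of_real t = - (x + y + z)" "of_real a = x * y + x * z + y * z"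
    "of_real b = - (x * y * z)" by (rule complex_cubic_split)
  have n: "cmod x < Y" "cmod y < Y" "cmod z < Y"
    using assms unfolding hgt_less_iff poly_cubic_poly_roots[OF r] by auto
  then show Y: "Y > 0" using norm_ge_zero[of x] by linarith
  have p: "cmod (u * v) \<le> Y ^ 2" if "cmod u < Y" "cmod v < Y" for u v
    using that Y unfolding norm_mult power2_eq_square by (intro mult_mono) auto
  have "\<bar>t\<bar> = cmod (- (x + y + z))" unfolding r(1)[symmetric] by simp
  also have "\<dots> = cmod (x + y + z)" by (rule norm_minus_cancel)
  also have "\<dots> \<le> cmod x + cmod y + cmod z"
    using norm_triangle_ineq[of "x + y" z] norm_triangle_ineq[of x y] by linarith
  finally show "\<bar>t\<bar> \<le> 3 * Y" using n by linarith
  have "\<bar>a\<bar> = cmod (x * y + x * z + y * z)" unfolding r(2)[symmetric] by simp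
  also have "\<dots> \<le> cmod (x * y) + cmod (x * z) + cmod (y * z)"
    using norm_triangle_ineq[of "x * y + x * z" "y * z"] norm_triangle_ineq[of "x * y" "x * z"] by linarith
  finally show "\<bar>a\<bar> \<le> 3 * Y ^ 2" using p[of x y] p[of x z] p[of y z] n by linarith
  have b: "\<bar>b\<bar> = cmod (x * y) * cmod z" 
  proof -
    have "\<bar>b\<bar> = cmod (- (x * y * z))" unfolding r(3)[symmetric] by simp
    then show ?thesis by (simp add: norm_mult)
  qed
  also have "\<dots> \<le> Y ^ 2 * Y" using p[of x y] n Y by (intro mult_mono) auto
  finally show "\<bar>b\<bar> \<le> Y ^ 3" by (simp add: power2_eq_square power3_eq_cube)
  show "\<bar>b\<bar> < 1" if "Y \<le> 1"
  proof -
    have "cmod (x * y) \<le> 1" using p[of x y] n power_le_one[of Y 2] Y that by linarith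
    then have "\<bar>b\<bar> \<le> 1 * cmod z" unfolding b by (intro mult_right_mono) auto
    then show ?thesis using n(3) that by linarith
  qed
qed

text \<open>The coefficients are integers, so roots inside the unit disc force b = 0 and then a = 0,
  which leaves the double root 0.\<close>

lemma disc_eq_0_if_hgt_less_1:
  fixes t a b :: int
  assumes "hgt (of_int t) (of_int a) (of_int b) < Y" "Y \<le> 1"
  shows "disc t a b = 0"
proof -
  have "\<bar>of_int b :: real\<bar> < 1" using hgt_less_bounds(5)[OF assms] .
  then have b: "b = 0" by linarith
  obtain z w :: complex where zw: "of_int t = - (z + w)" "of_int a = z * w"
    by (rule complex_quadratic_split)
  have "poly (cubic_poly (of_real (of_int t)) (of_real (of_int a)) (of_real (of_int b))) x = x * ((x - z) * (x - w))"
    for x :: complex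
    by (simp add: poly_cubic_poly b zw algebra_simps power2_eq_square power3_eq_cube)
  then have "cmod z < 1" "cmod w < 1"
    using assms unfolding hgt_less_iff by force+
  then have "cmod (z * w) < 1" unfolding norm_mult
    by (metis mult_le_one norm_ge_zero less_le mult.right_neutral mult_left_le order_le_less_trans)
  then have "\<bar>of_int a :: real\<bar> < 1" unfolding zw(2)[symmetric] by simp
  then have "a = 0" by linarith
  then show ?thesis by (simp add: disc_def b)
qed

section \<open>Polynomial inequalities equivalent to a bound for the height\<close>

lemma real_cubic_root: "\<exists>r::real. r ^ 3 + t * r ^ 2 + a * r + b = 0"
proof -
  define M where "M = 1 + \<bar>t\<bar> + \<bar>a\<bar> + \<bar>b\<bar>"
  have M: "M \<ge> 1" by (simp add: M_def)
  have M2: "M \<le> M ^ 2" using M by (simp add: power2_eq_square)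
  have bounds: "\<bar>t * M ^ 2\<bar> \<le> \<bar>t\<bar> * M ^ 2" "\<bar>a * M\<bar> \<le> \<bar>a\<bar> * M ^ 2" "\<bar>b\<bar> \<le> \<bar>b\<bar> * M ^ 2"
    using M M2 by (auto simp: abs_mult intro!: mult_left_mono mult_right_mono)
       (metis abs_ge_zero mult.right_neutral mult_left_mono order_trans)
  have "M ^ 3 = M ^ 2 + \<bar>t\<bar> * M ^ 2 + \<bar>a\<bar> * M ^ 2 + \<bar>b\<bar> * M ^ 2"
    unfolding power3_eq_cube by (subst (3) M_def) (simp add: algebra_simps power2_eq_square)
  moreover have "M ^ 2 > 0" using M by simp
  ultimately have "M ^ 3 + t * M ^ 2 + a * M + b \<ge> 0" "- (M ^ 3) + t * M ^ 2 - a * M + b \<le> 0"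
    using bounds unfolding abs_le_iff by linarith+
  then have "\<exists>x\<ge>- M. x \<le> M \<and> x ^ 3 + t * x ^ 2 + a * x + b = 0"
    using M by (intro IVT') (auto intro!: continuous_intros simp: power2_eq_square)
  then show ?thesis by blast
qed

text \<open>Nonreal roots satisfy |z|^2 = q, and the values at Y and - Y are then positive. For real
  roots, positive values at Y and - Y leave the cases of both roots inside, both above Y or both
  below - Y; the last two are excluded by q < Y^2.\<close>

lemma real_quadratic_roots_less_iff:
  fixes p q Y :: real
  assumes "Y > 0"
  shows "(\<forall>z::complex. z ^ 2 + of_real p * z + of_real q = 0 \<longrightarrow> cmod z < Y) \<longleftrightarrow>
    q < Y ^ 2 \<and> Y ^ 2 + p * Y + q > 0 \<and> Y ^ 2 - p * Y + q > 0" (is "?L \<longleftrightarrow> ?R")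
proof (cases "p ^ 2 < 4 * q")
  case True
  have pos: "u ^ 2 + p * u + q > 0" for u
  proof -
    have "u ^ 2 + p * u + q = (u + p / 2) ^ 2 + (4 * q - p ^ 2) / 4"
      by (simp add: power2_eq_square field_simps)
    then show ?thesis using True by (smt (verit) divide_pos_pos zero_le_power2)
  qed
  define s where "s = sqrt (q - p ^ 2 / 4)"
  have s: "s ^ 2 = q - p ^ 2 / 4" using True by (simp add: s_def)
  have norm: "cmod z ^ 2 = q" if "z ^ 2 + of_real p * z + of_real q = 0" for z
  proof -
    have re: "Re z ^ 2 - Im z ^ 2 + p * Re z + q = 0" "(2 * Re z + p) * Im z = 0"
      using arg_cong[OF that, of Re] arg_cong[OF that, of Im]
      by (auto simp: power2_eq_square algebra_simps)
    have "Im z \<noteq> 0" using re(1) pos[of "Re z"] by auto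
    then have "p = - 2 * Re z" using re(2) by auto
    then have "q = Re z ^ 2 + Im z ^ 2" using re(1) by (simp add: power2_eq_square)
    then show ?thesis by (simp add: cmod_power2)
  qed
  show ?thesis
  proof
    assume ?L
    define z where "z = Complex (- p / 2) s"
    have "z ^ 2 + of_real p * z + of_real q = 0"
      using s by (simp add: z_def complex_eq_iff power2_eq_square field_simps)
    then have "cmod z < Y" "cmod z ^ 2 = q" using \<open>?L\<close> norm by auto
    then have "q < Y ^ 2" by (metis norm_ge_zero power_strict_mono zero_less_numeral)
    with pos[of Y] pos[of "- Y"] show ?R by simp
  next
    assume ?R
    then show ?L using norm assms by (metis less_imp_le power_less_imp_less_base)
  qed
next
  case False
  define s where "s = sqrt (p ^ 2 - 4 * q)"
  have s: "s ^ 2 = p ^ 2 - 4 * q" "s \<ge> 0" using False by (simp_all add: s_def)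
  define u v where "u = (- p - s) / 2" and "v = (- p + s) / 2"
  have p: "p = - (u + v)" and q: "q = u * v" and uv: "u \<le> v"
    using s by (simp_all add: u_def v_def field_simps power2_eq_square)
  have "z ^ 2 + of_real p * z + of_real q = (z - of_real u) * (z - of_real v)" for z :: complex
    by (simp add: p q algebra_simps power2_eq_square)
  then have L: "?L \<longleftrightarrow> \<bar>u\<bar> < Y \<and> \<bar>v\<bar> < Y"
    by (auto simp del: norm_of_real simp flip: norm_of_real[where 'a = complex])
  have e: "Y ^ 2 + p * Y + q = (Y - u) * (Y - v)" "Y ^ 2 - p * Y + q = (Y + u) * (Y + v)"
    by (simp_all add: p q algebra_simps power2_eq_square)
  show ?thesis
  proof
    assume ?L
    then have uv: "\<bar>u\<bar> < Y" "\<bar>v\<bar> < Y" using L by auto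
    then have "\<bar>u\<bar> * \<bar>v\<bar> < Y * Y" by (intro mult_strict_mono') auto
    then have "u * v < Y ^ 2" unfolding power2_eq_square by (metis abs_ge_self abs_mult order_le_less_trans)
    then have "q < Y ^ 2" by (simp add: q)
    then show ?R unfolding e using uv by simp
  next
    assume R: ?R
    then have 1: "(Y - u) * (Y - v) > 0" "(Y + u) * (Y + v) > 0" "u * v < Y ^ 2" unfolding e unfolding q by auto
    have "v < Y"
    proof (rule ccontr)
      assume "\<not> v < Y"
      then have "v > Y" "u > Y" using 1(1) uv by (auto simp: zero_less_mult_iff)
      then have "u * v > Y * Y" using assms by (intro mult_strict_mono) auto
      then show False using 1(3) by (simp add: power2_eq_square)
    qed
    moreover have "u > - Y"
    proof (rule ccontr)
      assume "\<not> u > - Y"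
      then have "u < - Y" "v < - Y" using 1(2) uv by (auto simp: zero_less_mult_iff)
      then have "(- u) * (- v) > Y * Y" using assms by (intro mult_strict_mono) auto
      then show False using 1(3) by (simp add: power2_eq_square)
    qed
    ultimately show ?L unfolding L using uv by auto
  qed
qed

text \<open>The last condition says that Y^2 exceeds the products of two roots (a Schur-Cohn criterion).\<close>

abbreviation schur_cohn :: "real \<Rightarrow> real \<Rightarrow> real \<Rightarrow> real \<Rightarrow> bool" where
  "schur_cohn t a b Y \<equiv> Y ^ 3 + t * Y ^ 2 + a * Y + b > 0 \<and> Y ^ 3 - t * Y ^ 2 + a * Y - b > 0
    \<and> Y ^ 6 - a * Y ^ 4 + t * b * Y ^ 2 - b ^ 2 > 0"

text \<open>Splitting off a real root r leaves x^2 + p x + q, and the three polynomials factor as in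
  \<open>e\<close>; the second factor of the last one is the product of Y^2 - r z over the two roots
  z of the quadratic. Since |t| \<le> 1 \<le> Y, the number p = t + r has the sign of r once |r|
  \<ge> Y, which rules that case out.\<close>

lemma hgt_less_iff_poly:
  fixes t a b Y :: real
  assumes t: "\<bar>t\<bar> \<le> 1" and Y: "Y \<ge> 1"
  shows "hgt t a b < Y \<longleftrightarrow> schur_cohn t a b Y"
proof -
  obtain r where r: "r ^ 3 + t * r ^ 2 + a * r + b = 0" using real_cubic_root by blast
  define p q where "p = t + r" and "q = a + r * p"
  have tab: "t = p - r" "a = q - p * r" "b = - (q * r)"
    using r by (simp_all add: p_def q_def algebra_simps power2_eq_square power3_eq_cube)
  have "poly (cubic_poly (of_real t) (of_real a) (of_real b)) z
      = (z - of_real r) * (z ^ 2 + of_real p * z + of_real q)" for z :: complex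
    by (simp add: poly_cubic_poly tab algebra_simps power2_eq_square power3_eq_cube)
  then have "hgt t a b < Y \<longleftrightarrow> \<bar>r\<bar> < Y \<and>
      (\<forall>z::complex. z ^ 2 + of_real p * z + of_real q = 0 \<longrightarrow> cmod z < Y)"
    unfolding hgt_less_iff by auto
  then have 1: "hgt t a b < Y \<longleftrightarrow> \<bar>r\<bar> < Y \<and> q < Y ^ 2 \<and> Y ^ 2 + p * Y + q > 0 \<and> Y ^ 2 - p * Y + q > 0"
    using real_quadratic_roots_less_iff[of Y p q] Y by simp
  have e: "Y ^ 3 + t * Y ^ 2 + a * Y + b = (Y - r) * (Y ^ 2 + p * Y + q)"
    "Y ^ 3 - t * Y ^ 2 + a * Y - b = (Y + r) * (Y ^ 2 - p * Y + q)"
    "Y ^ 6 - a * Y ^ 4 + t * b * Y ^ 2 - b ^ 2 = (Y ^ 2 - q) * (Y ^ 4 + p * r * Y ^ 2 + r ^ 2 * q)"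
    unfolding tab by (simp_all add: algebra_simps power2_eq_square power3_eq_cube power4_eq_xxxx eval_nat_numeral)
  show ?thesis
    unfolding 1 e
  proof safe
    assume *: "\<bar>r\<bar> < Y" "q < Y ^ 2" "Y ^ 2 + p * Y + q > 0" "Y ^ 2 - p * Y + q > 0"
    show "(Y - r) * (Y ^ 2 + p * Y + q) > 0" "(Y + r) * (Y ^ 2 - p * Y + q) > 0"
      using * by auto
    \<comment> \<open>Estimating p r by this bound leaves (Y - |r|) (Y^3 - q |r|), which is positive
      since q < Y^2 and |r| < Y.\<close>
    have "\<bar>p\<bar> * Y \<le> Y ^ 2 + q" using * by (auto simp: abs_if)
    then have "(\<bar>p\<bar> * Y) * (\<bar>r\<bar> * Y) \<le> (Y ^ 2 + q) * (\<bar>r\<bar> * Y)" using Y by (intro mult_right_mono) auto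
    moreover have "\<bar>p * r\<bar> * Y ^ 2 = (\<bar>p\<bar> * Y) * (\<bar>r\<bar> * Y)" by (simp add: abs_mult power2_eq_square)
    moreover have "- (p * r * Y ^ 2) \<le> \<bar>p * r\<bar> * Y ^ 2"
      using abs_ge_minus_self[of "p * r * Y ^ 2"] by (simp add: abs_mult)
    ultimately have "Y ^ 4 + p * r * Y ^ 2 + r ^ 2 * q \<ge> Y ^ 4 + r ^ 2 * q - (Y ^ 2 + q) * (\<bar>r\<bar> * Y)"
      by linarith
    also have "Y ^ 4 + r ^ 2 * q - (Y ^ 2 + q) * (\<bar>r\<bar> * Y) = (Y - \<bar>r\<bar>) * (Y ^ 3 - q * \<bar>r\<bar>)"
    proof -
      define k where "k = \<bar>r\<bar>"
      have "r ^ 2 = k ^ 2" by (simp add: k_def)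
      then show ?thesis unfolding k_def[symmetric]
        by (simp add: algebra_simps power2_eq_square power3_eq_cube power4_eq_xxxx)
    qed
    finally have S: "(Y - \<bar>r\<bar>) * (Y ^ 3 - q * \<bar>r\<bar>) \<le> Y ^ 4 + p * r * Y ^ 2 + r ^ 2 * q" .
    have "q * \<bar>r\<bar> < Y ^ 3"
    proof (cases "r = 0")
      case False
      then have "q * \<bar>r\<bar> < Y ^ 2 * \<bar>r\<bar>" using * by simp
      also have "\<dots> \<le> Y ^ 2 * Y" using * by (intro mult_left_mono) auto
      finally show ?thesis by (simp add: power2_eq_square power3_eq_cube)
    qed (use Y in simp)
    then have "(Y - \<bar>r\<bar>) * (Y ^ 3 - q * \<bar>r\<bar>) > 0" using * by simp
    then show "(Y ^ 2 - q) * (Y ^ 4 + p * r * Y ^ 2 + r ^ 2 * q) > 0" using S *(2) by simp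
  next
    assume *: "(Y - r) * (Y ^ 2 + p * Y + q) > 0" "(Y + r) * (Y ^ 2 - p * Y + q) > 0"
      "(Y ^ 2 - q) * (Y ^ 4 + p * r * Y ^ 2 + r ^ 2 * q) > 0"
    have "r < Y"
    proof (rule ccontr)
      assume "\<not> r < Y"
      then have "Y ^ 2 + p * Y + q < 0" "Y ^ 2 - p * Y + q > 0" "p \<ge> 0"
        using *(1,2) Y t by (auto simp: zero_less_mult_iff p_def)
      then show False using Y mult_nonneg_nonneg[of p Y] by linarith
    qed
    moreover have "r > - Y"
    proof (rule ccontr)
      assume "\<not> r > - Y"
      then have "Y ^ 2 + p * Y + q > 0" "Y ^ 2 - p * Y + q < 0" "p \<le> 0"
        using *(1,2) Y t by (auto simp: zero_less_mult_iff p_def)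
      then show False using Y mult_nonneg_nonneg[of "- p" Y] by simp
    qed
    ultimately show r: "\<bar>r\<bar> < Y" by simp
    then show "Y ^ 2 + p * Y + q > 0" "Y ^ 2 - p * Y + q > 0"
      using *(1,2) by (auto simp: zero_less_mult_iff)
    show "q < Y ^ 2"
    proof (rule ccontr)
      assume q: "\<not> q < Y ^ 2"
      \<comment> \<open>If q \<ge> Y^2, this gives p^2 \<le> 4 q. Completing the square then shows
        the second factor of the last product to be nonnegative, while the first is not
        positive.\<close>
      have "\<bar>p\<bar> \<le> 2 * Y" using r t Y by (simp add: p_def)
      then have "p ^ 2 \<le> (2 * Y) ^ 2" by (metis abs_ge_zero power2_abs power_mono)
      then have "p ^ 2 \<le> 4 * q" using q by (simp add: power_mult_distrib)
      then have "(Y ^ 2 + p * r / 2) ^ 2 + r ^ 2 * (q - p ^ 2 / 4) \<ge> 0" by simp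
      also have "(Y ^ 2 + p * r / 2) ^ 2 + r ^ 2 * (q - p ^ 2 / 4) = Y ^ 4 + p * r * Y ^ 2 + r ^ 2 * q"
        by (simp add: power2_eq_square power4_eq_xxxx field_simps)
      finally have "(q - Y ^ 2) * (Y ^ 4 + p * r * Y ^ 2 + r ^ 2 * q) \<ge> 0" using q by (intro mult_nonneg_nonneg) auto
      moreover have "(q - Y ^ 2) * (Y ^ 4 + p * r * Y ^ 2 + r ^ 2 * q) = - ((Y ^ 2 - q) * (Y ^ 4 + p * r * Y ^ 2 + r ^ 2 * q))"
        by (simp add: algebra_simps)
      ultimately show False using *(3) by linarith
    qed
  qed
qed

section \<open>Lattice points\<close>

lemma interval_real_sandwich:
  fixes S :: "real set"
  assumes "is_interval S" "S \<subseteq> {-M..M}" "S \<noteq> {}"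
  obtains u v where "u \<le> v" "{u<..<v} \<subseteq> S" "S \<subseteq> {u..v}" "S \<in> sets lborel" "measure lborel S = v - u"
proof -
  define u v where "u = Inf S" and "v = Sup S"
  have bdd: "bdd_below S" "bdd_above S" using assms(2) by (meson bdd_above_Icc bdd_above_mono bdd_below_Icc bdd_below_mono)+
  have sub: "S \<subseteq> {u..v}"
    using bdd by (auto simp: u_def v_def intro: cInf_lower cSup_upper)
  have uv: "u \<le> v" using sub assms(3) by auto
  have sup: "{u<..<v} \<subseteq> S"
  proof
    fix x assume "x \<in> {u<..<v}"
    then obtain y z where "y \<in> S" "y < x" "z \<in> S" "x < z"
      using assms(3) bdd by (auto simp: u_def v_def cInf_less_iff less_cSup_iff)
    then show "x \<in> S" using assms(1) unfolding is_interval_1 by (meson less_imp_le)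
  qed
  have S: "S = {u<..<v} \<union> (S \<inter> {u, v})" using sup sub by force
  have "finite (S \<inter> {u, v})" by simp
  then have "S \<inter> {u, v} \<in> sets lborel" by (simp add: finite_imp_closed)
  then have meas: "S \<in> sets lborel" by (subst S) auto
  have "measure lborel {u<..<v} \<le> measure lborel S" "measure lborel S \<le> measure lborel {u..v}"
  proof -
    have "{u..v} \<in> fmeasurable lborel" using uv by (intro fmeasurableI) auto
    moreover from this have "S \<in> fmeasurable lborel" using sub meas by (rule fmeasurableI2)
    ultimately show "measure lborel {u<..<v} \<le> measure lborel S" "measure lborel S \<le> measure lborel {u..v}"
      using sup sub meas by (intro measure_mono_fmeasurable; simp)+
  qed
  then have "measure lborel S = v - u" using uv by simp
  with uv sup sub meas show thesis by (rule that)
qed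

lemma card_int_interval:
  fixes S :: "real set" and q c :: int
  assumes S: "is_interval S" "S \<subseteq> {-M..M}" and q: "q > 0" and c: "c \<in> {0..<q}"
  shows "finite {k. k mod q = c \<and> of_int k \<in> S}"
    and "\<bar>real (card {k. k mod q = c \<and> of_int k \<in> S}) - measure lborel S / of_int q\<bar> \<le> 1"
proof -
  let ?A = "{k. k mod q = c \<and> of_int k \<in> S}"
  have A: "?A = (\<lambda>j. c + q * j) ` {j. of_int (c + q * j) \<in> S}"
  proof (intro equalityI subsetI)
    fix k assume "k \<in> ?A"
    then have "k = c + q * (k div q)" "of_int k \<in> S" by (auto simp: mod_mult_div_eq[symmetric])
    then show "k \<in> (\<lambda>j. c + q * j) ` {j. of_int (c + q * j) \<in> S}" by (metis (mono_tags) image_iff mem_Collect_eq)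
  qed (use q c in auto)
  have card: "card ?A = card {j. of_int (c + q * j) \<in> S}"
    unfolding A using q by (intro card_image) (auto simp: inj_on_def)
  have "finite {j. of_int (c + q * j) \<in> S} \<and>
     \<bar>real (card {j. of_int (c + q * j) \<in> S}) - measure lborel S / of_int q\<bar> \<le> 1"
  proof (cases "S = {}")
    case False
    obtain u v where uv: "u \<le> v" "{u<..<v} \<subseteq> S" "S \<subseteq> {u..v}" "measure lborel S = v - u"
      by (rule interval_real_sandwich[OF S False])
    define u' v' where "u' = (u - of_int c) / of_int q" and "v' = (v - of_int c) / of_int q"
    have e: "x \<in> {u..v} \<longleftrightarrow> (x - of_int c) / of_int q \<in> {u'..v'}"
      "x \<in> {u<..<v} \<longleftrightarrow> (x - of_int c) / of_int q \<in> {u'<..<v'}" for x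
      using q by (auto simp: u'_def v'_def divide_simps)
    have j: "(of_int (c + q * j) - of_int c) / of_int q = (of_int j :: real)" for j
      using q by simp
    have "{j. of_int (c + q * j) \<in> S} \<subseteq> {j. of_int j \<in> {u'..v'}}"
    proof (intro Collect_mono impI)
      fix i assume "of_int (c + q * i) \<in> S"
      then have "of_int (c + q * i) \<in> {u..v}" using uv(3) by blast
      then show "of_int i \<in> {u'..v'}" unfolding e(1) j .
    qed
    also have "\<dots> = {\<lceil>u'\<rceil>..\<lfloor>v'\<rfloor>}" by (auto simp: le_floor_iff ceiling_le_iff)
    finally have up: "{j. of_int (c + q * j) \<in> S} \<subseteq> {\<lceil>u'\<rceil>..\<lfloor>v'\<rfloor>}" .
    have "{j. of_int j \<in> {u'<..<v'}} \<subseteq> {j. of_int (c + q * j) \<in> S}"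
    proof (intro Collect_mono impI)
      fix i assume "of_int i \<in> {u'<..<v'}"
      then have "of_int (c + q * i) \<in> {u<..<v}" unfolding e(2) j .
      then show "of_int (c + q * i) \<in> S" using uv(2) by blast
    qed
    moreover have "{j. of_int j \<in> {u'<..<v'}} = {\<lfloor>u'\<rfloor>+1..\<lceil>v'\<rceil>-1}"
      by (auto simp: floor_less_iff less_ceiling_iff) linarith+
    ultimately have lo: "{\<lfloor>u'\<rfloor>+1..\<lceil>v'\<rceil>-1} \<subseteq> {j. of_int (c + q * j) \<in> S}" by simp
    have fin: "finite {j. of_int (c + q * j) \<in> S}" using up by (rule finite_subset) simp
    have "v' \<ge> u'" using uv(1) q by (simp add: u'_def v'_def divide_right_mono)
    moreover have "card {j. of_int (c + q * j) \<in> S} \<le> card {\<lceil>u'\<rceil>..\<lfloor>v'\<rfloor>}"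
      using up by (intro card_mono) auto
    moreover have "card {\<lfloor>u'\<rfloor>+1..\<lceil>v'\<rceil>-1} \<le> card {j. of_int (c + q * j) \<in> S}"
      using lo fin by (intro card_mono)
    ultimately have "\<bar>real (card {j. of_int (c + q * j) \<in> S}) - (v' - u')\<bar> \<le> 1"
      by simp linarith
    moreover have "measure lborel S / of_int q = v' - u'"
      unfolding uv(4) u'_def v'_def by (simp add: diff_divide_distrib)
    ultimately show ?thesis using fin by simp
  qed simp
  then show "finite ?A" "\<bar>real (card ?A) - measure lborel S / of_int q\<bar> \<le> 1"
    unfolding card unfolding A by auto
qed

text \<open>Pieces may be empty, so \<open>K\<close> is an upper bound for the number of intervals.
  Disjointness allows counts and lengths to be added over the pieces.\<close>

definition interval_union :: "nat \<Rightarrow> real set \<Rightarrow> bool" where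
  "interval_union K S \<longleftrightarrow> (\<exists>f. (\<forall>i<K. is_interval (f i)) \<and> disjoint_family_on f {..<K} \<and> S = (\<Union>i<K. f i))"

lemma interval_union_count:
  fixes S :: "real set" and q c :: int
  assumes S: "interval_union K S" "S \<subseteq> {-M..M}" and q: "q > 0" and c: "c \<in> {0..<q}"
  shows "finite {k. k mod q = c \<and> of_int k \<in> S}" "S \<in> sets lborel" "emeasure lborel S < \<infinity>"
    and "\<bar>real (card {k. k mod q = c \<and> of_int k \<in> S}) - measure lborel S / of_int q\<bar> \<le> real K"
proof -
  obtain f where f: "\<And>i. i < K \<Longrightarrow> is_interval (f i)" "disjoint_family_on f {..<K}" "S = (\<Union>i<K. f i)"
    using S(1) by (auto simp: interval_union_def)
  have sub: "f i \<subseteq> {-M..M}" if "i < K" for i using f(3) S(2) that by auto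
  have meas: "f i \<in> sets lborel" if "i < K" for i
  proof (cases "f i = {}")
    case False
    from interval_real_sandwich[OF f(1) sub False] that show ?thesis by blast
  qed simp
  show mS: "S \<in> sets lborel" using meas f(3) by auto
  have "emeasure lborel S \<le> emeasure lborel {-M..M}" using S(2) by (intro emeasure_mono) auto
  also have "\<dots> < \<infinity>" by (cases "-M \<le> M") auto
  finally show "emeasure lborel S < \<infinity>" .
  let ?A = "\<lambda>i. {k. k mod q = c \<and> of_int k \<in> f i}"
  have eq: "{k. k mod q = c \<and> of_int k \<in> S} = (\<Union>i<K. ?A i)" using f(3) by auto
  have fin: "finite (?A i)" if "i < K" for i using card_int_interval(1)[OF f(1) sub q c] that by blast
  show "finite {k. k mod q = c \<and> of_int k \<in> S}" unfolding eq using fin by auto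
  have "card {k. k mod q = c \<and> of_int k \<in> S} = (\<Sum>i<K. card (?A i))"
    unfolding eq using fin f(2) by (intro card_UN_disjoint) (auto simp: disjoint_family_on_def)
  moreover have "measure lborel S = (\<Sum>i<K. measure lborel (f i))"
    unfolding f(3)
  proof (rule measure_finite_Union)
    show "emeasure lborel (f i) \<noteq> \<infinity>" if "i \<in> {..<K}" for i
    proof -
      have "emeasure lborel (f i) \<le> emeasure lborel {-M..M}" using sub that by (intro emeasure_mono) auto
      also have "\<dots> < \<infinity>" by (cases "-M \<le> M") auto
      finally show ?thesis by simp
    qed
  qed (use f(2) meas in auto)
  ultimately have "\<bar>real (card {k. k mod q = c \<and> of_int k \<in> S}) - measure lborel S / of_int q\<bar>
      = \<bar>\<Sum>i<K. (real (card (?A i)) - measure lborel (f i) / of_int q)\<bar>"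
    by (simp add: sum_subtractf sum_divide_distrib)
  also have "\<dots> \<le> (\<Sum>i<K. \<bar>real (card (?A i)) - measure lborel (f i) / of_int q\<bar>)"
    by (rule sum_abs)
  also have "\<dots> \<le> (\<Sum>i<K. 1)"
    using card_int_interval(2)[OF f(1) sub q c] by (intro sum_mono) auto
  finally show "\<bar>real (card {k. k mod q = c \<and> of_int k \<in> S}) - measure lborel S / of_int q\<bar> \<le> real K"
    by simp
qed

lemma interval_union_3I:
  assumes "is_interval A" "is_interval B" "is_interval C" "A \<inter> B = {}" "A \<inter> C = {}" "B \<inter> C = {}"
  shows "interval_union 3 (A \<union> B \<union> C)"
  unfolding interval_union_def
  by (rule exI[of _ "\<lambda>i. if i = 0 then A else if i = 1 then B else C"])
     (use assms in \<open>auto simp: disjoint_family_on_def lessThan_Suc numeral_3_eq_3\<close>)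

lemma is_interval_monotone_vimage:
  fixes g :: "real \<Rightarrow> real"
  assumes J: "is_interval J" and W: "is_interval W"
    and g: "mono_on J g \<or> antimono_on J g"
  shows "is_interval {x \<in> J. g x \<in> W}"
  unfolding is_interval_1
proof (intro ballI allI impI)
  fix a b x assume *: "a \<in> {x \<in> J. g x \<in> W}" "b \<in> {x \<in> J. g x \<in> W}" "a \<le> x \<and> x \<le> b"
  then have x: "x \<in> J" using J unfolding is_interval_1 by blast
  have "(g a \<le> g x \<and> g x \<le> g b) \<or> (g b \<le> g x \<and> g x \<le> g a)"
    using g * x by (auto simp: monotone_on_def)
  then have "g x \<in> W" using W * unfolding is_interval_1 by blast
  then show "x \<in> {x \<in> J. g x \<in> W}" using x by blast
qed

section \<open>Fubini's theorem and lattice points in plane regions\<close>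

lemma section_integral:
  fixes R :: "(real \<times> real) set"
  assumes R: "R \<in> sets (borel \<Otimes>\<^sub>M borel)" and fin: "emeasure lborel R < \<infinity>"
    and slices: "\<And>a. emeasure lborel {b. (a, b) \<in> R} < \<infinity>"
  shows "integrable lborel (\<lambda>a. measure lborel {b. (a, b) \<in> R})"
    and "(\<integral>a. measure lborel {b. (a, b) \<in> R} \<partial>lborel) = measure lborel R"
proof -
  define F where "F = (\<lambda>a. measure lborel {b. (a, b) \<in> R})"
  have F_emeasure: "emeasure lborel {b. (a, b) \<in> R} = ennreal (F a)" for a
    unfolding F_def using slices[of a] by (intro emeasure_eq_ennreal_measure) auto
  have Rl: "R \<in> sets (lborel \<Otimes>\<^sub>M lborel)" using R by simp
  have "emeasure lborel R = (\<integral>\<^sup>+a. emeasure lborel (Pair a -` R) \<partial>lborel)"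
    unfolding lborel_prod[symmetric] by (rule lborel.emeasure_pair_measure_alt[OF Rl])
  also have "\<dots> = (\<integral>\<^sup>+a. ennreal (F a) \<partial>lborel)"
    by (simp add: vimage_def F_emeasure)
  finally have nn: "(\<integral>\<^sup>+a. ennreal (F a) \<partial>lborel) = emeasure lborel R" by simp
  have Fm: "F \<in> borel_measurable lborel"
  proof -
    have "(\<lambda>a. emeasure lborel (Pair a -` R)) \<in> borel_measurable lborel"
      by (rule lborel.measurable_emeasure_Pair[OF Rl])
    then have "(\<lambda>a. enn2real (emeasure lborel (Pair a -` R))) \<in> borel_measurable lborel"
      by measurable
    then show ?thesis by (simp add: F_def measure_def vimage_def)
  qed
  have F0: "F a \<ge> 0" for a by (simp add: F_def)
  have F_int: "integrable lborel F"
    using Fm fin nn F0 by (intro integrableI_nonneg) auto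
  have "ennreal (\<integral>a. F a \<partial>lborel) = emeasure lborel R"
    using nn_integral_eq_integral[OF F_int] F0 nn by simp
  then have "(\<integral>a. F a \<partial>lborel) = measure lborel R"
    unfolding measure_def by (metis F0 enn2real_ennreal integral_nonneg_AE AE_I2)
  with F_int show "integrable lborel (\<lambda>a. measure lborel {b. (a, b) \<in> R})"
    "(\<integral>a. measure lborel {b. (a, b) \<in> R} \<partial>lborel) = measure lborel R"
    unfolding F_def by auto
qed

lemma measure_lborel_swap:
  fixes R :: "(real \<times> real) set"
  assumes "R \<in> sets (borel \<Otimes>\<^sub>M borel)"
  shows "{(b, a). (a, b) \<in> R} \<in> sets (borel \<Otimes>\<^sub>M borel)"
    and "emeasure lborel {(b, a). (a, b) \<in> R} = emeasure lborel R"
proof -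
  have eq: "{(b, a). (a, b) \<in> R} = (\<lambda>(x, y). (y, x)) -` R \<inter> space (lborel \<Otimes>\<^sub>M lborel)"
    by (auto simp: space_pair_measure)
  have R: "R \<in> sets (lborel \<Otimes>\<^sub>M lborel)" using assms by simp
  have "{(b, a). (a, b) \<in> R} \<in> sets (lborel \<Otimes>\<^sub>M lborel)"
    unfolding eq by (rule measurable_sets[OF measurable_pair_swap' R])
  then show "{(b, a). (a, b) \<in> R} \<in> sets (borel \<Otimes>\<^sub>M borel)" by simp
  have "emeasure (lborel \<Otimes>\<^sub>M lborel) R
      = emeasure (distr (lborel \<Otimes>\<^sub>M lborel) (lborel \<Otimes>\<^sub>M lborel) (\<lambda>(x, y). (y, x))) R"
    by (simp only: lborel_pair.distr_pair_swap[symmetric])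
  also have "\<dots> = emeasure (lborel \<Otimes>\<^sub>M lborel) {(b, a). (a, b) \<in> R}"
    unfolding eq by (rule emeasure_distr[OF measurable_pair_swap' R])
  finally show "emeasure lborel {(b, a). (a, b) \<in> R} = emeasure lborel R"
    unfolding lborel_prod by simp
qed

text \<open>The sum over A of the lengths of the slices is, by Fubini, the integral over b of the number of
  admissible A on the line of height b.\<close>

lemma card_lattice_points_le:
  fixes R :: "(real \<times> real) set" and c :: int and q1 q2 :: int and d :: "int \<Rightarrow> int"
  assumes R: "R \<in> sets (borel \<Otimes>\<^sub>M borel)"
    and bounds: "\<And>a b. (a, b) \<in> R \<Longrightarrow> \<bar>a\<bar> \<le> M1 \<and> \<bar>b\<bar> \<le> M2" and M: "M1 \<ge> 0" "M2 \<ge> 0"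
    and slice_b: "\<And>a. interval_union K {b. (a, b) \<in> R}"
    and slice_a: "\<And>b. interval_union K {a. (a, b) \<in> R}"
    and q: "q1 > 0" "q2 > 0" and c: "c \<in> {0..<q1}" and d: "\<And>A. d A \<in> {0..<q2}"
  defines "S \<equiv> {A. A mod q1 = c \<and> \<bar>of_int A\<bar> \<le> M1}"
  shows "\<bar>real (card {(A, B). A mod q1 = c \<and> B mod q2 = d A \<and> (of_int A, of_int B) \<in> R})
    - measure lborel R / (of_int q1 * of_int q2)\<bar> \<le> real K * real (card S) + 2 * real K * M2 / of_int q2"
proof -
  have finS: "finite S"
  proof (rule finite_subset)
    show "S \<subseteq> {\<lceil>- M1\<rceil>..\<lfloor>M1\<rfloor>}" by (auto simp: S_def le_floor_iff ceiling_le_iff abs_le_iff)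
  qed simp
  have sub_b: "{b. (a, b) \<in> R} \<subseteq> {-M2..M2}" and sub_a: "{a. (a, b) \<in> R} \<subseteq> {-M1..M1}" for a b
    using bounds[of a b] bounds by (force simp: abs_le_iff)+
  define F where "F = (\<lambda>a. measure lborel {b. (a, b) \<in> R})"
  define H where "H = (\<lambda>b. measure lborel {a. (a, b) \<in> R})"
  note cb = interval_union_count[OF slice_b sub_b q(2) d]
  note ca = interval_union_count[OF slice_a sub_a q(1) c]
  let ?B = "\<lambda>A. {B. B mod q2 = d A \<and> of_int B \<in> {b. (of_int A, b) \<in> R}}"
  have "{(A, B). A mod q1 = c \<and> B mod q2 = d A \<and> (of_int A, of_int B) \<in> R} = (SIGMA A:S. ?B A)"
    using bounds by (auto simp: S_def)
  then have "real (card {(A, B). A mod q1 = c \<and> B mod q2 = d A \<and> (of_int A, of_int B) \<in> R})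
      = (\<Sum>A\<in>S. real (card (?B A)))"
    using finS cb(1) by simp
  \<comment> \<open>The class \<open>d A\<close> may vary with A, since the error on one slice is
    bounded by the number of its intervals whatever the class.\<close>
  moreover have "\<bar>(\<Sum>A\<in>S. real (card (?B A))) - (\<Sum>A\<in>S. F (of_int A) / of_int q2)\<bar> \<le> real K * real (card S)"
  proof -
    have "\<bar>(\<Sum>A\<in>S. real (card (?B A))) - (\<Sum>A\<in>S. F (of_int A) / of_int q2)\<bar>
        \<le> (\<Sum>A\<in>S. \<bar>real (card (?B A)) - F (of_int A) / of_int q2\<bar>)"
      unfolding sum_subtractf[symmetric] by (rule sum_abs)
    also have "\<dots> \<le> (\<Sum>A\<in>S. real K)"
      unfolding F_def using cb(4) by (intro sum_mono)
    finally show ?thesis by (simp add: mult.commute)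
  qed
  moreover have "\<bar>(\<Sum>A\<in>S. F (of_int A)) - measure lborel R / of_int q1\<bar> \<le> 2 * real K * M2"
  proof -
    define g where "g = (\<lambda>b. \<Sum>A\<in>S. indicator R (of_int A, b) :: real)"
    have ind_eq: "(\<lambda>b. indicator R (a, b) :: real) = indicator {b. (a, b) \<in> R}" for a
      by (auto simp: indicator_def)
    have int1: "integrable lborel (\<lambda>b. indicator R (a, b) :: real)" for a
      unfolding ind_eq using cb(2,3) by (simp add: integrable_indicator_iff)
    have F_int: "F a = (\<integral>b. indicator R (a, b) \<partial>lborel)" for a
      unfolding ind_eq F_def by simp
    have g_int: "integrable lborel g" "(\<Sum>A\<in>S. F (of_int A)) = (\<integral>b. g b \<partial>lborel)"
      unfolding g_def F_int by (auto simp: int1)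
    have card_g: "g b = real (card {A. A mod q1 = c \<and> of_int A \<in> {a. (a, b) \<in> R}})" for b
    proof -
      have "g b = (\<Sum>A\<in>S. if (of_int A, b) \<in> R then 1 else 0)" by (simp add: g_def indicator_def of_bool_def)
      also have "\<dots> = real (card {A \<in> S. (of_int A, b) \<in> R})"
        using finS by (simp add: sum.If_cases Int_def)
      also have "{A \<in> S. (of_int A, b) \<in> R} = {A. A mod q1 = c \<and> of_int A \<in> {a. (a, b) \<in> R}}"
        using bounds by (auto simp: S_def)
      finally show ?thesis .
    qed
    \<comment> \<open>Both terms vanish for |b| > M2, so the error K is integrated over an interval
      of length 2 M2 only.\<close>
    have gH: "\<bar>g b - H b / of_int q1\<bar> \<le> real K * indicator {-M2..M2} b" for b
    proof (cases "b \<in> {-M2..M2}")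
      case True
      then show ?thesis unfolding card_g H_def using ca(4)[of b] by simp
    next
      case False
      then have "{a. (a, b) \<in> R} = {}" using bounds by (fastforce simp: abs_le_iff)
      then show ?thesis unfolding card_g H_def by simp
    qed
    have "R \<subseteq> cbox (- M1, - M2) (M1, M2)"
      using bounds by (fastforce simp: cbox_Pair_eq abs_le_iff)
    then have "emeasure lborel R \<le> emeasure lborel (cbox (- M1, - M2) (M1, M2))"
      by (rule emeasure_mono) simp
    also have "\<dots> < \<infinity>" by (rule emeasure_lborel_cbox_finite)
    finally have fin: "emeasure lborel R < \<infinity>" .
    have "integrable lborel (\<lambda>b. measure lborel {a. (b, a) \<in> {(b, a). (a, b) \<in> R}})"
      "(\<integral>b. measure lborel {a. (b, a) \<in> {(b, a). (a, b) \<in> R}} \<partial>lborel) = measure lborel {(b, a). (a, b) \<in> R}"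
      using measure_lborel_swap[OF R] fin ca(3) by (intro section_integral; simp)+
    then have H_int: "integrable lborel H" and HR: "(\<integral>b. H b \<partial>lborel) = measure lborel R"
      using measure_lborel_swap(2)[OF R] by (simp_all add: H_def[abs_def] measure_def)
    have "(\<Sum>A\<in>S. F (of_int A)) - measure lborel R / of_int q1 = (\<integral>b. g b - H b / of_int q1 \<partial>lborel)"
      using g_int H_int HR by simp
    also have "\<bar>\<dots>\<bar> \<le> (\<integral>b. real K * indicator {-M2..M2} b \<partial>lborel)"
    proof -
      have "integrable lborel (\<lambda>b. real K * indicator {-M2..M2} b :: real)"
        using M by (intro integrable_mult_right) (simp add: integrable_indicator_iff)
      then show ?thesis using gH g_int H_int
        by (intro order_trans[OF integral_abs_bound integral_mono]) auto
    qed
    also have "\<dots> = 2 * real K * M2" using M by simp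
    finally show ?thesis .
  qed
  then have "\<bar>(\<Sum>A\<in>S. F (of_int A) / of_int q2) - measure lborel R / (of_int q1 * of_int q2)\<bar>
      \<le> 2 * real K * M2 / of_int q2"
  proof -
    assume *: "\<bar>(\<Sum>A\<in>S. F (of_int A)) - measure lborel R / of_int q1\<bar> \<le> 2 * real K * M2"
    have "(\<Sum>A\<in>S. F (of_int A) / of_int q2) - measure lborel R / (of_int q1 * of_int q2)
      = ((\<Sum>A\<in>S. F (of_int A)) - measure lborel R / of_int q1) / of_int q2"
      by (simp add: sum_divide_distrib diff_divide_distrib)
    then show ?thesis using * q by (simp add: divide_right_mono)
  qed
  ultimately show ?thesis by linarith
qed

section \<open>The regions of bounded height and discriminant\<close>

definition region :: "real \<Rightarrow> real \<Rightarrow> real \<Rightarrow> real \<Rightarrow> (real \<times> real) set" where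
  "region t s X Y = {(a, b). 0 < s * disc t a b \<and> \<bar>disc t a b\<bar> < X \<and> hgt t a b < Y}"

abbreviation disc_window :: "real \<Rightarrow> real \<Rightarrow> real set" where
  "disc_window s X \<equiv> {w. 0 < s * w \<and> \<bar>w\<bar> < X}"

lemma is_interval_disc_window: "is_interval (disc_window s X)"
  unfolding is_interval_1
proof (intro ballI allI impI)
  fix a b x assume *: "a \<in> disc_window s X" "b \<in> disc_window s X" "a \<le> x \<and> x \<le> b"
  have "0 < s * x"
  proof (cases "s > 0")
    case True
    then show ?thesis using * by (auto simp: zero_less_mult_iff)
  next
    case False
    then have "s < 0" "b < 0" using * by (auto simp: zero_less_mult_iff not_less)
    then show ?thesis using * by (simp add: mult_neg_neg)
  qed
  then show "x \<in> disc_window s X" using * by auto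
qed

lemma is_interval_Int_Collect: "is_interval {x. P x} \<Longrightarrow> is_interval {x. Q x} \<Longrightarrow> is_interval {x::real. P x \<and> Q x}"
  unfolding is_interval_1 by blast

lemma is_interval_affine_pos: "is_interval {x::real. c * x + d > 0}"
  unfolding is_interval_1
proof (intro ballI allI impI, unfold mem_Collect_eq)
  fix a b x :: real assume *: "0 < c * a + d" "0 < c * b + d" "a \<le> x \<and> x \<le> b"
  show "0 < c * x + d"
  proof (cases "c \<ge> 0")
    case True
    then have "c * a \<le> c * x" using * by (intro mult_left_mono) auto
    then show ?thesis using * by linarith
  next
    case False
    then have "c * b \<le> c * x" using * by (intro mult_left_mono_neg) auto
    then show ?thesis using * by linarith
  qed
qed

lemma is_interval_concave_pos: "is_interval {x::real. c + d * x - x ^ 2 > 0}"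
  unfolding is_interval_1
proof (intro ballI allI impI, unfold mem_Collect_eq)
  fix a b x :: real assume *: "0 < c + d * a - a ^ 2" "0 < c + d * b - b ^ 2" "a \<le> x \<and> x \<le> b"
  show "0 < c + d * x - x ^ 2"
  proof (cases "a < x \<and> x < b")
    case True
    have "(b - a) * (c + d * x - x ^ 2) = (b - x) * (c + d * a - a ^ 2) + (x - a) * (c + d * b - b ^ 2)
        + (x - a) * (b - x) * (b - a)"
      by (simp add: algebra_simps power2_eq_square)
    also have "\<dots> > 0" using * True by (intro add_pos_pos mult_pos_pos) auto
    finally show ?thesis using True by (simp add: zero_less_mult_iff)
  next
    case False
    then have "x = a \<or> x = b" using * by auto
    then show ?thesis using * by auto
  qed
qed

context
  fixes t s X Y :: real
  assumes t: "\<bar>t\<bar> \<le> 1" and Y: "Y \<ge> 1"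
begin

lemma region_eq:
  "region t s X Y = {(a, b). disc t a b \<in> disc_window s X \<and> schur_cohn t a b Y}"
  unfolding region_def hgt_less_iff_poly[OF t Y] by auto

lemma region_measurable: "region t s X Y \<in> sets (borel \<Otimes>\<^sub>M borel)"
proof -
  have "region t s X Y = {p \<in> space (borel \<Otimes>\<^sub>M borel). 0 < s * disc t (fst p) (snd p)
    \<and> \<bar>disc t (fst p) (snd p)\<bar> < X \<and> schur_cohn t (fst p) (snd p) Y}"
    unfolding region_eq by (auto simp: space_pair_measure)
  also have "\<dots> \<in> sets (borel \<Otimes>\<^sub>M borel)"
    unfolding disc_def by measurable
  finally show ?thesis .
qed

text \<open>In b the height condition consists of two affine inequalities and a concave quadratic
  one, hence cuts out an interval. The discriminant is a concave parabola with vertex v, and each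
  side of v contributes one interval. The third piece is empty; it matches the bound for lines in
  the other direction.\<close>

lemma region_slice_b: "interval_union 3 {b. (a, b) \<in> region t s X Y}"
proof -
  let ?I = "{b. schur_cohn t a b Y}"
  have I: "is_interval ?I"
  proof (intro is_interval_Int_Collect)
    show "is_interval {b. Y ^ 3 + t * Y ^ 2 + a * Y + b > 0}"
      using is_interval_affine_pos[of 1 "Y ^ 3 + t * Y ^ 2 + a * Y"] by (simp add: algebra_simps)
    show "is_interval {b. Y ^ 3 - t * Y ^ 2 + a * Y - b > 0}"
      using is_interval_affine_pos[of "-1" "Y ^ 3 - t * Y ^ 2 + a * Y"] by (simp add: algebra_simps)
    show "is_interval {b. Y ^ 6 - a * Y ^ 4 + t * b * Y ^ 2 - b ^ 2 > 0}"
      using is_interval_concave_pos[of "Y ^ 6 - a * Y ^ 4" "t * Y ^ 2"] by (simp add: algebra_simps)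
  qed
  define v where "v = (9 * t * a - 2 * t ^ 3) / 27"
  have diff: "disc t a y - disc t a x = 27 * (y - x) * (2 * v - x - y)" for x y
    by (simp add: disc_def v_def field_simps power2_eq_square power3_eq_cube)
  let ?J1 = "{b. b \<le> v} \<inter> ?I" and ?J2 = "{b. b > v} \<inter> ?I"
  let ?K = "\<lambda>J. {b \<in> J. disc t a b \<in> disc_window s X}"
  have "mono_on ?J1 (disc t a)"
  proof (rule mono_onI)
    fix x y assume "x \<in> ?J1" "y \<in> ?J1" "x \<le> y"
    then have "27 * (y - x) * (2 * v - x - y) \<ge> 0" by (intro mult_nonneg_nonneg) auto
    then show "disc t a x \<le> disc t a y" using diff[of y x] by simp
  qed
  moreover have "antimono_on ?J2 (disc t a)"
  proof (rule monotone_onI)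
    fix x y assume "x \<in> ?J2" "y \<in> ?J2" "x \<le> y"
    then have "27 * (y - x) * (x + y - 2 * v) \<ge> 0" by (intro mult_nonneg_nonneg) auto
    then show "disc t a y \<le> disc t a x" using diff[of y x] by (simp add: algebra_simps)
  qed
  moreover have "is_interval {b. b \<le> v}" "is_interval {b. b > v}" by (auto simp: is_interval_1)
  ultimately have "is_interval (?K ?J1)" "is_interval (?K ?J2)"
    by (intro is_interval_monotone_vimage is_interval_Int I is_interval_disc_window; simp)+
  then have "interval_union 3 (?K ?J1 \<union> ?K ?J2 \<union> {})"
    by (intro interval_union_3I) auto
  also have "?K ?J1 \<union> ?K ?J2 \<union> {}
     = {b. (a, b) \<in> region t s X Y}"
    unfolding region_eq by auto
  finally show ?thesis .
qed

text \<open>For fixed b the discriminant is a cubic in a whose derivative is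
  (\<delta> - (12 a - t^2)^2) / 12; this gives at most three intervals of monotonicity.\<close>

lemma region_slice_a: "interval_union 3 {a. (a, b) \<in> region t s X Y}"
proof -
  let ?I = "{a. schur_cohn t a b Y}"
  have I: "is_interval ?I"
  proof (intro is_interval_Int_Collect)
    show "is_interval {a. Y ^ 3 + t * Y ^ 2 + a * Y + b > 0}"
      using is_interval_affine_pos[of Y "Y ^ 3 + t * Y ^ 2 + b"] by (simp add: algebra_simps)
    show "is_interval {a. Y ^ 3 - t * Y ^ 2 + a * Y - b > 0}"
      using is_interval_affine_pos[of Y "Y ^ 3 - t * Y ^ 2 - b"] by (simp add: algebra_simps)
    show "is_interval {a. Y ^ 6 - a * Y ^ 4 + t * b * Y ^ 2 - b ^ 2 > 0}"
      using is_interval_affine_pos[of "- (Y ^ 4)" "Y ^ 6 + t * b * Y ^ 2 - b ^ 2"] by (simp add: algebra_simps)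
  qed
  define \<delta> where "\<delta> = t ^ 4 + 216 * t * b"
  \<comment> \<open>For \<delta> \<le> 0 this makes u = v: the middle piece is empty and the
    discriminant is decreasing throughout.\<close>
  define r where "r = sqrt (max 0 \<delta>)"
  have r: "r \<ge> 0" "r ^ 2 = max 0 \<delta>" by (simp_all add: r_def)
  define u v where "u = (t ^ 2 - r) / 12" and "v = (t ^ 2 + r) / 12"
  have uv: "u \<le> v" using r by (simp add: u_def v_def)
  let ?d = "\<lambda>a. (\<delta> - (12 * a - t ^ 2) ^ 2) / 12"
  have deriv: "((\<lambda>a. disc t a b) has_real_derivative ?d a) (at a)" for a
    unfolding disc_def \<delta>_def
    by (auto intro!: derivative_eq_intros simp: power2_eq_square power4_eq_xxxx field_simps)
  have neg: "?d a \<le> 0" if "a \<le> u \<or> v \<le> a" for a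
  proof -
    have "r \<le> \<bar>12 * a - t ^ 2\<bar>" using that by (auto simp: u_def v_def)
    then have "r ^ 2 \<le> (12 * a - t ^ 2) ^ 2" using r(1) by (metis power2_abs power_mono)
    then show ?thesis using r(2) by simp
  qed
  have pos: "?d a \<ge> 0" if "u \<le> a" "a \<le> v" "u < v" for a
  proof -
    have "\<bar>12 * a - t ^ 2\<bar> \<le> r" using that by (auto simp: u_def v_def)
    then have "(12 * a - t ^ 2) ^ 2 \<le> r ^ 2" using r(1) by (metis abs_ge_zero power2_abs power_mono)
    moreover have "\<delta> > 0" using that(3) by (auto simp: u_def v_def r_def max_def split: if_splits)
    ultimately show ?thesis using r(2) by simp
  qed
  let ?J1 = "{a. a \<le> u} \<inter> ?I" and ?J2 = "{a. u < a \<and> a \<le> v} \<inter> ?I" and ?J3 = "{a. v < a} \<inter> ?I"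
  let ?K = "\<lambda>J. {a \<in> J. disc t a b \<in> disc_window s X}"
  have "antimono_on ?J1 (\<lambda>a. disc t a b)"
    by (rule monotone_onI, rule DERIV_nonpos_imp_nonincreasing) (use deriv neg in \<open>force+\<close>)
  moreover have "mono_on ?J2 (\<lambda>a. disc t a b)"
    by (rule mono_onI, rule DERIV_nonneg_imp_nondecreasing) (use deriv pos in \<open>force+\<close>)
  moreover have "antimono_on ?J3 (\<lambda>a. disc t a b)"
    by (rule monotone_onI, rule DERIV_nonpos_imp_nonincreasing) (use deriv neg in \<open>force+\<close>)
  moreover have "is_interval {a. a \<le> u}" "is_interval {a. u < a \<and> a \<le> v}" "is_interval {a. v < a}"
    by (auto simp: is_interval_1)
  ultimately have "is_interval (?K ?J1)"
    "is_interval (?K ?J2)" "is_interval (?K ?J3)"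
    by (intro is_interval_monotone_vimage is_interval_Int I is_interval_disc_window; simp)+
  then have "interval_union 3 (?K ?J1 \<union> ?K ?J2
      \<union> ?K ?J3)"
    using uv by (intro interval_union_3I) auto
  also have "?K ?J1 \<union> ?K ?J2
      \<union> ?K ?J3 = {a. (a, b) \<in> region t s X Y}"
    unfolding region_eq using uv by auto
  finally show ?thesis .
qed

end

lemma region_bounds:
  assumes "(a, b) \<in> region t s X Y"
  shows "\<bar>a\<bar> \<le> 3 * Y ^ 2" "\<bar>b\<bar> \<le> Y ^ 3"
  using assms hgt_less_bounds[of t a b Y] by (auto simp: region_def)

lemma region_subset_cbox: "region t s X Y \<subseteq> cbox (- (3 * Y ^ 2), - (Y ^ 3)) (3 * Y ^ 2, Y ^ 3)"
  using region_bounds by (auto simp: cbox_Pair_eq abs_le_iff minus_le_iff)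

section \<open>Comparing the volumes for the three traces\<close>

text \<open>For x^3 + A x + B the discriminant is - 4 A^3 - 27 B^2, and B = \<open>cusp k A\<close>
  is the upper half of the curve on which it equals - k. Where that curve has no real point above A,
  the value is 0.\<close>

definition cusp :: "real \<Rightarrow> real \<Rightarrow> real" where
  "cusp k A = sqrt (max 0 ((k - 4 * A ^ 3) / 27))"

definition overlap :: "real \<Rightarrow> real \<Rightarrow> real \<Rightarrow> real" where
  "overlap \<beta> P Q = max 0 (min P \<beta> + min Q \<beta>)"

lemma cusp_nonneg: "cusp k A \<ge> 0"
  by (simp add: cusp_def)

lemma cusp_mono: "k \<le> k' \<Longrightarrow> cusp k A \<le> cusp k' A"
  unfolding cusp_def by (intro real_sqrt_le_mono max.mono divide_right_mono) auto

lemma cusp_antimono: "A \<le> A' \<Longrightarrow> cusp k A' \<le> cusp k A"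
  using power_mono_odd[of 3 A A']
  unfolding cusp_def by (intro real_sqrt_le_mono max.mono divide_right_mono) auto

lemma less_cusp_iff: "\<bar>x\<bar> < cusp k A \<longleftrightarrow> 27 * x ^ 2 < k - 4 * A ^ 3"
proof -
  have "\<bar>x\<bar> < cusp k A \<longleftrightarrow> x ^ 2 < max 0 ((k - 4 * A ^ 3) / 27)"
    unfolding cusp_def by (metis abs_ge_zero real_sqrt_abs real_sqrt_less_iff)
  also have "\<dots> \<longleftrightarrow> x ^ 2 < (k - 4 * A ^ 3) / 27"
    using zero_le_power2[of x] by (auto simp: less_max_iff_disj)
  finally show ?thesis by (simp add: field_simps)
qed

lemma cusp_less_iff: "x \<noteq> 0 \<Longrightarrow> cusp k A < \<bar>x\<bar> \<longleftrightarrow> k - 4 * A ^ 3 < 27 * x ^ 2"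
proof -
  assume x: "x \<noteq> 0"
  have "cusp k A < \<bar>x\<bar> \<longleftrightarrow> max 0 ((k - 4 * A ^ 3) / 27) < x ^ 2"
    unfolding cusp_def by (metis real_sqrt_abs real_sqrt_less_iff)
  also have "\<dots> \<longleftrightarrow> (k - 4 * A ^ 3) / 27 < x ^ 2"
    using x by auto
  finally show ?thesis by (simp add: field_simps)
qed

lemma measure_Ioo_neg: "measure lborel {- p<..<q :: real} = max 0 (p + q)"
  by (cases "- p \<le> q") auto

lemma measure_overlap:
  assumes "\<beta> \<ge> 0"
  shows "measure lborel ({- P<..<Q} \<inter> {- \<beta><..<\<beta>}) = overlap \<beta> P Q"
proof -
  have "{- P<..<Q} \<inter> {- \<beta><..<\<beta>} = {max (- P) (- \<beta>)<..<min Q \<beta>}" by auto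
  moreover have "max (- P) (- \<beta>) = - min P \<beta>" by (auto simp: min_def max_def)
  ultimately have "{- P<..<Q} \<inter> {- \<beta><..<\<beta>} = {- min P \<beta><..<min Q \<beta>}" by simp
  then show ?thesis by (simp only: measure_Ioo_neg overlap_def)
qed

lemma measure_annulus:
  assumes "0 \<le> lo" "lo \<le> hi"
  shows "measure lborel (({- P<..<Q} \<inter> {- hi<..<hi}) - ({- P<..<Q} \<inter> {- lo<..<lo})) = overlap hi P Q - overlap lo P Q"
proof -
  have "emeasure lborel ({- P<..<Q} \<inter> {- hi<..<hi}) \<le> emeasure lborel {- hi<..<hi}"
    by (intro emeasure_mono) auto
  also have "\<dots> < \<infinity>" using assms by (simp add: emeasure_lborel_Ioo)
  finally have "measure lborel (({- P<..<Q} \<inter> {- hi<..<hi}) - ({- P<..<Q} \<inter> {- lo<..<lo}))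
      = measure lborel ({- P<..<Q} \<inter> {- hi<..<hi}) - measure lborel ({- P<..<Q} \<inter> {- lo<..<lo})"
    using assms by (intro measure_Diff) auto
  then show ?thesis using assms by (simp only: measure_overlap)
qed

text \<open>If \<beta> is further than \<delta> from w, then P and Q lie on the same side of \<beta>
  as w: the overlap is 2 \<beta> both times, or it changes by at most |P + Q - 2 w|, so that
  opposite movements of the ends cancel. Otherwise each of the two minima moves by at most
  \<delta>.\<close>

lemma overlap_diff_le:
  assumes "w \<ge> 0" "\<beta> \<ge> 0" "\<bar>P - w\<bar> \<le> \<delta>" "\<bar>Q - w\<bar> \<le> \<delta>"
  shows "\<bar>overlap \<beta> P Q - overlap \<beta> w w\<bar> \<le> \<bar>P + Q - 2 * w\<bar> + (if \<bar>w - \<beta>\<bar> \<le> \<delta> then 2 * \<delta> else 0)"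
  using assms by (auto simp: overlap_def min_def max_def abs_if split: if_splits)

definition shell_slice :: "real \<Rightarrow> real \<Rightarrow> real \<Rightarrow> real \<Rightarrow> real \<Rightarrow> real set" where
  "shell_slice s X A P Q = {B. - P < B \<and> B < Q \<and> 0 < s * (- 4 * A ^ 3 - 27 * B ^ 2) \<and> \<bar>- 4 * A ^ 3 - 27 * B ^ 2\<bar> < X}"

lemma shell_slice_measurable: "shell_slice s X A P Q \<in> sets lborel"
proof -
  have "shell_slice s X A P Q = {B \<in> space borel. - P < B \<and> B < Q \<and> 0 < s * (- 4 * A ^ 3 - 27 * B ^ 2) \<and> \<bar>- 4 * A ^ 3 - 27 * B ^ 2\<bar> < X}"
    by (simp add: shell_slice_def)
  also have "\<dots> \<in> sets borel" by measurable
  finally show ?thesis by simp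
qed

text \<open>Up to finitely many points the discriminant condition confines |B| between two cusp
  curves: those for - X and 0 if s = 1, those for 0 and X if s = -1.\<close>

lemma shell_cusps:
  assumes "s \<in> {1, -1}" "X > 0"
  obtains lo hi where
    "\<And>A P Q. measure lborel (shell_slice s X A P Q) = overlap (cusp hi A) P Q - overlap (cusp lo A) P Q"
proof -
  define lo hi where "lo = (if s = 1 then - X else 0)" and "hi = (if s = 1 then 0 else X)"
  have "measure lborel (shell_slice s X A P Q) = overlap (cusp hi A) P Q - overlap (cusp lo A) P Q" for A P Q
  proof -
    let ?S = "({- P<..<Q} \<inter> {- cusp hi A<..<cusp hi A}) - ({- P<..<Q} \<inter> {- cusp lo A<..<cusp lo A})"
    \<comment> \<open>At 0 the equivalence \<open>cusp_less_iff\<close> breaks down if the radicand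
      is negative; at the other two points the complement of the open inner interval still contains
      the ends.\<close>
    have eq: "x \<in> shell_slice s X A P Q \<longleftrightarrow> x \<in> ?S"
      if x: "x \<noteq> 0" "x \<noteq> cusp lo A" "x \<noteq> - cusp lo A" for x
    proof -
      have "x \<in> ?S \<longleftrightarrow> x \<in> {- P<..<Q} \<and> \<bar>x\<bar> < cusp hi A \<and> cusp lo A < \<bar>x\<bar>"
        using x by (auto simp: abs_if)
      also have "\<dots> \<longleftrightarrow> x \<in> shell_slice s X A P Q"
        unfolding less_cusp_iff cusp_less_iff[OF x(1)] shell_slice_def lo_def hi_def using assms by auto
      finally show ?thesis by simp
    qed
    have "AE x in lborel. x \<in> shell_slice s X A P Q \<longleftrightarrow> x \<in> ?S"
      using AE_lborel_singleton[of 0] AE_lborel_singleton[of "cusp lo A"] AE_lborel_singleton[of "- cusp lo A"]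
      by eventually_elim (rule eq)
    then have "measure lborel (shell_slice s X A P Q) = measure lborel ?S"
      by (rule measure_eq_AE) (use shell_slice_measurable in auto)
    then show ?thesis
      
      using measure_annulus[OF cusp_nonneg cusp_mono[of lo hi A]] assms by (simp add: lo_def hi_def)
  qed
  then show thesis using that by blast
qed

lemma measure_shell_slice_le:
  "measure lborel (shell_slice s X A P Q) \<le> max 0 (P + Q)"
proof -
  have "{- P<..<Q} \<in> fmeasurable lborel" by (cases "- P \<le> Q") (auto intro!: fmeasurableI simp: emeasure_lborel_Ioo)
  then have "measure lborel (shell_slice s X A P Q) \<le> measure lborel {- P<..<Q}"
    by (intro measure_mono_fmeasurable shell_slice_measurable) (auto simp: shell_slice_def)
  also have "\<dots> \<le> max 0 (P + Q)" by (cases "- P \<le> Q") auto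
  finally show ?thesis .
qed

text \<open>After the substitution x = w - c the height condition on B reads -low c A < B < upp c A; at c = 0 both
  bounds become wid A.\<close>

context
  fixes Y :: real
  assumes Y: "Y \<ge> 1"
begin

text \<open>In shifted coordinates the third Schur-Cohn inequality is (B - mid)^2 < Y^4 (Y^2 - A -
  3/4 c^2), so B lies within \<open>rad\<close> of \<open>mid\<close>. The cubic entries of
  \<open>low\<close> and \<open>upp\<close> come from the signs of the polynomial at Y and - Y,
  which the shift moves to Y + c and c - Y.\<close>

definition rad :: "real \<Rightarrow> real \<Rightarrow> real" where "rad c A = Y ^ 2 * sqrt (Y ^ 2 - A - 3 / 4 * c ^ 2)"
definition mid :: "real \<Rightarrow> real \<Rightarrow> real" where "mid c A = 3 / 2 * c * Y ^ 2 - c * A - c ^ 3"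
definition low :: "real \<Rightarrow> real \<Rightarrow> real" where "low c A = min ((Y + c) ^ 3 + A * (Y + c)) (rad c A - mid c A)"
definition upp :: "real \<Rightarrow> real \<Rightarrow> real" where "upp c A = min ((Y - c) ^ 3 + A * (Y - c)) (rad c A + mid c A)"

definition wid :: "real \<Rightarrow> real" where "wid A = min (Y ^ 3 + A * Y) (Y ^ 2 * sqrt (Y ^ 2 - A))"

lemma low_upp_0: "low 0 A = wid A" "upp 0 A = wid A"
  by (simp_all add: low_def upp_def wid_def rad_def mid_def)

lemma cubes:
  "(Y + c) ^ 3 + A * (Y + c) = Y ^ 3 + A * Y + (c * (3 * Y ^ 2 + A) + 3 * Y * c ^ 2 + c ^ 3)"
  "(Y - c) ^ 3 + A * (Y - c) = Y ^ 3 + A * Y + (- c * (3 * Y ^ 2 + A) + 3 * Y * c ^ 2 - c ^ 3)"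
  by (simp_all add: algebra_simps power2_eq_square power3_eq_cube)

text \<open>Crude bounds for the ends of the range of A: the first is small for A near - Y^2, the
  second for A near Y^2.\<close>

lemma low_plus_upp_le:
  "low c A + upp c A \<le> 2 * Y * (Y ^ 2 + A + 3 * c ^ 2)" "low c A + upp c A \<le> 2 * rad c A"
proof -
  have "low c A + upp c A \<le> (Y + c) ^ 3 + A * (Y + c) + ((Y - c) ^ 3 + A * (Y - c))"
    unfolding low_def upp_def by (intro add_mono) auto
  also have "\<dots> = 2 * Y * (Y ^ 2 + A + 3 * c ^ 2)"
    by (simp add: algebra_simps power2_eq_square power3_eq_cube)
  finally show "low c A + upp c A \<le> 2 * Y * (Y ^ 2 + A + 3 * c ^ 2)" .
  show "low c A + upp c A \<le> 2 * rad c A" unfolding low_def upp_def by linarith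
qed

lemma sqrt_diff_le:
  assumes "0 \<le> e" "e \<le> x"
  shows "sqrt x - sqrt (x - e) \<le> sqrt e" "sqrt (x - e) \<le> sqrt x" "(sqrt x - sqrt (x - e)) * sqrt x \<le> e"
proof -
  show 2: "sqrt (x - e) \<le> sqrt x" using assms by simp
  have "sqrt x \<le> sqrt (x - e) + sqrt e"
    using sqrt_add_le_add_sqrt[of "x - e" e] assms by simp
  then show "sqrt x - sqrt (x - e) \<le> sqrt e" by simp
  have "(sqrt x - sqrt (x - e)) * sqrt x \<le> (sqrt x - sqrt (x - e)) * (sqrt x + sqrt (x - e))"
    using 2 assms by (intro mult_left_mono) auto
  also have "\<dots> = e" using assms by (simp add: algebra_simps)
  finally show "(sqrt x - sqrt (x - e)) * sqrt x \<le> e" .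
qed

text \<open>1/12 is the largest value of 3/4 c^2 for |c| \<le> 1/3. Up to Y^2 - 1/12 the radicand in
  \<open>rad\<close> is nonnegative for all these c, and \<open>sqrt (Y ^ 2 - A)\<close> is
  positive.\<close>

context
  fixes c A :: real
  assumes c: "\<bar>c\<bar> \<le> 1 / 3" and A: "- (Y ^ 2) \<le> A" "A \<le> Y ^ 2 - 1 / 12"
begin

lemma c2: "0 \<le> c ^ 2" "c ^ 2 \<le> 1 / 9"
  using c power_mono[of "\<bar>c\<bar>" "1/3" 2] by (auto simp: power2_eq_square)

lemma Y_le: "Y \<le> Y ^ 2" "1 \<le> Y ^ 2"
  using Y by (auto simp: power2_eq_square intro: order_trans[of _ Y])

lemma shift_bounds:
  "\<bar>c * (3 * Y ^ 2 + A) + 3 * Y * c ^ 2 + c ^ 3\<bar> \<le> 2 * Y ^ 2"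
  "\<bar>- c * (3 * Y ^ 2 + A) + 3 * Y * c ^ 2 - c ^ 3\<bar> \<le> 2 * Y ^ 2"
  "\<bar>mid c A\<bar> \<le> Y ^ 2"
proof -
  have "\<bar>c * (3 * Y ^ 2 + A)\<bar> \<le> 1 / 3 * (4 * Y ^ 2)"
    unfolding abs_mult using c A Y_le by (intro mult_mono) auto
  moreover have "\<bar>3 * Y * c ^ 2\<bar> \<le> 3 * Y ^ 2 * (1 / 9)"
    unfolding abs_mult using c2 Y Y_le by (intro mult_mono) auto
  moreover have c3: "\<bar>c ^ 3\<bar> \<le> 1 / 27"
  proof -
    have "\<bar>c\<bar> ^ 3 \<le> (1 / 3) ^ 3" using c by (intro power_mono) auto
    also have "(1 / 3 :: real) ^ 3 = 1 / 27" by (simp add: power3_eq_cube)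
    finally show ?thesis by (simp only: power_abs)
  qed
  ultimately show "\<bar>c * (3 * Y ^ 2 + A) + 3 * Y * c ^ 2 + c ^ 3\<bar> \<le> 2 * Y ^ 2"
    "\<bar>- c * (3 * Y ^ 2 + A) + 3 * Y * c ^ 2 - c ^ 3\<bar> \<le> 2 * Y ^ 2"
    using Y_le unfolding mult_minus_left by linarith+
  have "\<bar>c * (3 / 2 * Y ^ 2 - A)\<bar> \<le> 1 / 3 * (5 / 2 * Y ^ 2)"
    unfolding abs_mult using c A Y_le by (intro mult_mono) auto
  moreover have "mid c A = c * (3 / 2 * Y ^ 2 - A) - c ^ 3" by (simp add: mid_def algebra_simps)
  ultimately show "\<bar>mid c A\<bar> \<le> Y ^ 2" using c3 Y_le by linarith
qed

lemma rad_bounds: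
  "rad c A \<le> Y ^ 2 * sqrt (Y ^ 2 - A)" "Y ^ 2 * sqrt (Y ^ 2 - A) - rad c A \<le> Y ^ 2"
  "Y ^ 2 * sqrt (Y ^ 2 - A) - rad c A \<le> 1 / 2 * Y ^ 2 / sqrt (Y ^ 2 - A)"
proof -
  have e: "0 \<le> 3 / 4 * c ^ 2" "3 / 4 * c ^ 2 \<le> Y ^ 2 - A" "3 / 4 * c ^ 2 \<le> 1 / 2" using c2 A by auto
  note s = sqrt_diff_le[OF e(1,2)]
  show "rad c A \<le> Y ^ 2 * sqrt (Y ^ 2 - A)"
    unfolding rad_def using s(2) by (intro mult_left_mono) auto
  have "sqrt (3 / 4 * c ^ 2) \<le> 1" unfolding real_sqrt_le_1_iff using e by linarith
  then have "sqrt (Y ^ 2 - A) - sqrt (Y ^ 2 - A - 3 / 4 * c ^ 2) \<le> 1" using s(1) by linarith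
  then have "Y ^ 2 * (sqrt (Y ^ 2 - A) - sqrt (Y ^ 2 - A - 3 / 4 * c ^ 2)) \<le> Y ^ 2 * 1"
    by (intro mult_left_mono) auto
  then show "Y ^ 2 * sqrt (Y ^ 2 - A) - rad c A \<le> Y ^ 2" by (simp add: rad_def right_diff_distrib)
  have "sqrt (Y ^ 2 - A) > 0" using A by simp
  then have "sqrt (Y ^ 2 - A) - sqrt (Y ^ 2 - A - 3 / 4 * c ^ 2) \<le> 1 / 2 / sqrt (Y ^ 2 - A)"
    using s(3) e(3) by (simp add: pos_le_divide_eq)
  then have "Y ^ 2 * (sqrt (Y ^ 2 - A) - sqrt (Y ^ 2 - A - 3 / 4 * c ^ 2)) \<le> Y ^ 2 * (1 / 2 / sqrt (Y ^ 2 - A))"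
    by (intro mult_left_mono) auto
  then show "Y ^ 2 * sqrt (Y ^ 2 - A) - rad c A \<le> 1 / 2 * Y ^ 2 / sqrt (Y ^ 2 - A)"
    by (simp add: rad_def right_diff_distrib)
qed

lemma low_upp_near: "\<bar>low c A - wid A\<bar> \<le> 2 * Y ^ 2" "\<bar>upp c A - wid A\<bar> \<le> 2 * Y ^ 2"
proof -
  have m: "\<bar>min p q - min p' q'\<bar> \<le> d" if "\<bar>p - p'\<bar> \<le> d" "\<bar>q - q'\<bar> \<le> d" for p q p' q' d :: real
    using that by (auto simp: min_def)
  show "\<bar>low c A - wid A\<bar> \<le> 2 * Y ^ 2"
    unfolding low_def wid_def cubes by (rule m) (use shift_bounds rad_bounds in linarith)+
  show "\<bar>upp c A - wid A\<bar> \<le> 2 * Y ^ 2"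
    unfolding upp_def wid_def cubes by (rule m) (use shift_bounds rad_bounds in linarith)+
qed

text \<open>For A < - 4 Y the cubic entries are the minima, and c enters the sum only through 6 Y
  c^2. For A > 4 Y the square roots are the minima, and \<open>mid\<close> cancels in the sum. The
  threshold is such that the two entries of \<open>wid\<close> differ by more than 4 Y^2, the most
  by which the shift can move them against each other. For |A| \<le> 4 Y the first-order bound is
  used on an interval of length 8 Y. Each term has an integral O(Y^3).\<close>

lemma second_difference:
  "\<bar>low c A + upp c A - 2 * wid A\<bar> \<le> Y * indicator {- (Y ^ 2)..0} A + 4 * Y ^ 2 * indicator {- (4 * Y)..4 * Y} A
    + Y ^ 2 * (indicator {0..Y ^ 2 - 1 / 12} A / sqrt (Y ^ 2 - A))"
proof -
  have nn: "0 \<le> Y * indicator {- (Y ^ 2)..0} A" "0 \<le> 4 * Y ^ 2 * indicator {- (4 * Y)..4 * Y} A"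
    "0 \<le> Y ^ 2 * (indicator {0..Y ^ 2 - 1 / 12} A / sqrt (Y ^ 2 - A))"
    using Y A by (auto simp: indicator_def)
  have Y3: "Y ^ 3 = Y ^ 2 * Y" by (simp add: power2_eq_square power3_eq_cube)
  consider "A < - (4 * Y)" | "\<bar>A\<bar> \<le> 4 * Y" | "A > 4 * Y" by linarith
  then show ?thesis
  proof cases
    case 1
    have "Y ^ 2 * Y \<le> Y ^ 2 * sqrt (Y ^ 2 - A)"
      using 1 Y by (intro mult_left_mono real_le_rsqrt) auto
    moreover have "A * Y \<le> - (4 * Y) * Y" using 1 Y by (intro mult_right_mono) auto
    then have "A * Y \<le> - 4 * Y ^ 2" by (simp add: power2_eq_square)
    ultimately have "low c A = (Y + c) ^ 3 + A * (Y + c)" "upp c A = (Y - c) ^ 3 + A * (Y - c)"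
      "wid A = Y ^ 3 + A * Y"
      unfolding low_def upp_def wid_def cubes Y3 using shift_bounds rad_bounds by linarith+
    then have "low c A + upp c A - 2 * wid A = 6 * Y * c ^ 2"
      unfolding cubes by (simp add: algebra_simps)
    also have "\<bar>6 * Y * c ^ 2\<bar> \<le> Y"
    proof -
      have "Y * c ^ 2 \<le> Y * (1 / 9)" using c2 Y by (intro mult_left_mono) auto
      moreover have "0 \<le> Y * c ^ 2" using c2 Y by simp
      ultimately show ?thesis using Y by linarith
    qed
    also have "Y = Y * indicator {- (Y ^ 2)..0} A" using 1 A Y by simp
    finally show ?thesis using nn by linarith
  next
    case 2
    have "\<bar>low c A + upp c A - 2 * wid A\<bar> \<le> 4 * Y ^ 2" using low_upp_near by linarith
    also have "4 * Y ^ 2 = 4 * Y ^ 2 * indicator {- (4 * Y)..4 * Y} A" using 2 by (subst indicator_simps(1)) auto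
    finally show ?thesis using nn by linarith
  next
    case 3
    have "sqrt (Y ^ 2 - A) \<le> Y" using 3 Y A by (intro real_le_lsqrt) auto
    then have "Y ^ 2 * sqrt (Y ^ 2 - A) \<le> Y ^ 2 * Y" by (intro mult_left_mono) auto
    moreover have "(4 * Y) * Y \<le> A * Y" using 3 Y by (intro mult_right_mono) auto
    then have "4 * Y ^ 2 \<le> A * Y" by (simp add: power2_eq_square)
    ultimately have "low c A = rad c A - mid c A" "upp c A = rad c A + mid c A"
      "wid A = Y ^ 2 * sqrt (Y ^ 2 - A)"
      unfolding low_def upp_def wid_def cubes Y3 using shift_bounds rad_bounds by linarith+
    then have "\<bar>low c A + upp c A - 2 * wid A\<bar> \<le> Y ^ 2 / sqrt (Y ^ 2 - A)"
      using rad_bounds by simp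
    also have "\<dots> = Y ^ 2 * (indicator {0..Y ^ 2 - 1 / 12} A / sqrt (Y ^ 2 - A))" using 3 A Y by simp
    finally show ?thesis using nn by linarith
  qed
qed

end

end

section \<open>Volumes as integrals of slice lengths in shifted coordinates\<close>

lemma measure_lborel_shift:
  fixes S :: "real set"
  assumes "S \<in> sets borel"
  shows "measure lborel {x. k + x \<in> S} = measure lborel S"
proof -
  have "measure lborel S = measure (distr lborel borel ((+) k)) S" by (simp add: lborel_distr_plus)
  also have "\<dots> = measure lborel ((+) k -` S \<inter> space lborel)"
    using assms by (intro measure_distr) auto
  finally show ?thesis by (simp add: vimage_def)
qed

lemma measure_diam_le:
  fixes S :: "real set"
  assumes "S \<in> sets borel" "L \<ge> 0" "\<And>x y. x \<in> S \<Longrightarrow> y \<in> S \<Longrightarrow> x \<le> y \<Longrightarrow> y - x \<le> L"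
  shows "S \<in> fmeasurable lborel" "measure lborel S \<le> 2 * L"
proof -
  have "S \<in> fmeasurable lborel \<and> measure lborel S \<le> 2 * L"
  proof (cases "S = {}")
    case False
    then obtain x where x: "x \<in> S" by blast
    have sub: "S \<subseteq> {x - L..x + L}"
    proof
      fix y assume "y \<in> S"
      then show "y \<in> {x - L..x + L}" using assms(3)[OF x, of y] assms(3)[of y x] x assms(2)
        by (cases "x \<le> y") auto
    qed
    have f: "{x - L..x + L} \<in> fmeasurable lborel" using assms(2) by (intro fmeasurableI) auto
    then have "S \<in> fmeasurable lborel" using sub assms(1) by (intro fmeasurableI2[OF f sub]) simp
    moreover have "measure lborel S \<le> measure lborel {x - L..x + L}"
      using f sub assms(1) by (intro measure_mono_fmeasurable) auto
    ultimately show ?thesis using assms(2) by simp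
  qed (use assms(2) in simp)
  then show "S \<in> fmeasurable lborel" "measure lborel S \<le> 2 * L" by auto
qed

lemma region_shift_iff:
  assumes "\<bar>3 * c\<bar> \<le> 1" "Y \<ge> 1"
  shows "(A + 3 * c ^ 2, B + c * A + c ^ 3) \<in> region (3 * c) s X Y \<longleftrightarrow>
    A < Y ^ 2 - 3 / 4 * c ^ 2 \<and> B \<in> shell_slice s X A (low Y c A) (upp Y c A)"
proof -
  let ?a = "A + 3 * c ^ 2" and ?b = "B + c * A + c ^ 3"
  have d: "disc (3 * c) ?a ?b = - 4 * A ^ 3 - 27 * B ^ 2"
    by (simp add: disc_def algebra_simps power2_eq_square power3_eq_cube)
  have e: "Y ^ 3 + 3 * c * Y ^ 2 + ?a * Y + ?b = (Y + c) ^ 3 + A * (Y + c) + B"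
    "Y ^ 3 - 3 * c * Y ^ 2 + ?a * Y - ?b = (Y - c) ^ 3 + A * (Y - c) - B"
    by (simp_all add: algebra_simps power2_eq_square power3_eq_cube)
  define D where "D = Y ^ 2 - A - 3 / 4 * c ^ 2"
  have e3: "Y ^ 6 - ?a * Y ^ 4 + 3 * c * ?b * Y ^ 2 - ?b ^ 2 = (Y ^ 2) ^ 2 * D - (B - mid Y c A) ^ 2"
    by (simp add: mid_def[OF assms(2)] D_def field_simps power2_eq_square power3_eq_cube eval_nat_numeral)
  have "(Y ^ 2) ^ 2 * D - (B - mid Y c A) ^ 2 > 0 \<longleftrightarrow> D > 0 \<and> \<bar>B - mid Y c A\<bar> < rad Y c A"
  proof (cases "D > 0")
    case True
    have "rad Y c A = sqrt ((Y ^ 2) ^ 2 * D)"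
      unfolding rad_def[OF assms(2)] D_def[symmetric] real_sqrt_mult by (simp only: real_sqrt_abs abs_power2)
    then have "\<bar>B - mid Y c A\<bar> < rad Y c A \<longleftrightarrow> sqrt ((B - mid Y c A) ^ 2) < sqrt ((Y ^ 2) ^ 2 * D)" by simp
    also have "\<dots> \<longleftrightarrow> (B - mid Y c A) ^ 2 < (Y ^ 2) ^ 2 * D" by (rule real_sqrt_less_iff)
    finally show ?thesis using True by simp
  next
    case False
    then have "(Y ^ 2) ^ 2 * D \<le> 0" by (intro mult_nonneg_nonpos) auto
    then have "\<not> (Y ^ 2) ^ 2 * D - (B - mid Y c A) ^ 2 > 0" using zero_le_power2[of "B - mid Y c A"] by linarith
    then show ?thesis using False by blast
  qed
  moreover have "D > 0 \<longleftrightarrow> A < Y ^ 2 - 3 / 4 * c ^ 2" by (auto simp: D_def)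
  ultimately show ?thesis
    unfolding region_eq[OF assms] mem_Collect_eq prod.case e e3 d shell_slice_def low_def[OF assms(2)] upp_def[OF assms(2)]
    by (auto simp: min_less_iff_conj abs_less_iff)
qed

lemma emeasure_region_finite: "emeasure lborel (region t s X Y) < \<infinity>"
proof -
  have "emeasure lborel (region t s X Y) \<le> emeasure lborel (cbox (- (3 * Y ^ 2), - (Y ^ 3)) (3 * Y ^ 2, Y ^ 3))"
    by (rule emeasure_mono[OF region_subset_cbox]) simp
  also have "\<dots> < \<infinity>" by (rule emeasure_lborel_cbox_finite)
  finally show ?thesis .
qed

definition shifted_len :: "real \<Rightarrow> real \<Rightarrow> real \<Rightarrow> real \<Rightarrow> real \<Rightarrow> real" where
  "shifted_len s X Y c A = (if A < Y ^ 2 - 3 / 4 * c ^ 2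
     then measure lborel (shell_slice s X A (low Y c A) (upp Y c A)) else 0)"

text \<open>The map from (A, B) to (A + 3 c^2, B + c A + c^3) is a shear combined with a
  translation, so it preserves area. This is carried out by translating each slice in B and then the
  integral in A.\<close>

lemma shifted_len_integral:
  assumes "\<bar>3 * c\<bar> \<le> 1" "Y \<ge> 1"
  shows "integrable lborel (shifted_len s X Y c)"
    and "(\<integral>A. shifted_len s X Y c A \<partial>lborel) = measure lborel (region (3 * c) s X Y)"
proof -
  let ?R = "region (3 * c) s X Y"
  define F where "F = (\<lambda>a. measure lborel {b. (a, b) \<in> ?R})"
  have slice: "{b. (a, b) \<in> ?R} \<in> sets borel" "emeasure lborel {b. (a, b) \<in> ?R} < \<infinity>" for a
    using interval_union_count(2,3)[OF region_slice_b[OF assms], of a s X "Y ^ 3" 1 0] region_bounds(2)[of a _ "3 * c" s X Y]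
    by (force simp: abs_le_iff)+
  note F = section_integral[OF region_measurable[OF assms] emeasure_region_finite slice(2), folded F_def]
  have eq: "shifted_len s X Y c A = F (3 * c ^ 2 + 1 * A)" for A
  proof -
    have "F (3 * c ^ 2 + 1 * A) = measure lborel {B. (c * A + c ^ 3) + B \<in> {b. (A + 3 * c ^ 2, b) \<in> ?R}}"
      unfolding F_def by (subst measure_lborel_shift[OF slice(1)]) (simp add: add.commute)
    also have "{B. (c * A + c ^ 3) + B \<in> {b. (A + 3 * c ^ 2, b) \<in> ?R}} = {B. (A + 3 * c ^ 2, B + c * A + c ^ 3) \<in> ?R}"
      by (simp add: algebra_simps)
    also have "measure lborel \<dots> = shifted_len s X Y c A"
      unfolding region_shift_iff[OF assms] shifted_len_def by simp
    finally show ?thesis by simp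
  qed
  show "integrable lborel (shifted_len s X Y c)"
    using lborel_integrable_real_affine[OF F(1), of 1 "3 * c ^ 2"] by (simp add: eq[abs_def])
  show "(\<integral>A. shifted_len s X Y c A \<partial>lborel) = measure lborel ?R"
    using lborel_integral_real_affine[of 1 F "3 * c ^ 2"] F(2) by (simp add: eq[abs_def])
qed

lemma inverse_sqrt_integral:
  fixes Y :: real
  assumes "Y \<ge> 1"
  shows "integrable lborel (\<lambda>A. indicator {0..Y ^ 2 - 1 / 12} A / sqrt (Y ^ 2 - A))" (is ?thesis1)
    and "(\<integral>A. indicator {0..Y ^ 2 - 1 / 12} A / sqrt (Y ^ 2 - A) \<partial>lborel) \<le> 2 * Y" (is ?thesis2)
proof -
  have Y2: "Y ^ 2 \<ge> 1" using assms by simp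
  have "has_bochner_integral lborel (\<lambda>A. 1 / sqrt (Y ^ 2 - A) * indicator {0..Y ^ 2 - 1 / 12} A)
      (- 2 * sqrt (Y ^ 2 - (Y ^ 2 - 1 / 12)) - (- 2 * sqrt (Y ^ 2 - 0)))"
  proof (rule has_bochner_integral_FTC_Icc_real)
    show "0 \<le> Y ^ 2 - 1 / 12" using Y2 by simp
    fix A assume A: "0 \<le> A" "A \<le> Y ^ 2 - 1 / 12"
    show "((\<lambda>A. - 2 * sqrt (Y ^ 2 - A)) has_real_derivative 1 / sqrt (Y ^ 2 - A)) (at A)"
      using A by (auto intro!: derivative_eq_intros simp: field_simps)
    show "isCont (\<lambda>A. 1 / sqrt (Y ^ 2 - A)) A"
      using A by (intro continuous_intros) auto
  qed
  then have *: "has_bochner_integral lborel (\<lambda>A. indicator {0..Y ^ 2 - 1 / 12} A / sqrt (Y ^ 2 - A))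
      (2 * Y - 2 * sqrt (1 / 12))"
    using assms by (simp add: mult.commute)
  then show ?thesis1 by (rule integrable.intros)
  show ?thesis2 using has_bochner_integral_integral_eq[OF *] by simp
qed

text \<open>The exceptional A: an end of the unshifted B-interval lies within 2 Y^2, the bound of
  \<open>low_upp_near\<close>, of a curve bounding the discriminant condition.\<close>

definition near_cusp :: "real \<Rightarrow> real \<Rightarrow> real set" where
  "near_cusp Y k = {A. - (Y ^ 2) \<le> A \<and> A \<le> Y ^ 2 \<and> \<bar>wid Y A - cusp k A\<bar> \<le> 2 * Y ^ 2}"

text \<open>On A <= 0 the difference wid - cusp increases with slope at least Y; on A >= 0 the difference
  wid^2 - cusp^2 decreases with slope at least 15/27 Y^4 unless cusp vanishes.\<close>

lemma measure_near_cusp: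
  assumes Y: "Y \<ge> 1"
  shows "near_cusp Y k \<in> fmeasurable lborel" "measure lborel (near_cusp Y k) \<le> 78 * Y"
proof -
  let ?T = "near_cusp Y k"
  define q where "q = (\<lambda>A. (k - 4 * A ^ 3) / 27)"
  define T1 T2 T3 where "T1 = {A \<in> ?T. A \<le> 0}" and "T2 = {A \<in> ?T. 0 \<le> A \<and> q A \<ge> 0}"
    and "T3 = {A \<in> ?T. 0 \<le> A \<and> q A < 0}"
  have borel: "T1 \<in> sets borel" "T2 \<in> sets borel" "T3 \<in> sets borel"
  proof -
    have [measurable]: "wid Y \<in> borel_measurable borel" "cusp k \<in> borel_measurable borel"
      "q \<in> borel_measurable borel"
      unfolding wid_def[OF Y] cusp_def q_def by measurable
    have "?T = {A \<in> space borel. - (Y ^ 2) \<le> A \<and> A \<le> Y ^ 2 \<and> \<bar>wid Y A - cusp k A\<bar> \<le> 2 * Y ^ 2}"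
      by (simp add: near_cusp_def)
    also have "\<dots> \<in> sets borel" by measurable
    finally have "?T \<in> sets borel" .
    moreover have "{A \<in> space borel. q A \<ge> 0} \<in> sets borel" by measurable
    ultimately have "?T \<inter> {..0} \<in> sets borel" "?T \<inter> {0..} \<inter> {A. q A \<ge> 0} \<in> sets borel"
      "?T \<inter> {0..} - {A. q A \<ge> 0} \<in> sets borel" by auto
    moreover have "T1 = ?T \<inter> {..0}" "T2 = ?T \<inter> {0..} \<inter> {A. q A \<ge> 0}" "T3 = ?T \<inter> {0..} - {A. q A \<ge> 0}"
      by (auto simp: T1_def T2_def T3_def)
    ultimately show "T1 \<in> sets borel" "T2 \<in> sets borel" "T3 \<in> sets borel" by simp_all
  qed
  have Y3: "Y ^ 3 = Y ^ 2 * Y" "Y ^ 2 = Y * Y" by (simp_all add: power2_eq_square power3_eq_cube)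
  have wid_neg: "wid Y A = Y ^ 3 + A * Y" if "A \<le> 0" for A
  proof -
    have "Y ^ 2 * Y \<le> Y ^ 2 * sqrt (Y ^ 2 - A)"
      using that Y by (intro mult_left_mono real_le_rsqrt) auto
    moreover have "A * Y \<le> 0" using that Y by (simp add: mult_nonpos_nonneg)
    ultimately show ?thesis unfolding wid_def[OF Y] Y3(1) by simp
  qed
  have wid_pos: "wid Y A = Y ^ 2 * sqrt (Y ^ 2 - A)" if "A \<ge> 0" for A
  proof -
    have "sqrt (Y ^ 2 - A) \<le> Y" using that Y by (intro real_le_lsqrt) auto
    then have "Y ^ 2 * sqrt (Y ^ 2 - A) \<le> Y ^ 2 * Y" by (intro mult_left_mono) auto
    moreover have "A * Y \<ge> 0" using that Y by simp
    ultimately show ?thesis unfolding wid_def[OF Y] Y3(1) by simp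
  qed
  have d1: "y - x \<le> 4 * Y" if "x \<in> T1" "y \<in> T1" "x \<le> y" for x y
  proof -
    have "wid Y y - wid Y x \<le> 4 * Y ^ 2"
      using that cusp_antimono[OF that(3), of k] by (auto simp: T1_def near_cusp_def abs_le_iff)
    then have "(y - x) * Y \<le> (4 * Y) * Y"
      using that wid_neg[of x] wid_neg[of y] by (simp add: T1_def Y3 algebra_simps)
    then show ?thesis using Y by simp
  qed
  \<comment> \<open>Where \<open>cusp\<close> vanishes, the condition bounds \<open>wid\<close>
    itself, which keeps A within distance 4 of Y^2.\<close>
  have d3: "y - x \<le> 4" if "x \<in> T3" "y \<in> T3" "x \<le> y" for x y
  proof -
    have "cusp k x = 0" using that by (simp add: T3_def cusp_def q_def)
    then have "Y ^ 2 * sqrt (Y ^ 2 - x) \<le> Y ^ 2 * 2"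
      using that wid_pos[of x] by (simp add: T3_def near_cusp_def)
    then have "sqrt (Y ^ 2 - x) \<le> 2" using Y by simp
    then have "Y ^ 2 - x \<le> 2 ^ 2" using real_sqrt_le_iff[of "Y ^ 2 - x" "2 ^ 2"] by simp
    moreover have "y \<le> Y ^ 2" using that by (simp add: T3_def near_cusp_def)
    ultimately show ?thesis by simp
  qed
  \<comment> \<open>As wid + cusp \<le> 4 Y^3, the squares differ by at most 8 Y^5. From x to y
    their difference falls by at least (1 - 12/27) Y^4 (y - x), so y - x is at most 16 Y times
    27/15, and 28.8 is rounded up to 29.\<close>
  have d2: "y - x \<le> 29 * Y" if xy: "x \<in> T2" "y \<in> T2" "x \<le> y" for x y
  proof -
    have main: "\<bar>Y ^ 4 * (Y ^ 2 - A) - q A\<bar> \<le> 8 * Y ^ 5" if "A \<in> T2" for A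
    proof -
      have A: "0 \<le> A" "A \<le> Y ^ 2" "q A \<ge> 0" "\<bar>wid Y A - cusp k A\<bar> \<le> 2 * Y ^ 2"
        using that by (auto simp: T2_def near_cusp_def)
      have w2: "wid Y A ^ 2 = Y ^ 4 * (Y ^ 2 - A)"
        using A wid_pos[of A] by (simp add: power_mult_distrib flip: power_mult)
      have c2: "cusp k A ^ 2 = q A" using A by (simp add: cusp_def q_def)
      have "sqrt (Y ^ 2 - A) \<le> Y" using A Y by (intro real_le_lsqrt) auto
      then have "wid Y A \<le> Y ^ 2 * Y" using A wid_pos[of A] by (simp add: mult_left_mono)
      moreover have "wid Y A \<ge> 0" using A wid_pos[of A] by simp
      moreover have "Y ^ 2 * 1 \<le> Y ^ 2 * Y" using Y by (intro mult_left_mono) auto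
      ultimately have s: "\<bar>wid Y A + cusp k A\<bar> \<le> 4 * Y ^ 3"
        using A(4) cusp_nonneg[of k A] Y3 unfolding abs_le_iff by linarith
      have "Y ^ 4 * (Y ^ 2 - A) - q A = (wid Y A - cusp k A) * (wid Y A + cusp k A)"
        unfolding w2[symmetric] c2[symmetric] by (simp add: power2_eq_square algebra_simps)
      also have "\<bar>\<dots>\<bar> \<le> (2 * Y ^ 2) * (4 * Y ^ 3)"
        unfolding abs_mult using A(4) s by (intro mult_mono) auto
      also have "\<dots> = 8 * Y ^ 5" by (simp add: eval_nat_numeral)
      finally show ?thesis .
    qed
    have xy': "0 \<le> x" "0 \<le> y" "x \<le> Y ^ 2" "y \<le> Y ^ 2" using xy by (auto simp: T2_def near_cusp_def)
    have "y ^ 2 + x * y + x ^ 2 \<le> 3 * Y ^ 4"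
    proof -
      have "y * y \<le> Y ^ 2 * Y ^ 2" "x * y \<le> Y ^ 2 * Y ^ 2" "x * x \<le> Y ^ 2 * Y ^ 2"
        using xy' by (intro mult_mono; simp)+
      then show ?thesis by (simp add: power2_eq_square power4_eq_xxxx)
    qed
    then have "(y - x) * (y ^ 2 + x * y + x ^ 2) \<le> (y - x) * (3 * Y ^ 4)" using xy(3) by (intro mult_left_mono) auto
    moreover have "y ^ 3 - x ^ 3 = (y - x) * (y ^ 2 + x * y + x ^ 2)"
      by (simp add: algebra_simps power2_eq_square power3_eq_cube)
    ultimately have cub: "y ^ 3 - x ^ 3 \<le> 3 * ((y - x) * Y ^ 4)" by simp
    have "(Y ^ 4 * (Y ^ 2 - x) - q x) - (Y ^ 4 * (Y ^ 2 - y) - q y) = (y - x) * Y ^ 4 - 4 / 27 * (y ^ 3 - x ^ 3)"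
      by (simp add: q_def field_simps)
    then have "(y - x) * Y ^ 4 - 4 / 27 * (y ^ 3 - x ^ 3) \<le> 16 * Y ^ 5"
      using main[OF xy(1)] main[OF xy(2)] by linarith
    moreover have "Y ^ 5 \<ge> 0" using Y by simp
    moreover have "z \<le> 29 * f" if "z - 4 / 27 * w \<le> 16 * f" "f \<ge> 0" "w \<le> 3 * z" for z w f :: real
      using that by linarith
    ultimately have "(y - x) * Y ^ 4 \<le> 29 * Y ^ 5" using cub by blast
    also have "29 * Y ^ 5 = (29 * Y) * Y ^ 4" by (simp add: eval_nat_numeral)
    finally show ?thesis using Y by simp
  qed
  have pos: "4 * Y \<ge> 0" "29 * Y \<ge> 0" "(4::real) \<ge> 0" using Y by auto
  note m = measure_diam_le[OF borel(1) pos(1) d1] measure_diam_le[OF borel(2) pos(2) d2]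
    measure_diam_le[OF borel(3) pos(3) d3]
  have T: "?T = T1 \<union> T2 \<union> T3" by (auto simp: T1_def T2_def T3_def)
  show "?T \<in> fmeasurable lborel" unfolding T using m by (intro fmeasurable.Un)
  have "measure lborel ?T \<le> measure lborel T1 + measure lborel T2 + measure lborel T3"
    unfolding T using measure_Un_le[of "T1 \<union> T2" lborel T3] measure_Un_le[of T1 lborel T2] borel by simp
  also have "\<dots> \<le> 78 * Y" using m Y by linarith
  finally show "measure lborel ?T \<le> 78 * Y" .
qed


text \<open>It dominates the change of the slice length: two end zones of the range of A, the bound
  of \<open>second_difference\<close> once for each of the two boundary curves, and twice 2 Y^2
  where an end is close to such a curve.\<close>

definition shift_error :: "real \<Rightarrow> real \<Rightarrow> real \<Rightarrow> real \<Rightarrow> real" where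
  "shift_error Y lo hi A = Y * indicator {- (Y ^ 2) - 1..- (Y ^ 2)} A + 2 * Y ^ 2 * indicator {Y ^ 2 - 1..Y ^ 2} A
    + 2 * (Y * indicator {- (Y ^ 2)..0} A + 4 * Y ^ 2 * indicator {- (4 * Y)..4 * Y} A
      + Y ^ 2 * (indicator {0..Y ^ 2 - 1 / 12} A / sqrt (Y ^ 2 - A)))
    + (4 * Y ^ 2 * indicator (near_cusp Y hi) A + 4 * Y ^ 2 * indicator (near_cusp Y lo) A)"

lemma shift_error_integral:
  assumes Y: "Y \<ge> 1"
  shows "integrable lborel (shift_error Y lo hi)" "(\<integral>A. shift_error Y lo hi A \<partial>lborel) \<le> 700 * Y ^ 3"
proof -
  have ind: "has_bochner_integral lborel (\<lambda>A. r * indicator S A) (r * measure lborel S)"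
    if "S \<in> fmeasurable lborel" for r :: real and S
    using that by (intro has_bochner_integral_mult_right has_bochner_integral_real_indicator)
      (auto simp: fmeasurable_def)
  have Icc: "has_bochner_integral lborel (\<lambda>A. r * indicator {u..v} A) (r * (v - u))" if "u \<le> v" for r u v :: real
    using ind[of "{u..v}" r] that by (simp add: fmeasurableI)
  have scale: "has_bochner_integral lborel (\<lambda>A. r * f A) (r * x)"
    if "has_bochner_integral lborel f x" for r x and f :: "real \<Rightarrow> real"
    using that by (rule has_bochner_integral_mult_right)
  obtain J where J: "has_bochner_integral lborel (\<lambda>A. indicator {0..Y ^ 2 - 1 / 12} A / sqrt (Y ^ 2 - A)) J" "J \<le> 2 * Y"
    using inverse_sqrt_integral[OF Y] has_bochner_integral_iff by blast
  have Y1: "Y \<le> Y ^ 3" "Y ^ 2 \<le> Y ^ 3"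
    using power_increasing[OF _ Y, of 1 3] power_increasing[OF _ Y, of 2 3] by auto
  have main: "has_bochner_integral lborel (shift_error Y lo hi)
    (Y * (- (Y ^ 2) - (- (Y ^ 2) - 1)) + 2 * Y ^ 2 * (Y ^ 2 - (Y ^ 2 - 1))
    + 2 * (Y * (0 - (- (Y ^ 2))) + 4 * Y ^ 2 * (4 * Y - (- (4 * Y))) + Y ^ 2 * J)
    + (4 * Y ^ 2 * measure lborel (near_cusp Y hi) + 4 * Y ^ 2 * measure lborel (near_cusp Y lo)))"
    unfolding shift_error_def[abs_def]
    by (rule has_bochner_integral_add[OF has_bochner_integral_add[OF has_bochner_integral_add[OF Icc Icc]
          scale[OF has_bochner_integral_add[OF has_bochner_integral_add[OF Icc Icc] scale[OF J(1)]]]]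
          has_bochner_integral_add[OF ind[OF measure_near_cusp(1)[OF Y]] ind[OF measure_near_cusp(1)[OF Y]]]])
      (use Y in auto)
  then show "integrable lborel (shift_error Y lo hi)" by (rule integrable.intros)
  have "Y ^ 2 * J \<le> Y ^ 2 * (2 * Y)" using J(2) by (intro mult_left_mono) auto
  then have J': "Y ^ 2 * J \<le> 2 * Y ^ 3" by (simp add: power2_eq_square power3_eq_cube)
  have "4 * Y ^ 2 * measure lborel (near_cusp Y k) \<le> 4 * Y ^ 2 * (78 * Y)" for k
    using measure_near_cusp(2)[OF Y] by (intro mult_left_mono) auto
  then have cusps: "4 * Y ^ 2 * measure lborel (near_cusp Y k) \<le> 312 * Y ^ 3" for k
    by (simp add: power2_eq_square power3_eq_cube)
  have "(\<integral>A. shift_error Y lo hi A \<partial>lborel) = Y + 2 * Y ^ 2 + 66 * Y ^ 3 + 2 * (Y ^ 2 * J)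
    + (4 * Y ^ 2 * measure lborel (near_cusp Y hi) + 4 * Y ^ 2 * measure lborel (near_cusp Y lo))"
    unfolding has_bochner_integral_integral_eq[OF main] by (simp add: algebra_simps power2_eq_square power3_eq_cube)
  \<comment> \<open>The explicit terms contribute 1 + 2 + 66 + 4 and the two exceptional sets 312
    each, in all 697.\<close>
  also have "\<dots> \<le> 700 * Y ^ 3" using Y1 Y J' cusps[of hi] cusps[of lo] by linarith
  finally show "(\<integral>A. shift_error Y lo hi A \<partial>lborel) \<le> 700 * Y ^ 3" .
qed

lemma shifted_len_bounds:
  assumes "Y \<ge> 1"
  shows "0 \<le> shifted_len s X Y c A" "shifted_len s X Y c A \<le> max 0 (2 * Y * (Y ^ 2 + A + 3 * c ^ 2))"
    "shifted_len s X Y c A \<le> max 0 (2 * rad Y c A)"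
  using measure_shell_slice_le[of s X A "low Y c A" "upp Y c A"] low_plus_upp_le[OF assms, of c A]
  by (auto simp: shifted_len_def max_def split: if_splits)

theorem measure_region_diff:
  assumes s: "s \<in> {1, -1}" and X: "X > 0" and Y: "Y \<ge> 1" and c: "\<bar>c\<bar> \<le> 1 / 3"
  shows "\<bar>measure lborel (region (3 * c) s X Y) - measure lborel (region 0 s X Y)\<bar> \<le> 700 * Y ^ 3"
proof -
  obtain lo hi where shell: "\<And>A P Q. measure lborel (shell_slice s X A P Q) =
      overlap (cusp hi A) P Q - overlap (cusp lo A) P Q"
    using shell_cusps[OF s X] by metis
  let ?len = "shifted_len s X Y"
  note bounds = shifted_len_bounds[OF Y, of s X]
  have c2: "0 \<le> c ^ 2" "c ^ 2 \<le> 1 / 9"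
    using c power_mono[of "\<bar>c\<bar>" "1/3" 2] by (auto simp: power2_eq_square)
  have "\<bar>?len c A - ?len 0 A\<bar> \<le> shift_error Y lo hi A" for A
  proof -
    define e1 e2 e3 e4 where "e1 = Y * indicator {- (Y ^ 2) - 1..- (Y ^ 2)} A"
      and "e2 = 2 * Y ^ 2 * indicator {Y ^ 2 - 1..Y ^ 2} A"
      and "e3 = Y * indicator {- (Y ^ 2)..0} A + 4 * Y ^ 2 * indicator {- (4 * Y)..4 * Y} A
      + Y ^ 2 * (indicator {0..Y ^ 2 - 1 / 12} A / sqrt (Y ^ 2 - A))"
      and "e4 = 4 * Y ^ 2 * indicator (near_cusp Y hi) A + 4 * Y ^ 2 * indicator (near_cusp Y lo) A"
    have err: "shift_error Y lo hi A = e1 + e2 + 2 * e3 + e4"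
      by (simp add: shift_error_def e1_def e2_def e3_def e4_def)
    have nn: "e1 \<ge> 0" "e2 \<ge> 0" "e3 \<ge> 0" "e4 \<ge> 0"
      using Y by (auto simp: e1_def e2_def e3_def e4_def indicator_def)
    \<comment> \<open>Below - Y^2 the unshifted slice is empty and the shifted one has length at
      most Y on a set of bounded length. From Y^2 - 1/12 on, where \<open>second_difference\<close>
      ends, both have length at most 2 Y^2 and vanish beyond Y^2.\<close>
    consider "A \<le> - (Y ^ 2)" | "- (Y ^ 2) < A" "A \<le> Y ^ 2 - 1 / 12" "A < Y ^ 2 - 1 / 12" | "Y ^ 2 - 1 / 12 \<le> A"
      by linarith
    then show ?thesis
    proof cases
      case 1
      have "Y * (Y ^ 2 + A) \<le> 0" using 1 Y by (intro mult_nonneg_nonpos) auto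
      then have 0: "?len 0 A = 0" using bounds(1,2)[of 0 A] by simp
      have "?len c A \<le> e1"
      proof (cases "A \<ge> - (Y ^ 2) - 1")
        case True
        have "2 * Y * (Y ^ 2 + A + 3 * c ^ 2) \<le> 2 * Y * (1 / 2)" using Y c2 1 by (intro mult_left_mono) auto
        then have "?len c A \<le> Y" using Y by (intro order_trans[OF bounds(2)] max.boundedI) auto
        also have "Y = e1" using 1 True by (simp add: e1_def)
        finally show ?thesis .
      next
        case False
        then have "2 * Y * (Y ^ 2 + A + 3 * c ^ 2) \<le> 0" using Y c2 by (intro mult_nonneg_nonpos) auto
        then show ?thesis using bounds(2)[of c A] nn by simp
      qed
      then show ?thesis using 0 bounds(1)[of c A] nn unfolding err by linarith
    next
      case 2
      have A: "- (Y ^ 2) \<le> A" "A \<le> Y ^ 2 - 1 / 12" using 2 by auto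
      have lens: "?len c A = overlap (cusp hi A) (low Y c A) (upp Y c A) - overlap (cusp lo A) (low Y c A) (upp Y c A)"
        "?len 0 A = overlap (cusp hi A) (wid Y A) (wid Y A) - overlap (cusp lo A) (wid Y A) (wid Y A)"
        using 2 c2 by (auto simp: shifted_len_def shell low_upp_0[OF Y])
      have "0 \<le> (Y ^ 2 + A) * Y" using A Y by (intro mult_nonneg_nonneg) auto
      also have "(Y ^ 2 + A) * Y = Y ^ 3 + A * Y" by (simp add: algebra_simps power2_eq_square power3_eq_cube)
      finally have w: "wid Y A \<ge> 0" using 2 by (simp add: wid_def[OF Y])
      note near = low_upp_near[OF Y c A]
      have ov: "\<bar>overlap (cusp k A) (low Y c A) (upp Y c A) - overlap (cusp k A) (wid Y A) (wid Y A)\<bar>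
        \<le> e3 + 4 * Y ^ 2 * indicator (near_cusp Y k) A" for k
      proof -
        have "(if \<bar>wid Y A - cusp k A\<bar> \<le> 2 * Y ^ 2 then 2 * (2 * Y ^ 2) else 0) = 4 * Y ^ 2 * indicator (near_cusp Y k) A"
          using A by (auto simp: near_cusp_def)
        then show ?thesis
          using overlap_diff_le[OF w cusp_nonneg near, of k A] second_difference[OF Y c A]
          unfolding e3_def by linarith
      qed
      show ?thesis using ov[of hi] ov[of lo] nn unfolding err lens e4_def by linarith
    next
      case 3
      show ?thesis
      proof (cases "A < Y ^ 2")
        case True
        have "?len d A \<le> 2 * Y ^ 2" for d
        proof (cases "A < Y ^ 2 - 3 / 4 * d ^ 2")
          case True
          have "sqrt (Y ^ 2 - A - 3 / 4 * d ^ 2) \<le> 1"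
            unfolding real_sqrt_le_1_iff using 3 zero_le_power2[of d] by linarith
          then have "rad Y d A \<le> Y ^ 2 * 1" unfolding rad_def[OF Y] by (intro mult_left_mono) auto
          then show ?thesis by (intro order_trans[OF bounds(3)] max.boundedI) auto
        qed (simp add: shifted_len_def)
        moreover have "e2 = 2 * Y ^ 2" using True 3 by (simp add: e2_def)
        ultimately have "?len c A \<le> e2" "?len 0 A \<le> e2" by simp_all
        then show ?thesis using bounds(1)[of c A] bounds(1)[of 0 A] nn unfolding err by linarith
      next
        case False
        then have "\<not> A < Y ^ 2 - 3 / 4 * c ^ 2" using c2 by linarith
        moreover have "\<not> A < Y ^ 2 - 3 / 4 * 0 ^ 2" using False by simp
        ultimately have "?len c A = 0" "?len 0 A = 0" by (simp_all only: shifted_len_def if_False)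
        then show ?thesis using nn unfolding err by linarith
      qed
    qed
  qed
  note pointwise = this
  have c': "\<bar>3 * c\<bar> \<le> 1" "\<bar>3 * 0 :: real\<bar> \<le> 1" using c by auto
  note int = shifted_len_integral[OF c'(1) Y, of s X] shifted_len_integral[OF c'(2) Y, of s X]
  have "\<bar>measure lborel (region (3 * c) s X Y) - measure lborel (region 0 s X Y)\<bar>
      = \<bar>\<integral>A. ?len c A - ?len 0 A \<partial>lborel\<bar>"
    using int by simp
  also have "\<dots> \<le> (\<integral>A. \<bar>?len c A - ?len 0 A\<bar> \<partial>lborel)" by (rule integral_abs_bound)
  also have "\<dots> \<le> (\<integral>A. shift_error Y lo hi A \<partial>lborel)"
    using int pointwise shift_error_integral(1)[OF Y]
    by (intro integral_mono integrable_abs Bochner_Integration.integrable_diff) auto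
  also have "\<dots> \<le> 700 * Y ^ 3" by (rule shift_error_integral(2)[OF Y])
  finally show ?thesis .
qed

section \<open>Counting\<close>

lemma crt_class:
  fixes u v n m :: int
  assumes "coprime n m" "n > 0" "m > 0"
  obtains c where "c \<in> {0..<n * m}" "\<And>A. A mod m = v mod m \<and> n dvd A - u \<longleftrightarrow> A mod (n * m) = c"
proof -
  obtain x where x: "[x = u] (mod n)" "[x = v] (mod m)"
    using binary_chinese_remainder_int[OF assms(1)] by blast
  have "A mod m = v mod m \<and> n dvd A - u \<longleftrightarrow> A mod (n * m) = x mod (n * m)" for A
  proof -
    have "A mod m = v mod m \<longleftrightarrow> m dvd A - x" "n dvd A - u \<longleftrightarrow> n dvd A - x"
    proof -
      have "x mod n = u mod n" "x mod m = v mod m" using x by (auto simp: cong_iff_dvd_diff mod_eq_dvd_iff)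
      then show "A mod m = v mod m \<longleftrightarrow> m dvd A - x" "n dvd A - u \<longleftrightarrow> n dvd A - x"
        by (simp_all flip: mod_eq_dvd_iff)
    qed
    moreover have "n * m dvd k \<longleftrightarrow> n dvd k \<and> m dvd k" for k
      using divides_mult[OF _ _ assms(1)] by (auto intro: dvd_mult_left dvd_mult_right)
    ultimately show ?thesis by (auto simp: mod_eq_dvd_iff)
  qed
  moreover have "x mod (n * m) \<in> {0..<n * m}" using assms by simp
  ultimately show thesis using that by blast
qed

lemma card_int_abs_le:
  assumes "M \<ge> 0"
  shows "finite {A :: int. \<bar>of_int A\<bar> \<le> (M :: real)}" "real (card {A :: int. \<bar>of_int A\<bar> \<le> M}) \<le> 2 * M + 1"
proof -
  have "\<bar>of_int A\<bar> \<le> M \<longleftrightarrow> A \<in> {- \<lfloor>M\<rfloor>..\<lfloor>M\<rfloor>}" for A :: int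
  proof -
    have "A \<le> \<lfloor>M\<rfloor> \<longleftrightarrow> of_int A \<le> M" by (rule le_floor_iff)
    moreover have "- A \<le> \<lfloor>M\<rfloor> \<longleftrightarrow> - of_int A \<le> M" using le_floor_iff[of "- A" M] by simp
    ultimately show ?thesis
      unfolding abs_le_iff atLeastAtMost_iff minus_le_iff[of "\<lfloor>M\<rfloor>" A] by blast
  qed
  then have eq: "{A :: int. \<bar>of_int A\<bar> \<le> M} = {- \<lfloor>M\<rfloor>..\<lfloor>M\<rfloor>}" by blast
  show "finite {A :: int. \<bar>of_int A\<bar> \<le> M}" unfolding eq by simp
  have "\<lfloor>M\<rfloor> \<ge> 0" using assms by simp
  then show "real (card {A :: int. \<bar>of_int A\<bar> \<le> M}) \<le> 2 * M + 1" unfolding eq by simp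
qed

abbreviation class_points :: "int \<Rightarrow> nat \<Rightarrow> nat \<Rightarrow> (real \<times> real) set \<Rightarrow> int \<Rightarrow> int \<Rightarrow> int \<Rightarrow> (int \<times> int) set" where
  "class_points t n m R \<alpha> \<beta> r \<equiv> {(A, B). A mod int m = \<alpha> mod int m \<and> B mod int m = \<beta> mod int m \<and>
    index_dvd_at t A B n r \<and> (of_int A, of_int B) \<in> R}"

abbreviation class_line :: "int \<Rightarrow> nat \<Rightarrow> nat \<Rightarrow> real \<Rightarrow> int \<Rightarrow> int \<Rightarrow> int set" where
  "class_line t n m Y \<alpha> r \<equiv> {A. A mod int m = \<alpha> mod int m \<and> int n dvd cubic_der t A r \<and> \<bar>of_int A\<bar> \<le> 3 * Y ^ 2}"

abbreviation residue_pairs :: "nat \<Rightarrow> (int \<times> int \<times> int) set \<Rightarrow> int \<Rightarrow> (int \<times> int) set" where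
  "residue_pairs m L t \<equiv> {(\<alpha>, \<beta>). \<alpha> \<in> {0..<int m} \<and> \<beta> \<in> {0..<int m} \<and> (t, \<alpha>, \<beta>) \<in> L}"

abbreviation index_points :: "nat \<Rightarrow> (int \<times> int \<times> int) set \<Rightarrow> (real \<times> real) set \<Rightarrow> int \<Rightarrow> (int \<times> int) set" where
  "index_points n L R t \<equiv> {(A, B). (t, A, B) \<in> L \<and> (\<exists>r. index_dvd_at t A B n r) \<and> (of_int A, of_int B) \<in> R}"

text \<open>For given r the conditions are that n divides A + 3 r^2 + 2 t r and that n^2 divides B +
  r^3 + t r^2 + A r. The Chinese remainder theorem combines each of them with the class modulo m;
  the class of B depends on A through the term A r.\<close>

lemma card_index_points:
  fixes s X Y :: real
  assumes Y: "Y \<ge> 1" and tt: "t \<in> {-1, 0, 1 :: int}" and nm: "n > 0" "m > 0" "coprime n m"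
  defines "R \<equiv> region (of_int t) s X Y"
  shows "\<bar>real (card (class_points t n m R \<alpha> \<beta> r))
      - measure lborel R / (real n ^ 3 * real m ^ 2)\<bar>
    \<le> 3 * real (card (class_line t n m Y \<alpha> r))
      + 6 * Y ^ 3 / (real n ^ 2 * real m)"
proof -
  have t1: "\<bar>of_int t :: real\<bar> \<le> 1" using tt by auto
  have co: "coprime (int n) (int m)" using nm by simp
  have co2: "coprime (int (n ^ 2)) (int m)" using nm by simp
  have pos: "int n > 0" "int m > 0" "int (n ^ 2) > 0" using nm by auto
  obtain c where c: "c \<in> {0..<int n * int m}"
    "\<And>A. A mod int m = \<alpha> mod int m \<and> int n dvd A - (- (3 * r ^ 2) - 2 * t * r) \<longleftrightarrow> A mod (int n * int m) = c"
    by (rule crt_class[OF co pos(1,2), of \<alpha> "- (3 * r ^ 2) - 2 * t * r"]) blast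
  have "\<exists>d. d \<in> {0..<int (n ^ 2) * int m} \<and> (\<forall>B. B mod int m = \<beta> mod int m \<and> int (n ^ 2) dvd B - (- (r ^ 3) - t * r ^ 2 - A * r) \<longleftrightarrow> B mod (int (n ^ 2) * int m) = d)" for A
    by (rule crt_class[OF co2 pos(3,2), of \<beta> "- (r ^ 3) - t * r ^ 2 - A * r"]) blast
  then obtain d where d: "\<And>A. d A \<in> {0..<int (n ^ 2) * int m}"
    "\<And>A B. B mod int m = \<beta> mod int m \<and> int (n ^ 2) dvd B - (- (r ^ 3) - t * r ^ 2 - A * r) \<longleftrightarrow> B mod (int (n ^ 2) * int m) = d A"
    by metis
  have der: "int n dvd cubic_der t A r \<longleftrightarrow> int n dvd A - (- (3 * r ^ 2) - 2 * t * r)" for A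
    by (simp add: cubic_der_def algebra_simps)
  have val: "int (n ^ 2) dvd cubic_val t A B r \<longleftrightarrow> int (n ^ 2) dvd B - (- (r ^ 3) - t * r ^ 2 - A * r)" for A B
    by (simp add: cubic_val_def algebra_simps)
  have set1: "class_points t n m R \<alpha> \<beta> r
    = {(A, B). A mod (int n * int m) = c \<and> B mod (int (n ^ 2) * int m) = d A \<and> (of_int A, of_int B) \<in> R}"
    unfolding index_dvd_at_def der val c(2)[symmetric] d(2)[symmetric] by auto
  have set2: "class_line t n m Y \<alpha> r
    = {A. A mod (int n * int m) = c \<and> \<bar>of_int A\<bar> \<le> 3 * Y ^ 2}"
    unfolding der c(2)[symmetric] by auto
  have "\<bar>real (card {(A, B). A mod (int n * int m) = c \<and> B mod (int (n ^ 2) * int m) = d A \<and> (of_int A, of_int B) \<in> R})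
    - measure lborel R / (of_int (int n * int m) * of_int (int (n ^ 2) * int m))\<bar>
    \<le> real 3 * real (card {A. A mod (int n * int m) = c \<and> \<bar>of_int A\<bar> \<le> 3 * Y ^ 2}) + 2 * real 3 * Y ^ 3 / of_int (int (n ^ 2) * int m)"
  proof (rule card_lattice_points_le)
    show "R \<in> sets (borel \<Otimes>\<^sub>M borel)" unfolding R_def by (rule region_measurable[OF t1 Y])
    show "\<bar>a\<bar> \<le> 3 * Y ^ 2 \<and> \<bar>b\<bar> \<le> Y ^ 3" if "(a, b) \<in> R" for a b
      using region_bounds that by (auto simp: R_def)
    show "interval_union 3 {b. (a, b) \<in> R}" for a unfolding R_def by (rule region_slice_b[OF t1 Y])
    show "interval_union 3 {a. (a, b) \<in> R}" for b unfolding R_def by (rule region_slice_a[OF t1 Y])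
  qed (use c d pos Y in auto)
  moreover have "of_int (int n * int m) * of_int (int (n ^ 2) * int m) = real n ^ 3 * real m ^ 2"
    by (simp add: power2_eq_square power3_eq_cube)
  ultimately show ?thesis unfolding set1 set2 by simp
qed

text \<open>Since r is unique modulo n, the points form a disjoint union over n card \<Lambda>
  choices of r and residues modulo m; summing over r turns the n^3 of the single classes into
  n^2.\<close>

lemma card_t_section:
  fixes s X Y \<epsilon> C0 :: real
  assumes Y: "Y \<ge> 1" and tt: "t \<in> {-1, 0, 1 :: int}" and n: "n > 0" "squarefree n" and m: "m > 0" "coprime n m"
    and L: "defined_mod m L"
    and C0: "\<And>a. real (card (der_roots n t a)) \<le> C0 * real n powr \<epsilon>"
  defines "R \<equiv> region (of_int t) s X Y"
    and "\<Lambda> \<equiv> residue_pairs m L t"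
  shows "\<bar>real (card (index_points n L R t))
      - real (card \<Lambda>) * measure lborel R / (real n ^ 2 * real m ^ 2)\<bar>
    \<le> 21 * C0 * (Y ^ 2 * real m * real n powr \<epsilon>) + 6 * (Y ^ 3 * real m / real n)"
proof -
  let ?T = "index_points n L R t"
  let ?P = "\<lambda>(r, \<alpha>, \<beta>). class_points t n m R \<alpha> \<beta> r"
  let ?S = "\<lambda>r \<alpha>. class_line t n m Y \<alpha> r"
  let ?I = "{0..<int n} \<times> \<Lambda>"
  let ?A = "{A :: int. \<bar>of_int A\<bar> \<le> 3 * Y ^ 2}"
  have \<Lambda>_sub: "\<Lambda> \<subseteq> {0..<int m} \<times> {0..<int m}" by (auto simp: \<Lambda>_def)
  then have fin\<Lambda>: "finite \<Lambda>" by (rule finite_subset) simp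
  have card\<Lambda>: "card \<Lambda> \<le> m ^ 2"
    using card_mono[OF _ \<Lambda>_sub] by (simp add: card_cartesian_product power2_eq_square)
  have finA: "finite ?A" and cardA: "real (card ?A) \<le> 7 * Y ^ 2"
  proof -
    have "3 * Y ^ 2 \<ge> 0" by simp
    note M = card_int_abs_le[OF this]
    show "finite ?A" by (rule M(1))
    have "1 \<le> Y ^ 2" using Y by simp
    then show "real (card ?A) \<le> 7 * Y ^ 2" using M(2) by linarith
  qed
  have finP: "finite (?P i)" for i
  proof (rule finite_subset)
    show "?P i \<subseteq> ?A \<times> {B :: int. \<bar>of_int B\<bar> \<le> Y ^ 3}"
      using region_bounds by (cases i) (auto simp: R_def)
    show "finite (?A \<times> {B :: int. \<bar>of_int B\<bar> \<le> Y ^ 3})"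
      using finA card_int_abs_le(1)[of "Y ^ 3"] Y by simp
  qed
  have L_iff: "(t, A, B) \<in> L \<longleftrightarrow> (A mod int m, B mod int m) \<in> \<Lambda>" for A B
  proof -
    have "(t, A, B) \<in> VZ" using tt by (auto simp: VZ_def)
    then have "(t, A, B) \<in> L \<longleftrightarrow> (t, A mod int m, B mod int m) \<in> L"
      using L unfolding defined_mod_def by (metis mod_mod_trivial)
    then show ?thesis using m by (simp add: \<Lambda>_def)
  qed
  have "?T = (\<Union>i\<in>?I. ?P i)"
  proof (intro equalityI subsetI)
    fix x assume "x \<in> ?T"
    then obtain A B where x: "x = (A, B)" "(A mod int m, B mod int m) \<in> \<Lambda>" "\<exists>r. index_dvd_at t A B n r" "(of_int A, of_int B) \<in> R"
      using L_iff by auto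
    then obtain r where "r \<in> {0..<int n}" "index_dvd_at t A B n r"
      using index_dvd_at_ex1[OF n(2), of t A B] by blast
    then show "x \<in> (\<Union>i\<in>?I. ?P i)" using x
      by (intro UN_I[of "(r, A mod int m, B mod int m)"]) auto
  next
    fix x assume "x \<in> (\<Union>i\<in>?I. ?P i)"
    then obtain r \<alpha> \<beta> A B where x: "x = (A, B)" "(\<alpha>, \<beta>) \<in> \<Lambda>" "A mod int m = \<alpha> mod int m" "B mod int m = \<beta> mod int m"
      "index_dvd_at t A B n r" "(of_int A, of_int B) \<in> R" by auto
    then have "(A mod int m, B mod int m) \<in> \<Lambda>" using \<Lambda>_sub by auto
    then show "x \<in> ?T" using x L_iff by auto
  qed
  moreover have "card (\<Union>i\<in>?I. ?P i) = (\<Sum>i\<in>?I. card (?P i))"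
  proof (rule card_UN_disjoint)
    show "\<forall>i\<in>?I. \<forall>j\<in>?I. i \<noteq> j \<longrightarrow> ?P i \<inter> ?P j = {}"
    proof (intro ballI impI, rule ccontr)
      fix i j assume ij: "i \<in> ?I" "j \<in> ?I" "i \<noteq> j" "?P i \<inter> ?P j \<noteq> {}"
      obtain r \<alpha> \<beta> where i: "i = (r, \<alpha>, \<beta>)" by (cases i) auto
      obtain r' \<alpha>' \<beta>' where j: "j = (r', \<alpha>', \<beta>')" by (cases j) auto
      obtain A B where AB: "(A, B) \<in> ?P i" "(A, B) \<in> ?P j" using ij(4) by auto
      have r: "index_dvd_at t A B n r" "index_dvd_at t A B n r'" using AB by (auto simp: i j)
      then have "r = r'" using index_dvd_at_ex1[OF n(2), of t A B] ij(1,2) by (auto simp: i j)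
      moreover have "(\<alpha>, \<beta>) \<in> {0..<int m} \<times> {0..<int m}" "(\<alpha>', \<beta>') \<in> {0..<int m} \<times> {0..<int m}"
        using ij(1,2) \<Lambda>_sub by (auto simp: i j)
      then have "\<alpha> = \<alpha>'" "\<beta> = \<beta>'" using AB by (auto simp: i j)
      ultimately show False using ij(3) by (simp add: i j)
    qed
  qed (use fin\<Lambda> finP in auto)
  ultimately have card_T: "real (card ?T) = (\<Sum>i\<in>?I. real (card (?P i)))" by simp
  have "\<bar>(\<Sum>i\<in>?I. real (card (?P i))) - (\<Sum>i\<in>?I. measure lborel R / (real n ^ 3 * real m ^ 2))\<bar>
      \<le> (\<Sum>i\<in>?I. \<bar>real (card (?P i)) - measure lborel R / (real n ^ 3 * real m ^ 2)\<bar>)"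
    unfolding sum_subtractf[symmetric] by (rule sum_abs)
  also have "\<dots> \<le> (\<Sum>i\<in>?I. case i of (r, \<alpha>, \<beta>) \<Rightarrow> 3 * real (card (?S r \<alpha>)) + 6 * Y ^ 3 / (real n ^ 2 * real m))"
    unfolding R_def using card_index_points[OF Y tt n(1) m] by (intro sum_mono) auto
  also have "\<dots> = 3 * (\<Sum>(r, \<alpha>, \<beta>)\<in>?I. real (card (?S r \<alpha>))) + real (card ?I) * (6 * Y ^ 3 / (real n ^ 2 * real m))"
    by (simp add: case_prod_unfold sum.distrib sum_distrib_left)
  also have "(\<Sum>i\<in>?I. measure lborel R / (real n ^ 3 * real m ^ 2)) = real (card \<Lambda>) * measure lborel R / (real n ^ 2 * real m ^ 2)"
    using n by (simp add: card_cartesian_product power2_eq_square power3_eq_cube)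
  finally have 1: "\<bar>real (card ?T) - real (card \<Lambda>) * measure lborel R / (real n ^ 2 * real m ^ 2)\<bar>
    \<le> 3 * (\<Sum>(r, \<alpha>, \<beta>)\<in>?I. real (card (?S r \<alpha>))) + real (card ?I) * (6 * Y ^ 3 / (real n ^ 2 * real m))"
    unfolding card_T .
  have 2: "real (card ?I) * (6 * Y ^ 3 / (real n ^ 2 * real m)) \<le> 6 * (Y ^ 3 * real m / real n)"
  proof -
    have "real (card ?I) \<le> real n * real m ^ 2"
    proof -
      have "real (card \<Lambda>) \<le> real m ^ 2" using card\<Lambda> by (metis of_nat_le_iff of_nat_power)
      then show ?thesis by (simp add: card_cartesian_product mult_left_mono)
    qed
    then have "real (card ?I) * (6 * Y ^ 3 / (real n ^ 2 * real m)) \<le> real n * real m ^ 2 * (6 * Y ^ 3 / (real n ^ 2 * real m))"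
      using Y by (intro mult_right_mono) auto
    also have "\<dots> = 6 * (Y ^ 3 * real m / real n)"
      using n m by (simp add: power2_eq_square)
    finally show ?thesis .
  qed
  have 3: "(\<Sum>(r, \<alpha>, \<beta>)\<in>?I. real (card (?S r \<alpha>))) \<le> 7 * C0 * (Y ^ 2 * real m * real n powr \<epsilon>)"
  proof -
    \<comment> \<open>The set of admissible A does not depend on \<beta>, which therefore
      contributes a factor m; the sum over \<alpha> then removes the condition on A modulo
      m.\<close>
    have "(\<Sum>(r, \<alpha>, \<beta>)\<in>?I. real (card (?S r \<alpha>))) \<le> (\<Sum>(r, \<alpha>, \<beta>)\<in>{0..<int n} \<times> {0..<int m} \<times> {0..<int m}. real (card (?S r \<alpha>)))"
      using \<Lambda>_sub by (intro sum_mono2) auto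
    also have "\<dots> = real m * (\<Sum>r\<in>{0..<int n}. \<Sum>\<alpha>\<in>{0..<int m}. real (card (?S r \<alpha>)))"
      by (simp add: sum.cartesian_product[symmetric] sum_distrib_left)
    also have "(\<Sum>r\<in>{0..<int n}. \<Sum>\<alpha>\<in>{0..<int m}. real (card (?S r \<alpha>))) = (\<Sum>r\<in>{0..<int n}. real (card {A \<in> ?A. int n dvd cubic_der t A r}))"
    proof (rule sum.cong[OF refl])
      fix r
      have "{A \<in> ?A. int n dvd cubic_der t A r} = (\<Union>\<alpha>\<in>{0..<int m}. ?S r \<alpha>)"
        using m by (auto intro!: bexI[of _ "_ mod int m"])
      moreover have "card (\<Union>\<alpha>\<in>{0..<int m}. ?S r \<alpha>) = (\<Sum>\<alpha>\<in>{0..<int m}. card (?S r \<alpha>))"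
        by (rule card_UN_disjoint) (auto intro: finite_subset[OF _ finA])
      ultimately show "(\<Sum>\<alpha>\<in>{0..<int m}. real (card (?S r \<alpha>))) = real (card {A \<in> ?A. int n dvd cubic_der t A r})" by simp
    qed
    also have "\<dots> = (\<Sum>r\<in>{0..<int n}. \<Sum>A\<in>?A. of_bool (int n dvd cubic_der t A r))"
      using finA by (simp add: Int_def)
    \<comment> \<open>The exchange that avoids an additive error for every r: what remains for each
      A is the number of zeros of f' modulo n.\<close>
    also have "\<dots> = (\<Sum>A\<in>?A. \<Sum>r\<in>{0..<int n}. of_bool (int n dvd cubic_der t A r))"
      by (rule sum.swap)
    also have "\<dots> = (\<Sum>A\<in>?A. real (card (der_roots n t A)))"
      by (simp add: Int_def)
    also have "real m * \<dots> \<le> real m * (\<Sum>A\<in>?A. C0 * real n powr \<epsilon>)"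
      using C0 by (intro mult_left_mono sum_mono) auto
    also have "\<dots> = real (card ?A) * (real m * (C0 * real n powr \<epsilon>))" by simp
    also have "\<dots> \<le> 7 * Y ^ 2 * (real m * (C0 * real n powr \<epsilon>))"
    proof (rule mult_right_mono[OF cardA])
      have "0 \<le> C0 * real n powr \<epsilon>" using C0[of 0] by (rule order_trans[rotated]) simp
      then show "0 \<le> real m * (C0 * real n powr \<epsilon>)" by simp
    qed
    finally show ?thesis by (simp add: mult_ac)
  qed
  show ?thesis using 1 2 3 by linarith
qed

section \<open>Combining the three traces\<close>

lemma defined_mod_card_reduce:
  assumes "defined_mod m L" "m > 0"
  shows "card (reduce m ` L) = (\<Sum>t\<in>{-1, 0, 1}. card (residue_pairs m L t))"
proof -
  let ?\<Lambda> = "\<lambda>t. residue_pairs m L t"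
  have "reduce m ` L = (SIGMA t:{-1, 0, 1}. ?\<Lambda> t)"
  proof (intro equalityI subsetI)
    fix x assume "x \<in> reduce m ` L"
    then obtain t a b where x: "(t, a, b) \<in> L" "x = (t, a mod int m, b mod int m)" by force
    have "(t, a, b) \<in> VZ" using x assms by (auto simp: defined_mod_def)
    moreover from this have "(t, a mod int m, b mod int m) \<in> L"
      using assms(1) x(1) unfolding defined_mod_def by (metis mod_mod_trivial)
    ultimately show "x \<in> (SIGMA t:{-1, 0, 1}. ?\<Lambda> t)" using assms x by (auto simp: VZ_def)
  next
    fix x assume "x \<in> (SIGMA t:{-1, 0, 1}. ?\<Lambda> t)"
    then obtain t a b where x: "(t, a, b) \<in> L" "x = (t, a, b)" "a \<in> {0..<int m}" "b \<in> {0..<int m}" by force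
    then have "x = reduce m (t, a, b)" by simp
    then show "x \<in> reduce m ` L" using x(1) by blast
  qed
  moreover have "finite (?\<Lambda> t)" for t
    by (rule finite_subset[of _ "{0..<int m} \<times> {0..<int m}"]) auto
  ultimately show ?thesis by simp
qed

lemma Vol_eq: "Vol s X Y = (\<Sum>t\<in>{-1, 0, 1::int}. measure lborel (region (of_int t) (of_int s) X Y))"
  by (simp add: Vol_def region_def)

lemma measure_region_le:
  assumes "Y > 0"
  shows "measure lborel (region t s X Y) \<le> 12 * Y ^ 5"
proof -
  let ?B = "cbox (- (3 * Y ^ 2), - (Y ^ 3)) (3 * Y ^ 2, Y ^ 3)"
  have "emeasure lborel (region t s X Y) \<le> emeasure lborel ?B"
    by (rule emeasure_mono[OF region_subset_cbox]) simp
  then have "measure lborel (region t s X Y) \<le> measure lborel ?B"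
    unfolding measure_def using emeasure_lborel_cbox_finite by (intro enn2real_mono) (simp_all only: infinity_ennreal_def)
  also have "measure lborel ?B = (6 * Y ^ 2) * (2 * Y ^ 3)"
    using assms by (subst content_Pair) auto
  also have "\<dots> = 12 * Y ^ 5" by (simp add: eval_nat_numeral)
  finally show ?thesis .
qed

lemma count_eq:
  assumes n: "squarefree n" and s: "s \<in> {1, -1}" and L: "L \<subseteq> VZ"
  shows "count L n s X Y = (\<Sum>t\<in>{-1, 0, 1}. card (index_points n L (region (of_int t) (of_int s) X Y) t))"
proof -
  let ?T = "\<lambda>t. index_points n L (region (of_int t) (of_int s) X Y) t"
  have R: "(of_int A, of_int B) \<in> region (of_int t) (of_int s) X Y \<longleftrightarrow>
    0 < s * disc t A B \<and> real_of_int (s * disc t A B) < X \<and> hgt (of_int t) (of_int A) (of_int B) < Y" for t A B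
  proof -
    have "0 < real_of_int s * real_of_int (disc t A B) \<longleftrightarrow> 0 < s * disc t A B"
      by (metis of_int_0_less_iff of_int_mult)
    moreover have "\<bar>real_of_int (disc t A B)\<bar> = real_of_int (s * disc t A B)" if "0 < s * disc t A B"
      using that s by auto
    ultimately show ?thesis unfolding region_def mem_Collect_eq prod.case of_int_disc[symmetric] by auto
  qed
  have Sigma: "(t, A, B) \<in> Sigma_n n \<longleftrightarrow> (\<exists>r. index_dvd_at t A B n r)" if "(t, A, B) \<in> L" "0 < s * disc t A B" for t A B
  proof -
    have "disc t A B \<noteq> 0" using that(2) by auto
    then show ?thesis using that(1) L squarefree_dvd_ind_iff[OF n, of t A B] by (auto simp: Sigma_n_def)
  qed
  have "{(t, a, b) \<in> L \<inter> Sigma_n n. 0 < s * disc t a b \<and> real_of_int (s * disc t a b) < X \<and>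
      hgt (of_int t) (of_int a) (of_int b) < Y} = (SIGMA t:{-1, 0, 1}. ?T t)"
    using L Sigma unfolding R by (auto simp: VZ_def)
  moreover have "finite (?T t)" for t
  proof (rule finite_subset)
    show "?T t \<subseteq> {A :: int. \<bar>of_int A\<bar> \<le> 3 * Y ^ 2} \<times> {B :: int. \<bar>of_int B\<bar> \<le> \<bar>Y ^ 3\<bar>}"
    proof
      fix p assume "p \<in> ?T t"
      then have "(of_int (fst p), of_int (snd p)) \<in> region (of_int t) (of_int s) X Y" by auto
      from region_bounds[OF this] show "p \<in> {A :: int. \<bar>of_int A\<bar> \<le> 3 * Y ^ 2} \<times> {B :: int. \<bar>of_int B\<bar> \<le> \<bar>Y ^ 3\<bar>}"
        by (cases p) simp
    qed
    show "finite ({A :: int. \<bar>of_int A\<bar> \<le> 3 * Y ^ 2} \<times> {B :: int. \<bar>of_int B\<bar> \<le> \<bar>Y ^ 3\<bar>})"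
      using card_int_abs_le(1)[of "3 * Y ^ 2"] card_int_abs_le(1)[of "\<bar>Y ^ 3\<bar>"] by simp
  qed
  ultimately show ?thesis unfolding count_def by simp
qed


text \<open>Here x is the density of L within each trace and v the volume for that trace; the true
  main term is compared with mean density times total volume. The common value v0 cancels because
  there are three traces, and each of the two remaining sums is at most 3 K.\<close>

lemma weighted_sum_deviation:
  fixes x v :: "'a \<Rightarrow> real"
  assumes T: "finite T" "card T = 3" and x: "\<And>t. t \<in> T \<Longrightarrow> 0 \<le> x t \<and> x t \<le> 1"
    and v: "\<And>t. t \<in> T \<Longrightarrow> \<bar>v t - v0\<bar> \<le> K"
  shows "\<bar>(\<Sum>t\<in>T. x t * v t) - (\<Sum>t\<in>T. x t) / 3 * (\<Sum>t\<in>T. v t)\<bar> \<le> 6 * K"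
proof -
  define d where "d = (\<lambda>t. v t - v0)"
  have vd: "v t = v0 + d t" for t by (simp add: d_def)
  have eq: "(\<Sum>t\<in>T. x t * v t) - (\<Sum>t\<in>T. x t) / 3 * (\<Sum>t\<in>T. v t)
      = (\<Sum>t\<in>T. x t * d t) - (\<Sum>t\<in>T. x t) / 3 * (\<Sum>t\<in>T. d t)"
  proof -
    have "(\<Sum>t\<in>T. x t * v t) = (\<Sum>t\<in>T. x t) * v0 + (\<Sum>t\<in>T. x t * d t)"
      by (simp add: vd distrib_left sum.distrib sum_distrib_right)
    moreover have "(\<Sum>t\<in>T. v t) = 3 * v0 + (\<Sum>t\<in>T. d t)"
      using T(2) by (simp add: vd sum.distrib)
    ultimately show ?thesis by (simp add: algebra_simps)
  qed
  have "\<bar>\<Sum>t\<in>T. x t * d t\<bar> \<le> (\<Sum>t\<in>T. 1 * K)"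
  proof (intro order_trans[OF sum_abs sum_mono])
    fix t assume "t \<in> T"
    then show "\<bar>x t * d t\<bar> \<le> 1 * K" unfolding abs_mult using x[of t] v[of t] by (intro mult_mono) (auto simp: d_def)
  qed
  then have 1: "\<bar>\<Sum>t\<in>T. x t * d t\<bar> \<le> 3 * K" using T(2) by simp
  have "\<bar>\<Sum>t\<in>T. d t\<bar> \<le> (\<Sum>t\<in>T. K)"
    using v by (intro order_trans[OF sum_abs sum_mono]) (auto simp: d_def)
  then have 2: "\<bar>\<Sum>t\<in>T. d t\<bar> \<le> 3 * K" using T(2) by simp
  have "(\<Sum>t\<in>T. x t) \<le> (\<Sum>t\<in>T. 1)" using x by (intro sum_mono) auto
  then have "(\<Sum>t\<in>T. x t) \<le> 3" using T(2) by simp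
  moreover have "(\<Sum>t\<in>T. x t) \<ge> 0" using x by (intro sum_nonneg) auto
  ultimately have "\<bar>(\<Sum>t\<in>T. x t) / 3 * (\<Sum>t\<in>T. d t)\<bar> \<le> 1 * (3 * K)"
    unfolding abs_mult using 2 by (intro mult_mono) auto
  with 1 show ?thesis unfolding eq by linarith
qed

lemma nu_defined_mod_le_1:
  assumes "defined_mod m L" "m > 0"
  shows "0 \<le> nu L" "nu L \<le> 1"
proof -
  have "card (residue_pairs m L t) \<le> card ({0..<int m} \<times> {0..<int m})" for t
    by (intro card_mono) auto
  then have "card (reduce m ` L) \<le> (\<Sum>t\<in>{-1, 0, 1::int}. m ^ 2)"
    unfolding defined_mod_card_reduce[OF assms] by (intro sum_mono) (simp add: card_cartesian_product power2_eq_square)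
  then have "real (card (reduce m ` L)) \<le> 3 * real m ^ 2" by (simp flip: of_nat_power)
  then show "0 \<le> nu L" "nu L \<le> 1" using assms(2) by (simp_all add: nu_defined_mod[OF assms])
qed

text \<open>Nothing is counted, so the main term itself has to be an admissible error: each region
  lies in a box of area 12 Y^5, and Y^5 \<le> Y^3.\<close>

lemma count_estimate_small:
  assumes "squarefree n" "n > 0" "defined_mod m L" "m > 0" "0 < Y" "Y \<le> 1"
  shows "\<bar>real (count L n s X Y) - nu L * nu (Sigma_n n) * Vol s X Y\<bar> \<le> 36 * (Y ^ 3 * real m / real n)"
proof -
  have "{(t, a, b) \<in> L \<inter> Sigma_n n. 0 < s * disc t a b \<and> real_of_int (s * disc t a b) < X \<and>
      hgt (of_int t) (of_int a) (of_int b) < Y} = {}"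
    using disc_eq_0_if_hgt_less_1[OF _ assms(6)] by auto
  then have c0: "count L n s X Y = 0" unfolding count_def by (simp only: card.empty)
  have V: "0 \<le> Vol s X Y" "Vol s X Y \<le> (\<Sum>t\<in>{-1, 0, 1::int}. 12 * Y ^ 5)"
    unfolding Vol_eq using measure_region_le[OF assms(5)] by (intro sum_nonneg sum_mono; simp)+
  have "nu L * (1 / real n ^ 2) * Vol s X Y \<le> 1 * (1 / real n) * (36 * Y ^ 3)"
  proof (intro mult_mono)
    show "1 / real n ^ 2 \<le> 1 / real n" using assms(2) by (simp add: power2_eq_square field_simps)
    have "Y ^ 5 \<le> Y ^ 3" using assms by (intro power_decreasing) auto
    then show "Vol s X Y \<le> 36 * Y ^ 3" using V(2) by simp
  qed (use nu_defined_mod_le_1[OF assms(3,4)] V in auto)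
  also have "\<dots> \<le> 36 * (Y ^ 3 * real m / real n)"
    using assms mult_left_mono[of 1 "real m" "Y ^ 3"] by (simp add: divide_right_mono)
  finally have "nu L * (1 / real n ^ 2) * Vol s X Y \<le> 36 * (Y ^ 3 * real m / real n)" .
  moreover have "0 \<le> nu L * (1 / real n ^ 2) * Vol s X Y"
    using nu_defined_mod_le_1[OF assms(3,4)] V by simp
  ultimately show ?thesis unfolding nu_Sigma_n[OF assms(1)] c0 by simp
qed

text \<open>The three traces contribute 3 times 21 C0 and 3 times 6; replacing the weighted volumes
  by the mean density times the total volume adds 6 times 700, and 4200 + 18 = 4218.\<close>

lemma count_estimate_large:
  assumes n: "squarefree n" "n > 0" and m: "m > 0" "coprime n m" and L: "defined_mod m L"
    and X: "X > 0" and Y: "Y \<ge> 1" and s: "s \<in> {1, -1 :: int}"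
    and C0: "\<And>t a. real (card (der_roots n t a)) \<le> C0 * real n powr \<epsilon>"
  shows "\<bar>real (count L n s X Y) - nu L * nu (Sigma_n n) * Vol s X Y\<bar>
    \<le> 63 * C0 * (Y ^ 2 * real m * real n powr \<epsilon>) + 4218 * (Y ^ 3 * real m / real n)"
proof -
  let ?V = "\<lambda>t::int. measure lborel (region (of_int t) (of_int s) X Y)"
  let ?\<Lambda> = "\<lambda>t. residue_pairs m L t"
  let ?T = "\<lambda>t. index_points n L (region (of_int t) (of_int s) X Y) t"
  let ?U = "{-1, 0, 1 :: int}"
  define x where "x = (\<lambda>t. real (card (?\<Lambda> t)) / real m ^ 2)"
  define E where "E = 21 * C0 * (Y ^ 2 * real m * real n powr \<epsilon>) + 6 * (Y ^ 3 * real m / real n)"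
  have LV: "L \<subseteq> VZ" using L by (simp add: defined_mod_def)
  have "\<bar>real (card (?T t)) - x t * ?V t / real n ^ 2\<bar> \<le> E" if "t \<in> ?U" for t
    using card_t_section[OF Y that n(2,1) m L C0, of "of_int s" X] by (simp add: x_def E_def mult.commute)
  then have "(\<Sum>t\<in>?U. \<bar>real (card (?T t)) - x t * ?V t / real n ^ 2\<bar>) \<le> (\<Sum>t\<in>?U. E)"
    by (rule sum_mono)
  then have "\<bar>\<Sum>t\<in>?U. (real (card (?T t)) - x t * ?V t / real n ^ 2)\<bar> \<le> 3 * E"
    using sum_abs[of "\<lambda>t. real (card (?T t)) - x t * ?V t / real n ^ 2" ?U] by simp
  then have 1: "\<bar>real (count L n s X Y) - (\<Sum>t\<in>?U. x t * ?V t) / real n ^ 2\<bar> \<le> 3 * E"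
    unfolding count_eq[OF n(1) s LV] sum_subtractf sum_divide_distrib of_nat_sum .
  have "nu L = (\<Sum>t\<in>?U. x t) / 3"
    unfolding nu_defined_mod[OF L m(1)] defined_mod_card_reduce[OF L m(1)] x_def of_nat_sum sum_divide_distrib[symmetric]
    by simp
  then have main: "nu L * nu (Sigma_n n) * Vol s X Y = (\<Sum>t\<in>?U. x t) / 3 * (\<Sum>t\<in>?U. ?V t) / real n ^ 2"
    unfolding nu_Sigma_n[OF n(1)] Vol_eq by (simp only: times_divide_eq_left times_divide_eq_right mult_1_right)
  have "\<bar>(\<Sum>t\<in>?U. x t * ?V t) - (\<Sum>t\<in>?U. x t) / 3 * (\<Sum>t\<in>?U. ?V t)\<bar> \<le> 6 * (700 * Y ^ 3)"
  proof (rule weighted_sum_deviation)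
    fix t assume t: "t \<in> ?U"
    have "card (?\<Lambda> t) \<le> card ({0..<int m} \<times> {0..<int m})" by (intro card_mono) auto
    then have "real (card (?\<Lambda> t)) \<le> real m ^ 2"
      by (simp add: card_cartesian_product power2_eq_square flip: of_nat_mult)
    then show "0 \<le> x t \<and> x t \<le> 1" using m by (simp add: x_def)
    have "\<bar>of_int t / 3 :: real\<bar> \<le> 1 / 3" using t by auto
    moreover have "real_of_int s \<in> {1, -1}" using s by auto
    ultimately show "\<bar>?V t - measure lborel (region 0 (of_int s) X Y)\<bar> \<le> 700 * Y ^ 3"
      using measure_region_diff[of "of_int s" X Y "of_int t / 3"] X Y by simp
  qed auto
  then have "\<bar>(\<Sum>t\<in>?U. x t * ?V t) - (\<Sum>t\<in>?U. x t) / 3 * (\<Sum>t\<in>?U. ?V t)\<bar> / real n ^ 2 \<le> 4200 * Y ^ 3 / real n ^ 2"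
    by (intro divide_right_mono) auto
  also have "\<bar>(\<Sum>t\<in>?U. x t * ?V t) - (\<Sum>t\<in>?U. x t) / 3 * (\<Sum>t\<in>?U. ?V t)\<bar> / real n ^ 2
      = \<bar>(\<Sum>t\<in>?U. x t * ?V t) / real n ^ 2 - nu L * nu (Sigma_n n) * Vol s X Y\<bar>"
    unfolding main by (simp only: diff_divide_distrib[symmetric] abs_divide abs_power2 abs_of_nat power_abs)
  finally have 2: "\<bar>(\<Sum>t\<in>?U. x t * ?V t) / real n ^ 2 - nu L * nu (Sigma_n n) * Vol s X Y\<bar> \<le> 4200 * Y ^ 3 / real n ^ 2" .
  have "4200 * Y ^ 3 / real n ^ 2 \<le> 4200 * (Y ^ 3 * real m / real n)"
  proof -
    have "real n \<le> real n ^ 2" using n(2) by (simp add: power2_eq_square)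
    then have "4200 * Y ^ 3 / real n ^ 2 \<le> 4200 * Y ^ 3 / real n" using n(2) Y by (intro divide_left_mono) auto
    also have "\<dots> \<le> 4200 * (Y ^ 3 * real m) / real n"
      using m(1) Y mult_left_mono[of 1 "real m" "Y ^ 3"] by (intro divide_right_mono) auto
    finally show ?thesis by simp
  qed
  moreover have "\<bar>u - w\<bar> \<le> 3 * E + l" if "\<bar>u - v\<bar> \<le> 3 * E" "\<bar>v - w\<bar> \<le> k" "k \<le> l" for u v w k l :: real
    using that by linarith
  ultimately have "\<bar>real (count L n s X Y) - nu L * nu (Sigma_n n) * Vol s X Y\<bar>
      \<le> 3 * E + 4200 * (Y ^ 3 * real m / real n)"
    using 1 2 by blast
  then show ?thesis by (simp add: E_def algebra_simps)
qed

theorem theorem3p5: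
  shows "\<forall>\<epsilon>>0. \<exists>C::real. \<forall>(m::nat) (n::nat) L (X::real) (Y::real) (s::int).
    m > 0 \<longrightarrow> n > 0 \<longrightarrow> squarefree n \<longrightarrow> coprime n m \<longrightarrow> defined_mod m L \<longrightarrow>
    X > 0 \<longrightarrow> Y > 0 \<longrightarrow> s \<in> {1, -1} \<longrightarrow>
    \<bar>real (count L n s X Y) - nu L * nu (Sigma_n n) * Vol s X Y\<bar>
      \<le> C * (Y^3 * real m / real n powr (1 - \<epsilon>) + Y^2 * real m * real n powr \<epsilon>)"
proof (intro allI impI)
  fix \<epsilon> :: real assume \<epsilon>: "\<epsilon> > 0"
  obtain C0 where C0: "C0 > 0" "\<And>n t a. squarefree n \<Longrightarrow>
      real (card (der_roots n t a)) \<le> C0 * real n powr \<epsilon>"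
    using card_cubic_der_roots_le[OF \<epsilon>] by metis
  show "\<exists>C::real. \<forall>(m::nat) (n::nat) L (X::real) (Y::real) (s::int).
    m > 0 \<longrightarrow> n > 0 \<longrightarrow> squarefree n \<longrightarrow> coprime n m \<longrightarrow> defined_mod m L \<longrightarrow>
    X > 0 \<longrightarrow> Y > 0 \<longrightarrow> s \<in> {1, -1} \<longrightarrow>
    \<bar>real (count L n s X Y) - nu L * nu (Sigma_n n) * Vol s X Y\<bar>
      \<le> C * (Y^3 * real m / real n powr (1 - \<epsilon>) + Y^2 * real m * real n powr \<epsilon>)"
  proof (intro exI[of _ "63 * C0 + 4218"] allI impI)
    fix m n :: nat and L :: "(int \<times> int \<times> int) set" and X Y :: real and s :: int
    assume *: "m > 0" "n > 0" "squarefree n" "coprime n m" "defined_mod m L" "X > 0" "Y > 0" "s \<in> {1, -1}"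
    define p q where "p = Y ^ 3 * real m / real n powr (1 - \<epsilon>)" and "q = Y ^ 2 * real m * real n powr \<epsilon>"
    have pq: "p \<ge> 0" "q \<ge> 0" using * by (auto simp: p_def q_def)
    \<comment> \<open>The estimates give the first error term with n itself in the denominator;
      \<epsilon> enters only through the number of zeros of f' modulo n.\<close>
    have "real n powr (1 - \<epsilon>) \<le> real n powr 1" using *(2) \<epsilon> by (intro powr_mono) auto
    then have p: "Y ^ 3 * real m / real n \<le> p"
      unfolding p_def using * by (intro divide_left_mono) auto
    have "\<bar>real (count L n s X Y) - nu L * nu (Sigma_n n) * Vol s X Y\<bar> \<le> 63 * C0 * q + 4218 * (Y ^ 3 * real m / real n)"
    proof (cases "Y \<ge> 1")
      case True
      show ?thesis unfolding q_def by (rule count_estimate_large) (use * True C0 in auto)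
    next
      case False
      then have "\<bar>real (count L n s X Y) - nu L * nu (Sigma_n n) * Vol s X Y\<bar> \<le> 36 * (Y ^ 3 * real m / real n)"
        using * by (intro count_estimate_small) auto
      moreover have "0 \<le> 63 * C0 * q" "0 \<le> Y ^ 3 * real m / real n" using pq C0(1) * by auto
      ultimately show ?thesis by linarith
    qed
    also have "\<dots> \<le> 63 * C0 * q + 4218 * p" using p by simp
    also have "\<dots> \<le> (63 * C0 + 4218) * (p + q)"
      using pq C0(1) by (simp add: algebra_simps)
    finally show "\<bar>real (count L n s X Y) - nu L * nu (Sigma_n n) * Vol s X Y\<bar>
      \<le> (63 * C0 + 4218) * (Y^3 * real m / real n powr (1 - \<epsilon>) + Y^2 * real m * real n powr \<epsilon>)"
      unfolding p_def q_def .
  qed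
qed

end
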